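(* Let $p\ge2$, $\alpha_0>-1$, and let $X^{1,p}_\infty=X^{1,p}_\infty(\alpha_0,p-1)$. For $\mu>0$ set $$d_{p,\mu}:=\sup\left\{\int_0^\infty\exp_p\left(\mu|u|^{\frac p{p-1}}\right)r^{\alpha_0}\,dr:\ u\in X^{1,p}_\infty,\ \|u\|_{X^{1,p}_\infty}=1\right\}.$$ (a) If $p>2$ and $0<\mu<\alpha_0+1$, then $d_{p,\mu}$ is attained. (b) If $p=2$ and $2/B_{2,\alpha_0}<\mu<\alpha_0+1$, then $d_{p,\mu}$ is attained, where $$B_{2,\alpha_0}:=\sup_{u\in X^{1,2}_\infty(\alpha_0,1)\setminus\{0\}}\frac{\|u\|^4_{L^4_{\alpha_0}}}{\|u'\|^2_{L^2_1}\|u\|^2_{L^2_{\alpha_0}}}.$$ Here "attained" means that there exists $u\in X^{1,p}_\infty$ with $\|u\|_{X^{1,p}_\infty}=1$ and $\int_0^\infty\exp_p\left(\mu|u|^{\frac p{p-1}}\right)r^{\alpha_0}\,dr=d_{p,\mu}$.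
   Context: For $q\ge1$ and $\theta\in\mathbb R$, $L^q_\theta=L^q_\theta(0,\infty)$ is the space of measurable $u:(0,\infty)\to\mathbb R$ with $\|u\|_{L^q_\theta}=\left(\int_0^\infty|u|^q r^\theta\,dr\right)^{1/q}<\infty$. $X^{1,p}_\infty(\alpha_0,p-1)$ is the space of functions $u:(0,\infty)\to\mathbb R$ with $u\in L^p_{\alpha_0}$ and weak derivative $u'\in L^p_{p-1}$, with norm $\|u\|_{X^{1,p}_\infty}=\left(\|u'\|^p_{L^p_{p-1}}+\|u\|^p_{L^p_{\alpha_0}}\right)^{1/p}$. For real $p\ge1$ and $t\ge0$, $\exp_p(t):=\sum_{j=0}^\infty\dfrac{t^{p-1+j}}{\Gamma(p+j)}$. *)

theory Defs
  imports "HOL-Analysis.Analysis"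
begin

text \<open>Functions on \<open>(0, \<infinity>)\<close> are represented by total functions of type \<open>real \<Rightarrow> real\<close>. Every notion
  below only looks at their values on \<open>{0<..}\<close>.\<close>

(* Only used with a > 0; the convention \<infinity> powr a = \<infinity> is wrong for a \<le> 0. *)
definition ennpowr :: "ennreal \<Rightarrow> real \<Rightarrow> ennreal" where
  "ennpowr x a = (if x = \<infinity> then \<infinity> else ennreal (enn2real x powr a))"

definition wnorm :: "real \<Rightarrow> real \<Rightarrow> (real \<Rightarrow> real) \<Rightarrow> ennreal" where
  "wnorm q \<theta> u =
     ennpowr (\<integral>\<^sup>+r\<in>{0<..}. ennreal (\<bar>u r\<bar> powr q * r powr \<theta>) \<partial>lebesgue) (1 / q)"

definition wLp :: "real \<Rightarrow> real \<Rightarrow> (real \<Rightarrow> real) set" where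
  "wLp q \<theta> = {u. u \<in> borel_measurable (lebesgue_on {0<..}) \<and> wnorm q \<theta> u < \<infinity>}"

definition test_function :: "(real \<Rightarrow> real) \<Rightarrow> bool" where
  "test_function \<phi> \<longleftrightarrow>
     (\<forall>n x. (deriv ^^ n) \<phi> differentiable (at x)) \<and>
     compact (closure {x. \<phi> x \<noteq> 0}) \<and> closure {x. \<phi> x \<noteq> 0} \<subseteq> {0<..}"

definition locally_integrable :: "(real \<Rightarrow> real) \<Rightarrow> bool" where
  "locally_integrable u \<longleftrightarrow> (\<forall>K. compact K \<and> K \<subseteq> {0<..} \<longrightarrow> set_integrable lebesgue K u)"

definition has_weak_deriv :: "(real \<Rightarrow> real) \<Rightarrow> (real \<Rightarrow> real) \<Rightarrow> bool" where
  "has_weak_deriv u v \<longleftrightarrow>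
     locally_integrable u \<and> locally_integrable v \<and>
     (\<forall>\<phi>. test_function \<phi> \<longrightarrow>
        (LINT r:{0<..}|lebesgue. u r * deriv \<phi> r) = - (LINT r:{0<..}|lebesgue. v r * \<phi> r))"

(* A representative of the weak derivative, which is determined up to a null set of (0, \<infinity>). *)
definition weak_deriv :: "(real \<Rightarrow> real) \<Rightarrow> real \<Rightarrow> real" where
  "weak_deriv u = (SOME v. has_weak_deriv u v)"

text \<open>The space \<open>X\<close> with exponent \<open>p\<close> and weights \<open>r powr \<alpha>\<close> (for \<open>u\<close>) and \<open>r powr (p - 1)\<close>
  (for \<open>u'\<close>).\<close>

definition X_space :: "real \<Rightarrow> real \<Rightarrow> (real \<Rightarrow> real) set" where
  "X_space p \<alpha> =
     {u. u \<in> wLp p \<alpha> \<and> (\<exists>v. has_weak_deriv u v) \<and> weak_deriv u \<in> wLp p (p - 1)}"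

definition X_norm :: "real \<Rightarrow> real \<Rightarrow> (real \<Rightarrow> real) \<Rightarrow> ennreal" where
  "X_norm p \<alpha> u =
     ennpowr (ennpowr (wnorm p (p - 1) (weak_deriv u)) p + ennpowr (wnorm p \<alpha> u) p) (1 / p)"

(* For p > 1. If p = 1 the value at t = 0 is off, since 0 powr 0 = 0. *)
definition exp_p :: "real \<Rightarrow> real \<Rightarrow> real" where
  "exp_p p t = (\<Sum>j. t powr (p - 1 + real j) / Gamma (p + real j))"

definition TM_functional :: "real \<Rightarrow> real \<Rightarrow> real \<Rightarrow> (real \<Rightarrow> real) \<Rightarrow> ennreal" where
  "TM_functional p \<alpha> \<mu> u =
     (\<integral>\<^sup>+r\<in>{0<..}. ennreal (exp_p p (\<mu> * \<bar>u r\<bar> powr (p / (p - 1))) * r powr \<alpha>) \<partial>lebesgue)"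

definition TM_sup :: "real \<Rightarrow> real \<Rightarrow> real \<Rightarrow> ennreal" where
  "TM_sup p \<alpha> \<mu> = (SUP u\<in>{u \<in> X_space p \<alpha>. X_norm p \<alpha> u = 1}. TM_functional p \<alpha> \<mu> u)"

definition TM_attained :: "real \<Rightarrow> real \<Rightarrow> real \<Rightarrow> bool" where
  "TM_attained p \<alpha> \<mu> \<longleftrightarrow>
     (\<exists>u\<in>X_space p \<alpha>. X_norm p \<alpha> u = 1 \<and> TM_functional p \<alpha> \<mu> u = TM_sup p \<alpha> \<mu>)"

(* The zero element of the space is the class of functions vanishing a.e. on (0, \<infinity>). *)
definition B2 :: "real \<Rightarrow> ennreal" where
  "B2 \<alpha> =
     (SUP u\<in>{u \<in> X_space 2 \<alpha>. \<not> (AE r in lebesgue_on {0<..}. u r = 0)}.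
        wnorm 4 \<alpha> u ^ 4 / (wnorm 2 1 (weak_deriv u) ^ 2 * wnorm 2 \<alpha> u ^ 2))"

end

theory Submission
  imports Defs "HOL-Complex_Analysis.Great_Picard"
begin

text \<open>
  Write the functional as \<open>c \<parallel>u\<parallel>\<^sup>p + R(u)\<close>, where \<open>c = \<mu>\<^sup>p\<^sup>-\<^sup>1 / \<Gamma>(p)\<close> comes from the first term of
  \<open>exp_p\<close>. Since \<open>\<mu> < \<alpha> + 1\<close>, the remainder \<open>R\<close> is continuous along bounded sequences converging
  pointwise: near \<open>0\<close> it is dominated by means of \<open>\<bar>u(r) - u(s)\<bar> \<le> \<parallel>u'\<parallel> (ln (s/r))\<^sup>1\<^sup>-\<^sup>1\<^sup>/\<^sup>p\<close>, and at
  infinity it is of higher order than \<open>\<bar>u\<bar>\<^sup>p\<close>. Let a maximizing sequence converge pointwise to \<open>u\<close>, with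
  \<open>\<parallel>u\<^sub>n'\<parallel>\<^sup>p \<rightarrow> A\<close> and \<open>\<parallel>u\<^sub>n\<parallel>\<^sup>p \<rightarrow> B\<close>, so that \<open>A + B = 1\<close> and the supremum is \<open>d = c B + R(u)\<close>. If
  \<open>u \<noteq> 0\<close>, the dilation \<open>u(\<lambda> r)\<close> with \<open>\<parallel>u(\<lambda> \<cdot>)\<parallel>\<^sup>p = B\<close> keeps \<open>\<parallel>u'\<parallel>\<^sup>p \<le> A\<close> and does not decrease \<open>R\<close>;
  after normalization it is a maximizer. If \<open>u = 0\<close>, then \<open>d \<le> c\<close>, which is ruled out by testing with
  strongly dilated functions: their functional exceeds \<open>c\<close> because of the second term of \<open>exp_p\<close>,
  automatically for \<open>p > 2\<close> and by the bound on \<open>B2\<close> for \<open>p = 2\<close>.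
\<close>

section \<open>Test functions\<close>

text \<open>Because the derivative carries the weight \<open>r powr (p - 1)\<close>, its energy is
  invariant under dilations, while all integrals with weight \<open>r powr \<alpha>\<close> scale by
  one common factor; this is why lost mass can be restored at no cost. The threshold
  \<open>\<alpha> + 1\<close> arises as follows: up to a factor close to 1 the increment bound lets
  \<open>\<bar>u r\<bar> powr p'\<close> grow at most like \<open>ln (1 / r)\<close> near 0, so the
  exponential grows like a power of \<open>1 / r\<close> that \<open>r powr \<alpha>\<close> can
  still compensate. For the test by dilation, let the weighted integrals be multiplied by a large
  \<open>x\<close> and then normalize: the leading term stays below \<open>c\<close> by an amount of
  order \<open>1 / x\<close>, and the second term of \<open>exp_p\<close> contributes an amount of
  order \<open>x powr (- 1 / (p - 1))\<close>. The gain wins for \<open>p > 2\<close>; for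
  \<open>p = 2\<close> the orders agree and constants must be compared, which is where
  \<open>B2\<close> enters. The main obstacle is that pointwise convergence gives no limit for the
  derivatives. The bound on the derivative of the limit is obtained without weak compactness, from
  uniform convexity applied to convex sets of functions whose values are close to those of the
  limit.\<close>

definition smooth :: "(real \<Rightarrow> real) \<Rightarrow> bool" where
  "smooth f \<longleftrightarrow> (\<forall>n x. (deriv ^^ n) f differentiable (at x))"

text \<open>Dividing by powers of \<open>x\<close> makes the family closed under differentiation:
  the derivative of index \<open>k\<close> is a combination of the indices \<open>k + 1\<close> and
  \<open>k + 2\<close>.\<close>

definition flat_exp :: "nat \<Rightarrow> real \<Rightarrow> real" where
  "flat_exp k x = (if x > 0 then exp (- (1 / x)) / x ^ k else 0)"

text \<open>Differentiation stays inside this algebra, so membership alone yields smoothness and no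
  higher derivative is ever computed. The affine arguments provide cut-offs at both ends of an
  interval.\<close>

inductive_set flat_alg :: "(real \<Rightarrow> real) set" where
  const: "(\<lambda>_. c) \<in> flat_alg"
| flat: "(\<lambda>x. flat_exp k (m * x + b)) \<in> flat_alg"
| add: "f \<in> flat_alg \<Longrightarrow> g \<in> flat_alg \<Longrightarrow> (\<lambda>x. f x + g x) \<in> flat_alg"
| mult: "f \<in> flat_alg \<Longrightarrow> g \<in> flat_alg \<Longrightarrow> (\<lambda>x. f x * g x) \<in> flat_alg"

lemma flat_exp_nonneg: "flat_exp k x \<ge> 0"
  by (simp add: flat_exp_def)

text \<open>For \<open>x > 0\<close> a single term of the series of \<open>exp (1 / x)\<close>, that
  of index \<open>k + 2\<close>, is enough. Order two at the origin makes the difference quotient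
  there tend to 0.\<close>

lemma flat_exp_le_square: "flat_exp k x \<le> fact (k + 2) * x\<^sup>2"
proof (cases "x > 0")
  case True
  define n where "n = k + 2"
  have "(1 / x) ^ n /\<^sub>R fact n \<le> (\<Sum>i. (1 / x) ^ i /\<^sub>R fact i)"
    using sum_le_suminf[OF summable_exp_generic[of "1 / x"], of "{n}"] True by simp
  then have "(1 / x) ^ n / fact n \<le> exp (1 / x)"
    by (simp add: exp_def divide_inverse mult.commute)
  then have "1 \<le> exp (1 / x) * (fact n * x ^ n)"
    using True by (simp add: field_simps power_divide)
  then have "exp (- (1 / x)) \<le> fact n * x ^ n"
    by (simp add: exp_minus field_simps)
  then show ?thesis
    using True by (simp add: flat_exp_def n_def power_add field_simps power2_eq_square)
next
  case False
  then show ?thesis by (simp add: flat_exp_def)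
qed

lemma flat_exp_deriv:
  "(flat_exp k has_real_derivative (flat_exp (k + 2) x - real k * flat_exp (k + 1) x)) (at x)"
proof -
  consider "x > 0" | "x < 0" | "x = 0" by linarith
  then show ?thesis
  proof cases
    case 1
    have "((\<lambda>x. exp (- (1 / x)) / x ^ k) has_real_derivative
        (exp (- (1 / x)) * (1 / x\<^sup>2) * x ^ k - exp (- (1 / x)) * (real k * x ^ (k - 1))) / (x ^ k * x ^ k)) (at x)"
      using 1 by (auto intro!: derivative_eq_intros simp: power2_eq_square)
    moreover have "(exp (- (1 / x)) * (1 / x\<^sup>2) * x ^ k - exp (- (1 / x)) * (real k * x ^ (k - 1))) / (x ^ k * x ^ k)
        = flat_exp (k + 2) x - real k * flat_exp (k + 1) x"
      using 1 by (cases k) (auto simp: flat_exp_def field_simps power2_eq_square power_add)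
    moreover have "\<forall>\<^sub>F y in at x. flat_exp k y = exp (- (1 / y)) / y ^ k"
      using eventually_at_in_open'[of "{0<..}" x] 1
      by (auto simp: flat_exp_def elim: eventually_mono)
    ultimately show ?thesis
      using has_field_derivative_cong_eventually[of "flat_exp k" "\<lambda>x. exp (- (1 / x)) / x ^ k" x UNIV] 1
      by (simp add: flat_exp_def)
  next
    case 2
    have "\<forall>\<^sub>F y in at x. flat_exp k y = 0"
      using eventually_at_in_open'[of "{..<0}" x] 2
      by (auto simp: flat_exp_def elim: eventually_mono)
    then show ?thesis
      using has_field_derivative_cong_eventually[of "flat_exp k" "\<lambda>x. 0" x UNIV] 2
      by (simp add: flat_exp_def)
  next
    case 3
    have "((\<lambda>h. flat_exp k h / h) \<longlongrightarrow> 0) (at 0)"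
    proof (rule Lim_null_comparison)
      have "norm (flat_exp k h / h) \<le> fact (k + 2) * \<bar>h\<bar>" for h :: real
      proof (cases "h = 0")
        case False
        have "norm (flat_exp k h / h) \<le> fact (k + 2) * h\<^sup>2 / \<bar>h\<bar>"
          using flat_exp_le_square[of k h] flat_exp_nonneg[of k h] by (simp add: divide_right_mono)
        also have "\<dots> = fact (k + 2) * (\<bar>h\<bar> * \<bar>h\<bar>) / \<bar>h\<bar>"
          by (simp add: power2_eq_square)
        also have "\<dots> = fact (k + 2) * \<bar>h\<bar>" using False by (simp del: abs_mult_self_eq)
        finally show ?thesis .
      qed simp
      then show "\<forall>\<^sub>F h in at 0. norm (flat_exp k h / h) \<le> fact (k + 2) * \<bar>h\<bar>"
        by (simp add: always_eventually)
      show "((\<lambda>h. fact (k + 2) * \<bar>h\<bar>) \<longlongrightarrow> 0) (at (0::real))"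
        by (auto intro!: tendsto_eq_intros)
    qed
    then show ?thesis
      using 3 by (simp add: DERIV_def flat_exp_def)
  qed
qed

lemma flat_alg_deriv:
  assumes "f \<in> flat_alg"
  shows "\<exists>g\<in>flat_alg. \<forall>x. (f has_real_derivative g x) (at x)"
  using assms
proof induction
  case (const c)
  then show ?case by (intro bexI[of _ "\<lambda>_. 0"]) (auto intro: flat_alg.const)
next
  case (flat k m b)
  show ?case
  proof (intro bexI allI)
    fix x
    have lin: "((\<lambda>x. m * x + b) has_real_derivative m) (at x)"
      by (auto intro!: derivative_eq_intros)
    show "((\<lambda>x. flat_exp k (m * x + b)) has_real_derivative
        (flat_exp (k + 2) (m * x + b) + (- real k) * flat_exp (k + 1) (m * x + b)) * m) (at x)"
      using DERIV_chain2[OF flat_exp_deriv lin] by simp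
  qed (intro flat_alg.intros)
next
  case (add f g)
  then obtain f' g' where "f' \<in> flat_alg" "g' \<in> flat_alg"
    "\<forall>x. (f has_real_derivative f' x) (at x)" "\<forall>x. (g has_real_derivative g' x) (at x)"
    by blast
  then show ?case
    by (intro bexI[of _ "\<lambda>x. f' x + g' x"]) (auto intro!: DERIV_add flat_alg.add)
next
  case (mult f g)
  then obtain f' g' where "f' \<in> flat_alg" "g' \<in> flat_alg"
    "\<forall>x. (f has_real_derivative f' x) (at x)" "\<forall>x. (g has_real_derivative g' x) (at x)"
    by blast
  with mult show ?case
    by (intro bexI[of _ "\<lambda>x. f' x * g x + g' x * f x"])
       (auto intro!: DERIV_mult flat_alg.add flat_alg.mult)
qed

lemma flat_alg_deriv_closed:
  assumes "f \<in> flat_alg"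
  shows "deriv f \<in> flat_alg"
proof -
  obtain g where "g \<in> flat_alg" "\<forall>x. (f has_real_derivative g x) (at x)"
    using flat_alg_deriv[OF assms] by blast
  moreover from this have "deriv f = g" by (intro ext) (auto intro: DERIV_imp_deriv)
  ultimately show ?thesis by simp
qed

lemma smooth_flat_alg:
  assumes "f \<in> flat_alg"
  shows "smooth f"
proof -
  have "(deriv ^^ n) f \<in> flat_alg" for n
    by (induction n) (auto simp: assms flat_alg_deriv_closed)
  then show ?thesis
    unfolding smooth_def by (meson flat_alg_deriv real_differentiable_def)
qed

lemma smooth_continuous: "smooth f \<Longrightarrow> continuous_on UNIV f"
  unfolding smooth_def
  by (metis continuous_at_imp_continuous_on differentiable_imp_continuous_within funpow_0)

lemma smooth_of_deriv:
  assumes "\<And>x. (f has_real_derivative g x) (at x)" "smooth g"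
  shows "smooth f"
  unfolding smooth_def
proof (intro allI)
  fix n x
  have "deriv f = g" using assms(1) by (intro ext) (auto intro: DERIV_imp_deriv)
  then show "(deriv ^^ n) f differentiable (at x)"
    using assms by (cases n) (auto simp: smooth_def funpow_Suc_right real_differentiable_def simp del: funpow.simps)
qed

text \<open>The parameter \<open>n\<close> steepens both flanks, so that the bumps approach the
  indicator of the open interval while staying below 1.\<close>

definition bump :: "real \<Rightarrow> real \<Rightarrow> nat \<Rightarrow> real \<Rightarrow> real" where
  "bump a b n x = flat_exp 0 (real n * (x - a)) * flat_exp 0 (real n * (b - x))"

lemma bump_flat_alg: "bump a b n \<in> flat_alg"
proof -
  have "(\<lambda>x. flat_exp 0 (real n * x + - (real n * a)) * flat_exp 0 (- real n * x + real n * b)) \<in> flat_alg"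
    by (intro flat_alg.intros)
  moreover have "bump a b n = (\<lambda>x. flat_exp 0 (real n * x + - (real n * a)) * flat_exp 0 (- real n * x + real n * b))"
    by (auto simp: bump_def fun_eq_iff algebra_simps)
  ultimately show ?thesis by simp
qed

lemma bump_bounds: "0 \<le> bump a b n x" "bump a b n x \<le> 1"
proof -
  have "flat_exp 0 y \<le> 1" for y by (simp add: flat_exp_def)
  then show "0 \<le> bump a b n x" "bump a b n x \<le> 1"
    by (auto simp: bump_def flat_exp_nonneg intro!: mult_le_one)
qed

lemma bump_outside: "x \<notin> {a<..<b} \<Longrightarrow> bump a b n x = 0"
  by (auto simp: bump_def flat_exp_def zero_less_mult_iff)

lemma bump_inside: "x \<in> {a<..<b} \<Longrightarrow> n > 0 \<Longrightarrow> bump a b n x > 0"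
  by (auto simp: bump_def flat_exp_def zero_less_mult_iff)

lemma bump_tendsto: "(\<lambda>n. bump a b n x) \<longlonglongrightarrow> indicator {a<..<b} x"
proof (cases "x \<in> {a<..<b}")
  case True
  have *: "(\<lambda>n. flat_exp 0 (real n * c)) \<longlonglongrightarrow> 1" if "c > 0" for c
  proof -
    have "(\<lambda>n. exp (- (1 / c) * (1 / real n))) \<longlonglongrightarrow> exp (- (1 / c) * 0)"
      by (intro tendsto_intros lim_1_over_n)
    moreover have "\<forall>\<^sub>F n in sequentially. exp (- (1 / c) * (1 / real n)) = flat_exp 0 (real n * c)"
      using eventually_gt_at_top[of 0]
      by eventually_elim (use that in \<open>auto simp: flat_exp_def field_simps\<close>)
    ultimately show ?thesis by (simp add: tendsto_cong)
  qed
  have "(\<lambda>n. flat_exp 0 (real n * (x - a)) * flat_exp 0 (real n * (b - x))) \<longlonglongrightarrow> 1 * 1"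
    using True by (intro tendsto_mult *) auto
  then show ?thesis using True by (simp add: bump_def)
next
  case False
  then show ?thesis by (simp add: bump_outside)
qed

lemma test_functionI:
  assumes "smooth \<phi>" "0 < a" "\<And>x. x \<notin> {a..b} \<Longrightarrow> \<phi> x = 0"
  shows "test_function \<phi>"
proof -
  have sub: "closure {x. \<phi> x \<noteq> 0} \<subseteq> {a..b}"
    using assms(3) by (intro closure_minimal) (blast, auto)
  moreover have "compact (closure {x. \<phi> x \<noteq> 0})"
    using closed_closure compact_Int_closed[OF compact_Icc] Int_absorb1[OF sub] by metis
  ultimately show ?thesis
    using assms unfolding test_function_def smooth_def by fastforce
qed

lemma test_function_bump: "0 < a \<Longrightarrow> test_function (bump a b n)"
  by (rule test_functionI[of _ a b]) (auto intro: smooth_flat_alg bump_flat_alg bump_outside)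

lemma compact_positive_subset_Icc:
  assumes "compact K" "K \<subseteq> {0<..}"
  obtains a b :: real where "0 < a" "a < b" "K \<subseteq> {a..b}"
proof (cases "K = {}")
  case True
  then show ?thesis using that[of 1 2] by auto
next
  case False
  obtain m where m: "m \<in> K" "\<And>x. x \<in> K \<Longrightarrow> m \<le> x" using compact_attains_inf[OF assms(1) False] by blast
  obtain M where M: "M \<in> K" "\<And>x. x \<in> K \<Longrightarrow> x \<le> M" using compact_attains_sup[OF assms(1) False] by blast
  show ?thesis using that[of m "M + 1"] m M assms by fastforce
qed

lemma test_functionE:
  assumes "test_function \<phi>"
  obtains a b where "0 < a" "a < b" "\<And>x. x \<notin> {a<..<b} \<Longrightarrow> \<phi> x = 0"
    "\<And>x. x \<notin> {a<..<b} \<Longrightarrow> deriv \<phi> x = 0"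
    "\<And>x. (\<phi> has_real_derivative deriv \<phi> x) (at x)" "continuous_on UNIV (deriv \<phi>)" "smooth \<phi>"
proof -
  define K where "K = closure {x. \<phi> x \<noteq> 0}"
  have K: "compact K" "K \<subseteq> {0<..}" using assms by (auto simp: test_function_def K_def)
  have diff: "(deriv ^^ n) \<phi> differentiable (at x)" for n x
    using assms by (auto simp: test_function_def)
  obtain a b where ab: "0 < a" "a < b" "K \<subseteq> {a..b}"
    using compact_positive_subset_Icc[OF K] .
  have zero: "\<phi> x = 0" if "x \<notin> {a..b}" for x
    using that ab closure_subset[of "{x. \<phi> x \<noteq> 0}"] by (auto simp: K_def)
  have zero': "deriv \<phi> x = 0" if "x \<notin> {a..b}" for x
  proof -
    have "\<forall>\<^sub>F y in nhds x. \<phi> y = (\<lambda>_. 0) y"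
      by (rule eventually_mono[OF eventually_nhds_in_open[of "- {a..b}" x]])
         (use that zero in blast)+
    then have "deriv \<phi> x = deriv (\<lambda>_. 0) x" by (intro deriv_cong_ev) auto
    then show ?thesis by simp
  qed
  show ?thesis
  proof (rule that)
    \<comment> \<open>Widening the interval makes the function vanish at both end points too, which
      removes the boundary terms in integration by parts.\<close>
    show "a / 2 > 0" "a / 2 < b + 1" using ab by auto
    show "\<phi> x = 0" "deriv \<phi> x = 0" if "x \<notin> {a / 2<..<b + 1}" for x
      using that ab zero[of x] zero'[of x] by auto
    show "smooth \<phi>" using diff by (simp add: smooth_def)
    show "(\<phi> has_real_derivative deriv \<phi> x) (at x)" for x
      using diff[of 0 x] by (simp add: DERIV_deriv_iff_real_differentiable)
    show "continuous_on UNIV (deriv \<phi>)"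
      using diff[of 1] by (auto intro!: continuous_at_imp_continuous_on differentiable_imp_continuous_within)
  qed
qed

section \<open>Functions that vanish almost everywhere when tested\<close>

text \<open>By Lebesgue differentiation, \<open>f x\<close> is for almost every \<open>x\<close> the
  limit of the means of \<open>f\<close> over \<open>[x, x + h]\<close>, and all these means are
  0.\<close>

lemma AE_zero_of_interval_integrals:
  fixes f :: "real \<Rightarrow> real"
  assumes f: "integrable lebesgue f" and z: "\<And>a b. a < b \<Longrightarrow> (LINT r:{a..b}|lebesgue. f r) = 0"
  shows "AE x in lebesgue. f x = 0"
proof -
  have fi: "f integrable_on cbox a b" and fe: "integral (cbox a b) f = (LINT r:{a..b}|lebesgue. f r)" for a b
  proof -
    have "set_integrable lebesgue {a..b} f"
      unfolding set_integrable_def by (intro integrable_mult_indicator f) auto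
    from set_lebesgue_integral_eq_integral[OF this]
    show "f integrable_on cbox a b" "integral (cbox a b) f = (LINT r:{a..b}|lebesgue. f r)" by auto
  qed
  obtain N where N: "negligible N" "\<And>x e. \<lbrakk>x \<notin> N; 0 < e\<rbrakk> \<Longrightarrow>
     \<exists>d>0. \<forall>h. 0 < h \<and> h < d \<longrightarrow>
            norm (integral (cbox x (x + h *\<^sub>R One)) f /\<^sub>R h ^ DIM(real) - f x) < e"
    using integrable_ccontinuous_explicit[of f] fi by metis
  have "f x = 0" if xN: "x \<notin> N" for x
  proof (rule ccontr)
    assume "f x \<noteq> 0"
    then obtain d where "d > 0" and d: "\<forall>h. 0 < h \<and> h < d \<longrightarrow>
            norm (integral (cbox x (x + h *\<^sub>R One)) f /\<^sub>R h ^ DIM(real) - f x) < \<bar>f x\<bar>"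
      using N(2)[OF xN, of "\<bar>f x\<bar>"] by auto
    from d[rule_format, of "d / 2"] z[of x "x + d / 2"] fe[of x "x + d / 2"] \<open>d > 0\<close> show False by simp
  qed
  then have "{x. f x \<noteq> 0} \<subseteq> N" by auto
  then have "{x. f x \<noteq> 0} \<in> null_sets lebesgue"
    using N(1) by (meson negligible_iff_null_sets negligible_subset)
  from AE_not_in[OF this] show ?thesis by auto
qed

text \<open>Bumps converge boundedly to the indicator of an interval, so dominated convergence turns
  the hypothesis into vanishing integrals over intervals.\<close>

lemma fundamental_lemma_variations:
  assumes f: "locally_integrable f"
    and z: "\<And>\<phi>. test_function \<phi> \<Longrightarrow> (LINT r:{0<..}|lebesgue. f r * \<phi> r) = 0"
  shows "AE r in lebesgue. r > 0 \<longrightarrow> f r = 0"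
proof -
  have op: "(LINT r:{a<..<b}|lebesgue. f r) = 0" if "0 < a" "a < b" for a b
  proof -
    have si: "set_integrable lebesgue {a..b} f"
      using f[unfolded locally_integrable_def, rule_format, of "{a..b}"] that
      by (simp add: subset_eq)
    then have fi: "integrable lebesgue (\<lambda>x. indicator {a..b} x * f x)"
      by (simp add: set_integrable_def)
    have eq: "indicator {0<..} r * (f r * bump a b n r) = indicator {a..b} r * f r * bump a b n r" for r n
      using that bump_outside[of r a b n] by (auto simp: indicator_def)
    have meas: "bump a b n \<in> borel_measurable lebesgue" for n
      using smooth_continuous[OF smooth_flat_alg[OF bump_flat_alg[of a b n]]]
      by (simp add: borel_measurable_continuous_onI measurable_completion)
    have "(\<lambda>n. \<integral>r. indicator {a..b} r * f r * bump a b n r \<partial>lebesgue) \<longlonglongrightarrow>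
        (\<integral>r. indicator {a..b} r * f r * indicator {a<..<b} r \<partial>lebesgue)"
    proof (rule integral_dominated_convergence[where w = "\<lambda>r. norm (indicator {a..b} r * f r)"])
      show "AE r in lebesgue. norm (indicator {a..b} r * f r * bump a b n r) \<le> norm (indicator {a..b} r * f r)" for n
        using bump_bounds[of a b n] by (auto simp: abs_mult intro!: mult_left_le)
      show "AE r in lebesgue. (\<lambda>n. indicator {a..b} r * f r * bump a b n r) \<longlonglongrightarrow> indicator {a..b} r * f r * indicator {a<..<b} r"
        by (intro AE_I2 tendsto_mult tendsto_const bump_tendsto)
      show "(\<lambda>r. indicator {a..b} r * f r * indicator {a<..<b} r) \<in> borel_measurable lebesgue"
        by (rule borel_measurable_times[OF borel_measurable_integrable[OF fi] borel_measurable_indicator]) simp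
      show "(\<lambda>r. indicator {a..b} r * f r * bump a b n r) \<in> borel_measurable lebesgue" for n
        by (rule borel_measurable_times[OF borel_measurable_integrable[OF fi] meas])
      show "integrable lebesgue (\<lambda>r. norm (indicator {a..b} r * f r))" using fi by (rule integrable_norm)
    qed
    moreover have "(\<integral>r. indicator {a..b} r * f r * bump a b n r \<partial>lebesgue) = 0" for n
      using z[OF test_function_bump[OF that(1), of b n]] by (simp add: set_lebesgue_integral_def eq)
    moreover have "indicator {a..b} r * f r * indicator {a<..<b} r = indicator {a<..<b} r * f r" for r
      by (auto simp: indicator_def)
    ultimately show ?thesis
      by (simp add: set_lebesgue_integral_def LIMSEQ_const_iff)
  qed
  \<comment> \<open>\<open>f\<close> is only locally integrable. Truncation to these intervals makes
    it integrable on the line, and countably many of them exhaust the half-line.\<close>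
  have "AE r in lebesgue. indicator {inverse (Suc n)<..<real (Suc n)} r * f r = 0" for n
  proof (rule AE_zero_of_interval_integrals)
    define A where "A = inverse (real (Suc n))"
    define B where "B = real (Suc n)"
    have A: "0 < A" by (simp add: A_def)
    have "set_integrable lebesgue {A..B} f"
      using f[unfolded locally_integrable_def, rule_format, of "{A..B}"] A
      by (simp add: subset_eq)
    then have si: "set_integrable lebesgue {A<..<B} f"
      by (rule set_integrable_subset) auto
    then show "integrable lebesgue (\<lambda>r. indicator {inverse (Suc n)<..<real (Suc n)} r * f r)"
      by (simp add: set_integrable_def A_def B_def)
    fix a b :: real
    assume "a < b"
    have "(LINT r:{a..b}|lebesgue. indicator {A<..<B} r * f r) = (LINT r:{max a A<..<min b B}|lebesgue. f r)"
      unfolding set_lebesgue_integral_def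
    proof (rule integral_cong_AE)
      have "AE r in lebesgue. r \<notin> {a, b}"
        by (intro AE_not_in) (simp add: negligible_iff_null_sets[symmetric])
      then show "AE r in lebesgue. indicat_real {a..b} r *\<^sub>R (indicat_real {A<..<B} r * f r) = indicat_real {max a A<..<min b B} r *\<^sub>R f r"
        by eventually_elim (auto simp: indicator_def)
      show "(\<lambda>r. indicat_real {a..b} r *\<^sub>R (indicat_real {A<..<B} r * f r)) \<in> borel_measurable lebesgue"
        unfolding real_scaleR_def
        by (rule borel_measurable_times[OF borel_measurable_indicator
              borel_measurable_integrable[OF si[unfolded set_integrable_def real_scaleR_def]]]) simp
      have "set_integrable lebesgue {max a A<..<min b B} f"
        using si by (rule set_integrable_subset) auto
      then show "(\<lambda>r. indicat_real {max a A<..<min b B} r *\<^sub>R f r) \<in> borel_measurable lebesgue"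
        unfolding set_integrable_def by (rule borel_measurable_integrable)
    qed
    also have "\<dots> = 0"
    proof (cases "max a A < min b B")
      case True
      then show ?thesis using A by (intro op) auto
    next
      case False
      then have "{max a A<..<min b B} = {}" by (auto simp: not_less)
      then show ?thesis by (simp add: set_lebesgue_integral_def)
    qed
    finally show "(LINT r:{a..b}|lebesgue. indicator {inverse (Suc n)<..<real (Suc n)} r * f r) = 0"
      by (simp add: A_def B_def)
  qed
  then have "AE r in lebesgue. \<forall>n. indicator {inverse (Suc n)<..<real (Suc n)} r * f r = 0"
    unfolding AE_all_countable by blast
  then show ?thesis
  proof eventually_elim
    case (elim r)
    show ?case
    proof
      assume "r > 0"
      obtain n1 where "inverse (real (Suc n1)) < r" using \<open>r > 0\<close> reals_Archimedean by blast
      obtain n2 where "r < real n2" using reals_Archimedean2 by blast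
      define n where "n = max n1 n2"
      have "inverse (real (Suc n)) \<le> inverse (real (Suc n1))" by (simp add: n_def)
      then have "inverse (real (Suc n)) < r" using \<open>inverse (real (Suc n1)) < r\<close> by linarith
      moreover have "r < real (Suc n)" using \<open>r < real n2\<close> by (simp add: n_def)
      ultimately show "f r = 0" using elim[rule_format, of n] by (simp add: indicator_def)
    qed
  qed
qed

section \<open>Weak derivatives and primitives\<close>

text \<open>The good representative of an element of the space: \<open>U\<close> is locally
  absolutely continuous on the half-line with derivative \<open>g\<close>. Both are Borel, so that
  product measures and \<open>lborel\<close> can be used. The value 0 off the half-line turns
  pointwise limits there into limits on the whole line, which gives their measurability.\<close>

definition primitive_pair :: "(real \<Rightarrow> real) \<Rightarrow> (real \<Rightarrow> real) \<Rightarrow> bool" where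
  "primitive_pair U g \<longleftrightarrow> U \<in> borel_measurable borel \<and> g \<in> borel_measurable borel \<and>
     (\<forall>r\<le>0. U r = 0) \<and>
     (\<forall>s t. 0 < s \<longrightarrow> s \<le> t \<longrightarrow> set_integrable lborel {s..t} g \<and> U t - U s = (LINT r:{s..t}|lborel. g r))"

lemma primitive_pairD:
  assumes "primitive_pair U g"
  shows "U \<in> borel_measurable borel" "g \<in> borel_measurable borel"
    "\<And>r. r \<le> 0 \<Longrightarrow> U r = 0"
    "\<And>s t. 0 < s \<Longrightarrow> set_integrable lborel {s..t} g"
    "\<And>s t. 0 < s \<Longrightarrow> s \<le> t \<Longrightarrow> U t - U s = (LINT r:{s..t}|lborel. g r)"
proof -
  show "set_integrable lborel {s..t} g" if "0 < s" for s t
    using assms that by (cases "s \<le> t") (auto simp: primitive_pair_def set_integrable_def)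
qed (use assms in \<open>auto simp: primitive_pair_def\<close>)

lemma set_integrable_lebesgue_borel:
  fixes f :: "real \<Rightarrow> real"
  assumes "f \<in> borel_measurable borel" "A \<in> sets borel"
  shows "set_integrable lebesgue A f \<longleftrightarrow> set_integrable lborel A f"
    "(LINT r:A|lebesgue. f r) = (LINT r:A|lborel. f r)"
proof -
  have "(\<lambda>x. indicator A x *\<^sub>R f x) \<in> borel_measurable lborel"
    using assms by auto
  then show "set_integrable lebesgue A f \<longleftrightarrow> set_integrable lborel A f"
    "(LINT r:A|lebesgue. f r) = (LINT r:A|lborel. f r)"
    by (simp_all only: set_integrable_def set_lebesgue_integral_def integrable_completion integral_completion)
qed

lemma primitive_pair_bound:
  assumes "primitive_pair U g" "0 < a" "a \<le> r" "r \<le> b"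
  shows "\<bar>U r\<bar> \<le> \<bar>U a\<bar> + (LINT s:{a..b}|lborel. \<bar>g s\<bar>)"
proof -
  note D = primitive_pairD[OF assms(1)]
  have "\<bar>LINT s:{a..r}|lborel. g s\<bar> \<le> (LINT s:{a..r}|lborel. \<bar>g s\<bar>)"
    using set_integral_norm_bound[OF D(4)[of a r]] assms by simp
  also have "\<dots> \<le> (LINT s:{a..b}|lborel. \<bar>g s\<bar>)"
    unfolding set_lebesgue_integral_def
  proof (rule integral_mono)
    show "integrable lborel (\<lambda>x. indicator {a..c} x *\<^sub>R \<bar>g x\<bar>)" for c
      using set_integrable_abs[OF D(4)[OF assms(2), of c]] by (simp add: set_integrable_def)
    then show "integrable lborel (\<lambda>x. indicator {a..b} x *\<^sub>R \<bar>g x\<bar>)" .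
    show "indicator {a..r} x *\<^sub>R \<bar>g x\<bar> \<le> indicator {a..b} x *\<^sub>R \<bar>g x\<bar>" for x
      using assms by (auto simp: indicator_def)
  qed
  finally show ?thesis using D(5)[of a r] assms by linarith
qed

lemma locally_integrable_primitive_pair:
  assumes "primitive_pair U g"
  shows "locally_integrable U" "locally_integrable g"
proof -
  note D = primitive_pairD[OF assms]
  have *: "set_integrable lborel {a..b} U" if ab: "0 < a" "a < b" for a b
    unfolding set_integrable_def
  proof (rule Bochner_Integration.integrable_bound)
    show "integrable lborel (\<lambda>x. indicator {a..b} x *\<^sub>R (\<bar>U a\<bar> + (LINT s:{a..b}|lborel. \<bar>g s\<bar>)))"
      by (intro integrable_scaleR_left integrable_real_indicator) (use ab in auto)
    show "AE x in lborel. norm (indicator {a..b} x *\<^sub>R U x)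
      \<le> norm (indicator {a..b} x *\<^sub>R (\<bar>U a\<bar> + (LINT s:{a..b}|lborel. \<bar>g s\<bar>)))"
      using primitive_pair_bound[OF assms ab(1), of _ b] by (auto simp: indicator_def intro!: AE_I2 order_trans[OF _ abs_ge_self])
  qed (use D in auto)
  show "locally_integrable U" "locally_integrable g"
    unfolding locally_integrable_def
  proof safe
    fix K :: "real set" assume K: "compact K" "K \<subseteq> {0<..}"
    obtain a b where ab: "0 < a" "a < b" "K \<subseteq> {a..b}"
      using compact_positive_subset_Icc[OF K] by blast
    show "set_integrable lebesgue K U" "set_integrable lebesgue K g"
      using *[OF ab(1,2)] D ab K
      by (auto intro!: set_integrable_subset[OF _ _ ab(3)] simp: set_integrable_lebesgue_borel borel_compact)
  qed
qed

lemma locally_integrable_times_compact_support: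
  assumes f: "locally_integrable f" and ab: "0 < a"
    and h: "h \<in> borel_measurable borel" "\<And>x. \<bar>h x\<bar> \<le> M" "\<And>x. x \<notin> {a..b} \<Longrightarrow> h x = 0"
  shows "set_integrable lebesgue {0<..} (\<lambda>r. f r * h r)"
proof -
  have fi: "integrable lebesgue (\<lambda>x. indicator {a..b} x * f x)"
    using f[unfolded locally_integrable_def, rule_format, of "{a..b}"] ab
    by (simp add: subset_eq set_integrable_def)
  have eq: "indicator {0<..} r *\<^sub>R (f r * h r) = (indicator {a..b} r * f r) * h r" for r
    using ab h(3)[of r] by (auto simp: indicator_def)
  have "h \<in> borel_measurable lebesgue" using h(1) by (simp add: measurable_completion)
  with borel_measurable_integrable[OF fi]
  have m: "(\<lambda>r. (indicator {a..b} r * f r) * h r) \<in> borel_measurable lebesgue"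
    by (rule borel_measurable_times)
  show ?thesis
    unfolding set_integrable_def eq
  proof (rule Bochner_Integration.integrable_bound[OF _ m])
    show "integrable lebesgue (\<lambda>x. M * (indicator {a..b} x * f x))"
      using fi by (rule integrable_mult_right)
    show "AE x in lebesgue. norm (indicat_real {a..b} x * f x * h x) \<le> norm (M * (indicat_real {a..b} x * f x))"
      using h(2) by (auto simp: abs_mult mult.commute intro!: AE_I2 mult_right_mono order_trans[OF _ abs_ge_self])
  qed
qed

lemma test_function_facts:
  assumes "test_function \<phi>"
  shows "\<phi> \<in> borel_measurable borel" "deriv \<phi> \<in> borel_measurable borel"
    "\<exists>M. \<forall>x. \<bar>\<phi> x\<bar> \<le> M" "\<exists>M. \<forall>x. \<bar>deriv \<phi> x\<bar> \<le> M"
proof -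
  obtain a b where ab: "0 < a" "a < b" "\<And>x. x \<notin> {a<..<b} \<Longrightarrow> \<phi> x = 0"
    "\<And>x. x \<notin> {a<..<b} \<Longrightarrow> deriv \<phi> x = 0"
    "\<And>x. (\<phi> has_real_derivative deriv \<phi> x) (at x)" "continuous_on UNIV (deriv \<phi>)" "smooth \<phi>"
    using test_functionE[OF assms] by metis
  note c = smooth_continuous[OF ab(7)]
  show "\<phi> \<in> borel_measurable borel" "deriv \<phi> \<in> borel_measurable borel"
    using c ab(6) by (auto intro: borel_measurable_continuous_onI)
  have bd: "\<exists>M. \<forall>x. \<bar>f x\<bar> \<le> M" if "continuous_on UNIV f" "\<And>x. x \<notin> {a<..<b} \<Longrightarrow> f x = 0" for f :: "real \<Rightarrow> real"
  proof -
    have "bounded (f ` {a..b})"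
      using that(1) by (meson compact_Icc compact_continuous_image compact_imp_bounded continuous_on_subset top_greatest)
    then obtain M where M: "\<And>x. x \<in> {a..b} \<Longrightarrow> \<bar>f x\<bar> \<le> M"
      unfolding bounded_iff by (metis imageI real_norm_def)
    have "\<bar>f x\<bar> \<le> max M 0" for x
      using M[of x] that(2)[of x] by (cases "x \<in> {a<..<b}") auto
    then show ?thesis by blast
  qed
  show "\<exists>M. \<forall>x. \<bar>\<phi> x\<bar> \<le> M" "\<exists>M. \<forall>x. \<bar>deriv \<phi> x\<bar> \<le> M"
    using bd c ab by blast+
qed

lemma locally_integrable_times_test:
  assumes f: "locally_integrable f" and \<phi>: "test_function \<phi>"
  shows "set_integrable lebesgue {0<..} (\<lambda>r. f r * \<phi> r)"
    "set_integrable lebesgue {0<..} (\<lambda>r. f r * deriv \<phi> r)"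
proof -
  obtain a b where ab: "0 < a" "a < b" "\<And>x. x \<notin> {a<..<b} \<Longrightarrow> \<phi> x = 0"
    "\<And>x. x \<notin> {a<..<b} \<Longrightarrow> deriv \<phi> x = 0"
    using test_functionE[OF \<phi>] by metis
  note F = test_function_facts[OF \<phi>]
  obtain M where M: "\<And>x. \<bar>\<phi> x\<bar> \<le> M" using F(3) by blast
  obtain M' where M': "\<And>x. \<bar>deriv \<phi> x\<bar> \<le> M'" using F(4) by blast
  have z: "\<phi> x = 0" "deriv \<phi> x = 0" if "x \<notin> {a..b}" for x
    using that ab(3)[of x] ab(4)[of x] by auto
  show "set_integrable lebesgue {0<..} (\<lambda>r. f r * \<phi> r)"
    by (rule locally_integrable_times_compact_support[OF f ab(1) F(1) M z(1)])
  show "set_integrable lebesgue {0<..} (\<lambda>r. f r * deriv \<phi> r)"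
    by (rule locally_integrable_times_compact_support[OF f ab(1) F(2) M' z(2)])
qed

text \<open>Fubini for \<open>g s * \<phi>' r\<close> on the triangle \<open>s \<le> r\<close>
  inside the square: integration over \<open>s\<close> gives \<open>(U r - U a) * \<phi>' r\<close>,
  integration over \<open>r\<close> gives \<open>- g s * \<phi> s\<close>.\<close>

lemma primitive_pair_integral_by_parts:
  assumes P: "primitive_pair U g" and ab: "0 < a" "a < b"
    and \<phi>: "\<phi> a = 0" "\<phi> b = 0" "\<And>x. (\<phi> has_real_derivative \<phi>' x) (at x)" "continuous_on UNIV \<phi>'"
  shows "(LINT r:{a..b}|lborel. U r * \<phi>' r) = - (LINT r:{a..b}|lborel. g r * \<phi> r)"
proof -
  note D = primitive_pairD[OF P]
  note [measurable] = D(1,2)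
  have m[measurable]: "\<phi>' \<in> borel_measurable borel" using \<phi>(4) by (rule borel_measurable_continuous_onI)
  define k where "k s r = (indicator {a..b} s * g s) * (if s \<le> r then indicator {a..b} r * \<phi>' r else 0)" for s r
  have gi: "integrable lborel (\<lambda>s. indicator {a..b} s * g s)"
    using D(4)[OF ab(1), of b] by (simp add: set_integrable_def)
  have pc: "continuous_on {s..b} \<phi>'" for s using \<phi>(4) continuous_on_subset by blast
  have pint: "set_integrable lborel {s..b} \<phi>'" for s
    using borel_integrable_compact[of "{s..b}" \<phi>'] pc by (simp add: set_integrable_def)
  have ftc: "(LINT r:{s..b}|lborel. \<phi>' r) = \<phi> b - \<phi> s" if "s \<le> b" for s
    unfolding set_lebesgue_integral_def real_scaleR_def
    using integral_FTC_Icc_real[OF that, of \<phi> \<phi>'] \<phi>(3) \<phi>(4)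
    by (simp add: continuous_on_eq_continuous_at mult.commute)
  have "integrable (lborel \<Otimes>\<^sub>M lborel) (case_prod k)"
  proof (rule Bochner_Integration.integrable_bound)
    have "integrable (lborel \<Otimes>\<^sub>M lborel) (\<lambda>(x, y). \<bar>indicator {a..b} x * g x\<bar> * \<bar>indicator {a..b} y * \<phi>' y\<bar>)"
    proof (rule lborel_pair.Fubini_integrable)
      show "integrable lborel (\<lambda>x. \<integral>y. norm (case (x, y) of (x, y) \<Rightarrow> \<bar>indicator {a..b} x * g x\<bar> * \<bar>indicator {a..b} y * \<phi>' y\<bar>) \<partial>lborel)"
        using integrable_abs[OF gi] by (simp add: abs_mult)
      show "AE x in lborel. integrable lborel (\<lambda>y. case (x, y) of (x, y) \<Rightarrow> \<bar>indicator {a..b} x * g x\<bar> * \<bar>indicator {a..b} y * \<phi>' y\<bar>)"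
        using pint[of a] by (auto intro!: AE_I2 integrable_mult_right integrable_abs simp: set_integrable_def)
    qed measurable
    then show "integrable (lborel \<Otimes>\<^sub>M lborel) (\<lambda>(x, y). \<bar>indicator {a..b} x * g x\<bar> * \<bar>indicator {a..b} y * \<phi>' y\<bar>)" .
    show "case_prod k \<in> borel_measurable (lborel \<Otimes>\<^sub>M lborel)"
      unfolding k_def by measurable
    show "AE x in lborel \<Otimes>\<^sub>M lborel. norm (case x of (x, xa) \<Rightarrow> k x xa)
         \<le> norm (case x of (x, y) \<Rightarrow> \<bar>indicator {a..b} x * g x\<bar> * \<bar>indicator {a..b} y * \<phi>' y\<bar>)"
      by (auto simp: k_def abs_mult intro!: AE_I2)
  qed
  then have fub: "(\<integral>r. (\<integral>s. k s r \<partial>lborel) \<partial>lborel) = (\<integral>s. (\<integral>r. k s r \<partial>lborel) \<partial>lborel)"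
    by (rule lborel_pair.Fubini_integral)
  have inner1: "(\<integral>s. k s r \<partial>lborel) = indicator {a..b} r * (U r - U a) * \<phi>' r" for r
  proof (cases "r \<in> {a..b}")
    case True
    have "(\<integral>s. k s r \<partial>lborel) = (\<integral>s. (indicator {a..r} s * g s) * \<phi>' r \<partial>lborel)"
      using True by (intro Bochner_Integration.integral_cong) (auto simp: k_def indicator_def)
    also have "\<dots> = (LINT s:{a..r}|lborel. g s) * \<phi>' r"
      by (simp add: set_lebesgue_integral_def)
    finally show ?thesis using D(5)[OF ab(1), of r] True by simp
  next
    case False
    then have "k s r = 0" for s by (auto simp: k_def)
    then show ?thesis using False by simp
  qed
  have inner2: "(\<integral>r. k s r \<partial>lborel) = - (indicator {a..b} s * (g s * \<phi> s))" for s
  proof (cases "s \<in> {a..b}")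
    case True
    have "(\<integral>r. k s r \<partial>lborel) = (\<integral>r. g s * (indicator {s..b} r * \<phi>' r) \<partial>lborel)"
      using True by (intro Bochner_Integration.integral_cong) (auto simp: k_def indicator_def)
    also have "\<dots> = g s * (LINT r:{s..b}|lborel. \<phi>' r)"
      by (simp add: set_lebesgue_integral_def)
    finally show ?thesis using ftc[of s] True \<phi>(2) by simp
  next
    case False
    then show ?thesis by (simp add: k_def)
  qed
  have UI: "set_integrable lborel {a..b} (\<lambda>r. (U r - U a) * \<phi>' r)"
  proof -
    have "integrable lborel (\<lambda>r. \<integral>s. k s r \<partial>lborel)"
      using lborel_pair.integrable_snd[OF \<open>integrable (lborel \<Otimes>\<^sub>M lborel) (case_prod k)\<close>] by simp
    then show ?thesis by (simp add: inner1 set_integrable_def mult.assoc)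
  qed
  \<comment> \<open>The constant \<open>U a\<close> can be put back because the integral of
    \<open>\<phi>'\<close> vanishes.\<close>
  have "(LINT r:{a..b}|lborel. U r * \<phi>' r) = (LINT r:{a..b}|lborel. (U r - U a) * \<phi>' r + U a * \<phi>' r)"
    by (simp add: algebra_simps)
  also have "\<dots> = (LINT r:{a..b}|lborel. (U r - U a) * \<phi>' r) + (LINT r:{a..b}|lborel. U a * \<phi>' r)"
    using UI pint[of a] by (intro set_integral_add) auto
  also have "(LINT r:{a..b}|lborel. U a * \<phi>' r) = 0"
    using ftc[of a] ab \<phi>(1,2) by simp
  also have "(LINT r:{a..b}|lborel. (U r - U a) * \<phi>' r) = (\<integral>r. (\<integral>s. k s r \<partial>lborel) \<partial>lborel)"
    by (simp add: inner1 set_lebesgue_integral_def mult.assoc)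
  also have "\<dots> = - (LINT r:{a..b}|lborel. g r * \<phi> r)"
    by (simp add: fub inner2 set_lebesgue_integral_def)
  finally show ?thesis by simp
qed

lemma primitive_pair_has_weak_deriv:
  assumes "primitive_pair U g"
  shows "has_weak_deriv U g"
  unfolding has_weak_deriv_def
proof (intro conjI allI impI locally_integrable_primitive_pair[OF assms])
  fix \<phi> assume \<phi>: "test_function \<phi>"
  obtain a b where ab: "0 < a" "a < b" "\<And>x. x \<notin> {a<..<b} \<Longrightarrow> \<phi> x = 0"
    "\<And>x. x \<notin> {a<..<b} \<Longrightarrow> deriv \<phi> x = 0"
    "\<And>x. (\<phi> has_real_derivative deriv \<phi> x) (at x)" "continuous_on UNIV (deriv \<phi>)"
    using test_functionE[OF \<phi>] by metis
  note F = test_function_facts[OF \<phi>]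
  note D = primitive_pairD[OF assms]
  have red: "(LINT r:{0<..}|lebesgue. f r * h r) = (LINT r:{a..b}|lborel. f r * h r)"
    if "f \<in> borel_measurable borel" "h \<in> borel_measurable borel" "\<And>x. x \<notin> {a<..<b} \<Longrightarrow> h x = 0"
    for f h :: "real \<Rightarrow> real"
  proof -
    have "(LINT r:{0<..}|lebesgue. f r * h r) = (LINT r:{0<..}|lborel. f r * h r)"
      using that by (intro set_integrable_lebesgue_borel) auto
    also have "\<dots> = (LINT r:{a..b}|lborel. f r * h r)"
      unfolding set_lebesgue_integral_def
      using that(3) ab(1) by (intro Bochner_Integration.integral_cong) (auto simp: indicator_def)
    finally show ?thesis .
  qed
  show "(LINT r:{0<..}|lebesgue. U r * deriv \<phi> r) = - (LINT r:{0<..}|lebesgue. g r * \<phi> r)"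
    using primitive_pair_integral_by_parts[OF assms ab(1,2) _ _ ab(5,6)] ab(3)[of a] ab(3)[of b]
      red[OF D(1) F(2) ab(4)] red[OF D(2) F(1) ab(3)] by simp
qed

section \<open>Uniqueness of weak derivatives and recovery of primitives\<close>

lemma locally_integrable_diff:
  "locally_integrable f \<Longrightarrow> locally_integrable g \<Longrightarrow> locally_integrable (\<lambda>r. f r - g r)"
  unfolding locally_integrable_def by (auto intro: set_integral_diff)

lemma locally_integrable_const: "locally_integrable (\<lambda>_. c)"
  unfolding locally_integrable_def set_integrable_def
  using lmeasurable_compact lmeasurable_iff_integrable by (blast intro: integrable_scaleR_left)

lemma weak_deriv_unique:
  assumes "has_weak_deriv u v" "has_weak_deriv u w"
  shows "AE r in lebesgue. r > 0 \<longrightarrow> v r = w r"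
proof -
  have "AE r in lebesgue. r > 0 \<longrightarrow> v r - w r = 0"
  proof (rule fundamental_lemma_variations)
    show "locally_integrable (\<lambda>r. v r - w r)"
      using assms by (intro locally_integrable_diff) (auto simp: has_weak_deriv_def)
    fix \<phi> assume \<phi>: "test_function \<phi>"
    have "(LINT r:{0<..}|lebesgue. v r * \<phi> r - w r * \<phi> r) = (LINT r:{0<..}|lebesgue. v r * \<phi> r) - (LINT r:{0<..}|lebesgue. w r * \<phi> r)"
      using assms by (intro set_integral_diff locally_integrable_times_test[OF _ \<phi>]) (auto simp: has_weak_deriv_def)
    also have "\<dots> = 0" using assms \<phi> unfolding has_weak_deriv_def by (simp add: minus_equation_iff)
    finally show "(LINT r:{0<..}|lebesgue. (v r - w r) * \<phi> r) = 0" by (simp add: algebra_simps)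
  qed
  then show ?thesis by simp
qed

text \<open>Measurability is known only on compact pieces; the truncations to them converge
  pointwise to \<open>w\<close>, and a Lebesgue measurable function has a Borel version.\<close>

lemma locally_integrable_borel_representative:
  assumes "locally_integrable v"
  obtains g where "g \<in> borel_measurable borel" "AE r in lborel. r > 0 \<longrightarrow> v r = g r"
proof -
  define w where "w r = indicator {0<..} r * v r" for r :: real
  have "w \<in> borel_measurable lebesgue"
  proof (rule borel_measurable_LIMSEQ_real)
    fix r :: real
    have "\<forall>\<^sub>F n in sequentially. indicator {inverse (real (Suc n))..real (Suc n)} r * v r = w r"
    proof (cases "r > 0")
      case True
      have "\<forall>\<^sub>F n in sequentially. inverse (real (Suc n)) < r"
        using order_tendstoD(2)[OF LIMSEQ_inverse_real_of_nat True] .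
      moreover have "\<forall>\<^sub>F n in sequentially. r \<le> real n"
        using eventually_ge_at_top[of "nat \<lceil>r\<rceil>"] by eventually_elim linarith
      ultimately show ?thesis
        by eventually_elim (use True in \<open>auto simp: w_def indicator_def\<close>)
    next
      case False
      have "r \<notin> {inverse (real (Suc n))..real (Suc n)}" for n
      proof -
        have "0 < inverse (real (Suc n))" by simp
        then show ?thesis using False by (metis atLeastAtMost_iff less_le_trans)
      qed
      then show ?thesis using False by (simp add: w_def)
    qed
    then show "(\<lambda>n. indicator {inverse (real (Suc n))..real (Suc n)} r * v r) \<longlonglongrightarrow> w r"
      by (rule tendsto_eventually)
  next
    fix n
    have "{inverse (real (Suc n))..real (Suc n)} \<subseteq> {0<..}"
      by (auto intro: less_le_trans[of 0 "inverse (real (Suc n))"])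
    then have "set_integrable lebesgue {inverse (real (Suc n))..real (Suc n)} v"
      using assms unfolding locally_integrable_def by blast
    then show "(\<lambda>r. indicator {inverse (real (Suc n))..real (Suc n)} r * v r) \<in> borel_measurable lebesgue"
      unfolding set_integrable_def real_scaleR_def by (rule borel_measurable_integrable)
  qed
  from completion_ex_borel_measurable_real[OF this]
  obtain g where "g \<in> borel_measurable lborel" "AE x in lborel. w x = g x" by auto
  then show ?thesis
    by (intro that[of g]) (auto simp: w_def elim!: eventually_mono)
qed

lemma primitive_pair_exists:
  assumes g[measurable]: "g \<in> borel_measurable borel"
    and gi: "\<And>s t. 0 < s \<Longrightarrow> set_integrable lborel {s..t} g"
  shows "\<exists>V. primitive_pair (\<lambda>r. if r > 0 then V r + c else 0) g"
proof -
  \<comment> \<open>\<open>V r\<close> is the oriented integral of \<open>g\<close> from 1 to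
    \<open>r\<close>. The base point is interior because \<open>g\<close> need not be integrable
    near 0, and writing the orientation into one kernel makes \<open>V\<close> measurable as a
    parameter integral.\<close>
  define k where "k r s = (if 1 < s \<and> s \<le> r then g s else if r < s \<and> s \<le> 1 then - g s else 0)" for r s :: real
  define V where "V r = (\<integral>s. k r s \<partial>lborel)" for r
  have [measurable]: "(\<lambda>(r, s). k r s) \<in> borel_measurable (borel \<Otimes>\<^sub>M borel)"
    unfolding k_def by measurable
  have ki: "integrable lborel (k r)" if "r > 0" for r
  proof (rule Bochner_Integration.integrable_bound)
    show "integrable lborel (\<lambda>s. indicator {min r 1..max r 1} s *\<^sub>R g s)"
      using gi[of "min r 1" "max r 1"] that by (simp add: set_integrable_def)
    show "k r \<in> borel_measurable lborel" unfolding k_def by measurable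
    show "AE s in lborel. norm (k r s) \<le> norm (indicator {min r 1..max r 1} s *\<^sub>R g s)"
      by (auto simp: k_def indicator_def)
  qed
  have "primitive_pair (\<lambda>r. if r > 0 then V r + c else 0) g"
    unfolding primitive_pair_def
  proof (intro conjI allI impI)
    have "V \<in> borel_measurable borel" unfolding V_def by measurable
    then show "(\<lambda>r. if r > 0 then V r + c else 0) \<in> borel_measurable borel" by measurable
    fix s t :: real
    assume st: "0 < s" "s \<le> t"
    have "V t - V s = (\<integral>x. k t x - k s x \<partial>lborel)"
      using ki st by (simp add: V_def)
    also have "\<dots> = (\<integral>x. indicator {s<..t} x *\<^sub>R g x \<partial>lborel)"
      using st by (intro Bochner_Integration.integral_cong) (auto simp: k_def indicator_def)
    also have "\<dots> = (\<integral>x. indicator {s..t} x *\<^sub>R g x \<partial>lborel)"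
    proof (rule integral_cong_AE)
      show "AE x in lborel. indicator {s<..t} x *\<^sub>R g x = indicator {s..t} x *\<^sub>R g x"
        using AE_lborel_singleton[of s] by eventually_elim (auto simp: indicator_def)
    qed auto
    finally show "(if 0 < t then V t + c else 0) - (if 0 < s then V s + c else 0) = (LINT r:{s..t}|lborel. g r)"
      using st by (simp add: set_lebesgue_integral_def)
  qed (use g gi in auto)
  then show ?thesis by blast
qed

text \<open>The primitive that vanishes at \<open>a\<close> is constant outside the interval; it is
  0 on the left by choice and 0 on the right because \<open>h\<close> has mean zero.\<close>

lemma test_function_antiderivative:
  assumes h: "smooth h" and ab: "0 < a" "a < b" "\<And>x. x \<notin> {a<..<b} \<Longrightarrow> h x = 0"
    and z: "(LINT r:{a..b}|lborel. h r) = 0"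
  obtains \<eta> where "test_function \<eta>" "deriv \<eta> = h"
proof -
  have c: "continuous_on UNIV h" using h by (rule smooth_continuous)
  have "\<exists>F. \<forall>x. -\<infinity> < ereal x \<longrightarrow> ereal x < \<infinity> \<longrightarrow> (F has_vector_derivative h x) (at x)"
    using c by (intro einterval_antiderivative) (auto simp: continuous_on_eq_continuous_at)
  then obtain F where F: "\<And>x. (F has_real_derivative h x) (at x)"
    by (auto simp: has_real_derivative_iff_has_vector_derivative)
  define \<eta> where "\<eta> x = F x - F a" for x
  have \<eta>: "(\<eta> has_real_derivative h x) (at x)" for x
    unfolding \<eta>_def using F by (auto intro!: derivative_eq_intros)
  have ftc: "(LINT r:{s..t}|lborel. h r) = F t - F s" if "s \<le> t" for s t
    unfolding set_lebesgue_integral_def real_scaleR_def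
    using integral_FTC_Icc_real[OF that, of F h] F c
    by (simp add: continuous_on_eq_continuous_at mult.commute)
  have "\<eta> x = 0" if "x \<notin> {a..b}" for x
  proof (cases "x < a")
    case True
    have "(LINT r:{x..a}|lborel. h r) = (LINT r:{x..a}|lborel. 0)"
      using ab(3) by (intro set_lebesgue_integral_cong) auto
    then show ?thesis using ftc[of x a] True by (simp add: \<eta>_def)
  next
    case False
    then have "b < x" using that by auto
    have "(LINT r:{b..x}|lborel. h r) = (LINT r:{b..x}|lborel. 0)"
      using ab(3) by (intro set_lebesgue_integral_cong) auto
    then show ?thesis using ftc[of b x] ftc[of a b] z ab \<open>b < x\<close> by (simp add: \<eta>_def)
  qed
  then have "test_function \<eta>"
    by (intro test_functionI[OF smooth_of_deriv[OF \<eta> h] ab(1)])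
  moreover have "deriv \<eta> = h" using \<eta> by (intro ext) (auto intro: DERIV_imp_deriv)
  ultimately show ?thesis by (rule that)
qed

text \<open>The induction carries the shape of the iterated derivative, a combination of two smooth
  functions, since differentiability of each iterate alone is too weak to continue.\<close>

lemma smooth_diff_scaled:
  assumes "smooth f" "smooth g"
  shows "smooth (\<lambda>x. f x - c * g x)"
proof -
  have d: "(f has_real_derivative deriv f x) (at x)" if "smooth f" for f x
    using that unfolding smooth_def DERIV_deriv_iff_real_differentiable by (metis funpow_0)
  have s: "smooth (deriv f)" if "smooth f" for f
    using that unfolding smooth_def by (metis funpow_swap1 funpow.simps(2) comp_apply)
  have "\<exists>f' g'. smooth f' \<and> smooth g' \<and> (deriv ^^ n) (\<lambda>x. f x - c * g x) = (\<lambda>x. f' x - c * g' x)" for n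
  proof (induction n)
    case (Suc n)
    then obtain f' g' where *: "smooth f'" "smooth g'" "(deriv ^^ n) (\<lambda>x. f x - c * g x) = (\<lambda>x. f' x - c * g' x)"
      by blast
    have "deriv (\<lambda>x. f' x - c * g' x) = (\<lambda>x. deriv f' x - c * deriv g' x)"
      using d * by (intro ext DERIV_imp_deriv) (auto intro!: derivative_eq_intros)
    then show ?case using * s by (intro exI[of _ "deriv f'"] exI[of _ "deriv g'"]) simp
  qed (use assms in auto)
  then show ?thesis
    unfolding smooth_def
  proof (intro allI)
    fix n x
    assume *: "\<And>n. \<exists>f' g'. (\<forall>n x. (deriv ^^ n) f' differentiable (at x)) \<and> (\<forall>n x. (deriv ^^ n) g' differentiable (at x)) \<and>
      (deriv ^^ n) (\<lambda>x. f x - c * g x) = (\<lambda>x. f' x - c * g' x)"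
    then obtain f' g' where "smooth f'" "smooth g'" "(deriv ^^ n) (\<lambda>x. f x - c * g x) = (\<lambda>x. f' x - c * g' x)"
      unfolding smooth_def by blast
    with d show "(deriv ^^ n) (\<lambda>x. f x - c * g x) differentiable at x"
      by (auto simp: real_differentiable_def intro!: exI derivative_eq_intros)
  qed
qed

text \<open>A test function minus the multiple of a fixed bump with the same integral is the derivative of
  a test function.\<close>

lemma weak_deriv_zero_imp_const:
  assumes W: "locally_integrable W"
    and z: "\<And>\<phi>. test_function \<phi> \<Longrightarrow> (LINT r:{0<..}|lebesgue. W r * deriv \<phi> r) = 0"
  obtains c where "AE r in lebesgue. r > 0 \<longrightarrow> W r = c"
proof -
  define \<psi> where "\<psi> = bump 1 2 1"
  have \<psi>s: "smooth \<psi>" and \<psi>t: "test_function \<psi>" and \<psi>0: "\<And>x. x \<notin> {1<..<2} \<Longrightarrow> \<psi> x = 0"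
    unfolding \<psi>_def by (auto intro: smooth_flat_alg bump_flat_alg test_function_bump bump_outside)
  note \<psi>c = smooth_continuous[OF \<psi>s]
  define I where "I \<phi> = (LINT r:{0<..}|lebesgue. \<phi> r)" for \<phi> :: "real \<Rightarrow> real"
  have tint: "set_integrable lebesgue {0<..} \<phi>" if "test_function \<phi>" for \<phi>
    using locally_integrable_times_test(1)[OF locally_integrable_const[of 1] that] by simp
  have Ieq: "I \<phi> = (LINT r:{a..b}|lborel. \<phi> r)" if "\<phi> \<in> borel_measurable borel" "0 < a" "\<And>x. x \<notin> {a<..<b} \<Longrightarrow> \<phi> x = 0" for \<phi> a b
  proof -
    have "I \<phi> = (LINT r:{0<..}|lborel. \<phi> r)"
      unfolding I_def using that by (intro set_integrable_lebesgue_borel) auto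
    also have "\<dots> = (LINT r:{a..b}|lborel. \<phi> r)"
      unfolding set_lebesgue_integral_def
      using that(3) that(2) by (intro Bochner_Integration.integral_cong) (auto simp: indicator_def)
    finally show ?thesis .
  qed
  have m: "I \<psi> \<noteq> 0"
  proof
    assume "I \<psi> = 0"
    then have "(LINT r:{0<..}|lebesgue. \<psi> r) = 0" by (simp add: I_def)
    then have "AE r in lebesgue. indicator {0<..} r *\<^sub>R \<psi> r = 0"
      using tint[OF \<psi>t] unfolding set_lebesgue_integral_def set_integrable_def
      by (subst (asm) integral_nonneg_eq_0_iff_AE) (auto simp: \<psi>_def bump_bounds)
    then have "AE r in lebesgue. r \<notin> {1<..<2::real}"
    proof eventually_elim
      case (elim r)
      then show ?case using bump_inside[of r 1 2 1] by (auto simp: \<psi>_def indicator_def)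
    qed
    then have "emeasure lebesgue {1<..<2::real} = 0"
      by (subst (asm) AE_iff_measurable[of "{1<..<2}"]) auto
    then show False by simp
  qed
  \<comment> \<open>Testing \<open>W - c\<close> with \<open>\<psi>\<close> must give 0, which
    forces this value.\<close>
  define c where "c = (LINT r:{0<..}|lebesgue. W r * \<psi> r) / I \<psi>"
  have "AE r in lebesgue. r > 0 \<longrightarrow> W r - c = 0"
  proof (rule fundamental_lemma_variations)
    show "locally_integrable (\<lambda>r. W r - c)"
      by (intro locally_integrable_diff W locally_integrable_const)
    fix \<phi> assume \<phi>: "test_function \<phi>"
    obtain a b where ab: "0 < a" "a < b" "\<And>x. x \<notin> {a<..<b} \<Longrightarrow> \<phi> x = 0" "smooth \<phi>"
      using test_functionE[OF \<phi>] by metis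
    define \<kappa> where "\<kappa> = I \<phi> / I \<psi>"
    define h where "h x = \<phi> x - \<kappa> * \<psi> x" for x
    have hs: "smooth h" unfolding h_def by (rule smooth_diff_scaled[OF ab(4) \<psi>s])
    have h0: "h x = 0" if "x \<notin> {min a 1<..<max b 2}" for x
    proof -
      have "x \<notin> {a<..<b}" "x \<notin> {1<..<2}" using that by auto
      then show ?thesis using ab(3) \<psi>0 by (simp add: h_def)
    qed
    have "I h = I \<phi> - I (\<lambda>x. \<kappa> * \<psi> x)"
      unfolding I_def h_def by (intro set_integral_diff tint[OF \<phi>] set_integrable_mult_right) (simp add: tint[OF \<psi>t])
    also have "\<dots> = 0" using m by (simp add: I_def \<kappa>_def)
    finally have "I h = 0" .
    moreover have "h \<in> borel_measurable borel"
      using smooth_continuous[OF hs] by (rule borel_measurable_continuous_onI)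
    ultimately have "(LINT r:{min a 1..max b 2}|lborel. h r) = 0"
      using Ieq[of h "min a 1" "max b 2"] h0 ab by simp
    moreover have "0 < min a 1" "min a 1 < max b 2" using ab by auto
    ultimately obtain \<eta> where \<eta>: "test_function \<eta>" "deriv \<eta> = h"
      using test_function_antiderivative[OF hs _ _ h0] by blast
    note W1 = locally_integrable_times_test(1)[OF W \<phi>] locally_integrable_times_test(1)[OF W \<psi>t]
    have "0 = (LINT r:{0<..}|lebesgue. W r * \<phi> r - \<kappa> * (W r * \<psi> r))"
      using z[OF \<eta>(1)] by (simp add: \<eta>(2) h_def algebra_simps)
    also have "\<dots> = (LINT r:{0<..}|lebesgue. W r * \<phi> r) - (LINT r:{0<..}|lebesgue. \<kappa> * (W r * \<psi> r))"
      by (intro set_integral_diff W1 set_integrable_mult_right)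
    also have "\<dots> = (LINT r:{0<..}|lebesgue. W r * \<phi> r) - c * I \<phi>"
      by (simp add: \<kappa>_def c_def)
    also have "\<dots> = (LINT r:{0<..}|lebesgue. W r * \<phi> r) - (LINT r:{0<..}|lebesgue. c * \<phi> r)"
      by (simp add: I_def)
    also have "\<dots> = (LINT r:{0<..}|lebesgue. W r * \<phi> r - c * \<phi> r)"
      by (intro set_integral_diff(2)[symmetric] W1 set_integrable_mult_right) (simp add: tint[OF \<phi>])
    finally show "(LINT r:{0<..}|lebesgue. (W r - c) * \<phi> r) = 0" by (simp add: algebra_simps)
  qed
  then show ?thesis by (intro that[of c]) auto
qed

text \<open>A primitive \<open>V0\<close> of a Borel version of \<open>v\<close> has the same weak
  derivative as \<open>u\<close>, so \<open>u - V0\<close> is almost everywhere constant; adding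
  that constant to \<open>V0\<close> gives \<open>U\<close>.\<close>

lemma has_weak_deriv_imp_primitive_pair:
  assumes uv: "has_weak_deriv u v"
  obtains U g where "primitive_pair U g" "AE r in lborel. r > 0 \<longrightarrow> u r = U r"
    "AE r in lborel. r > 0 \<longrightarrow> v r = g r"
proof -
  have lu: "locally_integrable u" and lv: "locally_integrable v" using uv by (auto simp: has_weak_deriv_def)
  obtain g where g[measurable]: "g \<in> borel_measurable borel" and vg: "AE r in lborel. r > 0 \<longrightarrow> v r = g r"
    using locally_integrable_borel_representative[OF lv] .
  have gi: "set_integrable lborel {s..t} g" if s: "0 < s" for s t
  proof -
    have "{s..t} \<subseteq> {0<..}" using s by auto
    then have "set_integrable lebesgue {s..t} v" using lv by (auto simp: locally_integrable_def)
    then have vi: "integrable lebesgue (\<lambda>r. indicator {s..t} r *\<^sub>R v r)" by (simp add: set_integrable_def)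
    have "integrable lebesgue (\<lambda>r. indicator {s..t} r *\<^sub>R g r)"
    proof (rule integrable_cong_AE_imp[OF vi])
      show "(\<lambda>r. indicator {s..t} r *\<^sub>R g r) \<in> borel_measurable lebesgue"
        by (rule measurable_completion) auto
      show "AE r in lebesgue. indicator {s..t} r *\<^sub>R v r = indicator {s..t} r *\<^sub>R g r"
        using AE_completion[OF vg] by eventually_elim (use s in \<open>auto simp: indicator_def\<close>)
    qed
    then show ?thesis by (subst set_integrable_lebesgue_borel(1)[symmetric]) (auto simp: set_integrable_def)
  qed
  obtain V where V: "primitive_pair (\<lambda>r. if r > 0 then V r + 0 else 0) g"
    using primitive_pair_exists[OF g gi] by blast
  define V0 where "V0 r = (if r > 0 then V r + 0 else 0)" for r
  have V0: "has_weak_deriv V0 g" unfolding V0_def by (rule primitive_pair_has_weak_deriv[OF V])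
  have lV: "locally_integrable V0" and lg: "locally_integrable g" using V0 by (auto simp: has_weak_deriv_def)
  obtain c where c: "AE r in lebesgue. r > 0 \<longrightarrow> u r - V0 r = c"
  proof (rule weak_deriv_zero_imp_const)
    show "locally_integrable (\<lambda>r. u r - V0 r)" by (rule locally_integrable_diff[OF lu lV])
    fix \<phi> assume \<phi>: "test_function \<phi>"
    have "(LINT r:{0<..}|lebesgue. u r * deriv \<phi> r - V0 r * deriv \<phi> r)
        = (LINT r:{0<..}|lebesgue. u r * deriv \<phi> r) - (LINT r:{0<..}|lebesgue. V0 r * deriv \<phi> r)"
      by (intro set_integral_diff locally_integrable_times_test[OF lu \<phi>] locally_integrable_times_test[OF lV \<phi>])
    also have "\<dots> = - (LINT r:{0<..}|lebesgue. v r * \<phi> r) + (LINT r:{0<..}|lebesgue. g r * \<phi> r)"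
      using uv V0 \<phi> by (simp add: has_weak_deriv_def)
    also have "(LINT r:{0<..}|lebesgue. v r * \<phi> r) = (LINT r:{0<..}|lebesgue. g r * \<phi> r)"
      unfolding set_lebesgue_integral_def
    proof (rule integral_cong_AE)
      show "(\<lambda>r. indicator {0<..} r *\<^sub>R (v r * \<phi> r)) \<in> borel_measurable lebesgue"
        "(\<lambda>r. indicator {0<..} r *\<^sub>R (g r * \<phi> r)) \<in> borel_measurable lebesgue"
        using locally_integrable_times_test(1)[OF lv \<phi>] locally_integrable_times_test(1)[OF lg \<phi>]
        unfolding set_integrable_def by (auto intro: borel_measurable_integrable)
      show "AE r in lebesgue. indicator {0<..} r *\<^sub>R (v r * \<phi> r) = indicator {0<..} r *\<^sub>R (g r * \<phi> r)"
        using AE_completion[OF vg] by eventually_elim (auto simp: indicator_def)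
    qed
    finally show "(LINT r:{0<..}|lebesgue. (u r - V0 r) * deriv \<phi> r) = 0"
      by (simp add: algebra_simps)
  qed
  define U where "U r = (if r > 0 then V r + c else 0)" for r
  have "primitive_pair U g"
    using V unfolding primitive_pair_def U_def
  proof (elim conjE, intro conjI)
    assume "(\<lambda>r. if r > 0 then V r + 0 else 0) \<in> borel_measurable borel"
    then have "(\<lambda>r. indicator {0<..} r * c + (if r > 0 then V r + 0 else 0)) \<in> borel_measurable borel" by measurable
    moreover have "(\<lambda>r. indicator {0<..} r * c + (if r > 0 then V r + 0 else 0)) = (\<lambda>r. if r > 0 then V r + c else 0)"
      by (auto simp: fun_eq_iff indicator_def)
    ultimately show "(\<lambda>r. if r > 0 then V r + c else 0) \<in> borel_measurable borel" by simp
  qed auto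
  moreover have "AE r in lborel. r > 0 \<longrightarrow> u r = U r"
    using c unfolding AE_completion_iff by eventually_elim (auto simp: U_def V0_def)
  ultimately show ?thesis using vg by (rule that)
qed

section \<open>Norms as integrals of powers of Borel representatives\<close>

lemma ennpowr_inverse: "p > 0 \<Longrightarrow> ennpowr (ennpowr x (1 / p)) p = x"
  by (cases "x = \<infinity>") (auto simp: ennpowr_def powr_powr less_top ennreal_enn2real_if)

lemma ennpowr_eq_1: "a > 0 \<Longrightarrow> ennpowr x a = 1 \<longleftrightarrow> x = 1"
proof (cases x)
  case (real y)
  assume "a > 0"
  then have "y = (y powr a) powr (1 / a)" using real by (simp add: powr_powr)
  then have "y powr a = 1 \<longleftrightarrow> y = 1" by auto
  with real show ?thesis by (simp add: ennpowr_def)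
qed (auto simp: ennpowr_def)

lemma ennpowr_less_top: "ennpowr x a < top \<longleftrightarrow> x < top"
  by (auto simp: ennpowr_def less_top)

text \<open>The \<open>q\<close>-th power of \<open>wnorm\<close> for \<open>q > 0\<close>. Working
  with powers avoids roots in sums and limits, and \<open>lborel\<close> gives the same value as
  \<open>lebesgue\<close>.\<close>

definition wint :: "real \<Rightarrow> real \<Rightarrow> (real \<Rightarrow> real) \<Rightarrow> ennreal" where
  "wint q \<theta> u = (\<integral>\<^sup>+r. ennreal (\<bar>u r\<bar> powr q * r powr \<theta>) * indicator {0<..} r \<partial>lborel)"

lemma wnorm_eq_wint: "wnorm q \<theta> u = ennpowr (wint q \<theta> u) (1 / q)"
  by (simp add: wnorm_def wint_def nn_integral_completion)

lemma ennpowr_wnorm: "q > 0 \<Longrightarrow> ennpowr (wnorm q \<theta> u) q = wint q \<theta> u"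
  by (simp add: wnorm_eq_wint ennpowr_inverse)

lemma wint_cong_AE:
  assumes "AE r in lborel. r > 0 \<longrightarrow> u r = w r"
  shows "wint q \<theta> u = wint q \<theta> w"
  unfolding wint_def using assms
  by (intro nn_integral_cong_AE) (auto elim!: eventually_mono simp: indicator_def)

lemma X_norm_eq_1:
  "p > 0 \<Longrightarrow> X_norm p \<alpha> u = 1 \<longleftrightarrow> wint p (p - 1) (weak_deriv u) + wint p \<alpha> u = 1"
  by (simp add: X_norm_def ennpowr_wnorm ennpowr_eq_1)

lemma X_space_imp_primitive_pair:
  assumes "u \<in> X_space p \<alpha>"
  obtains U g where "primitive_pair U g" "AE r in lborel. r > 0 \<longrightarrow> u r = U r"
    "AE r in lborel. r > 0 \<longrightarrow> weak_deriv u r = g r"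
proof -
  have "has_weak_deriv u (weak_deriv u)"
    using assms someI_ex[of "has_weak_deriv u"] unfolding X_space_def weak_deriv_def by auto
  from has_weak_deriv_imp_primitive_pair[OF this] that show ?thesis by blast
qed

lemma primitive_pair_weak_deriv:
  assumes "primitive_pair U g"
  shows "has_weak_deriv U (weak_deriv U)" "AE r in lborel. r > 0 \<longrightarrow> weak_deriv U r = g r"
proof -
  note 1 = primitive_pair_has_weak_deriv[OF assms]
  then show 2: "has_weak_deriv U (weak_deriv U)" unfolding weak_deriv_def by (rule someI[of "has_weak_deriv U"])
  show "AE r in lborel. r > 0 \<longrightarrow> weak_deriv U r = g r"
    using weak_deriv_unique[OF 2 1] by (simp add: AE_completion_iff)
qed

text \<open>\<open>weak_deriv U\<close> is a chosen function and may differ from \<open>g\<close>;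
  it agrees with \<open>g\<close> almost everywhere on the half-line and inherits measurability
  because Lebesgue measure is complete.\<close>

lemma primitive_pair_in_X_space:
  assumes P: "primitive_pair U g" and fin: "wint p \<alpha> U < \<infinity>" "wint p (p - 1) g < \<infinity>"
  shows "U \<in> X_space p \<alpha>"
proof -
  note D = primitive_pairD[OF P]
  note W = primitive_pair_weak_deriv[OF P]
  have "wint p (p - 1) (weak_deriv U) < \<infinity>" using fin wint_cong_AE[OF W(2)] by simp
  moreover have "U \<in> borel_measurable (lebesgue_on {0<..})"
    using D(1) by (intro measurable_restrict_space1 measurable_completion) simp
  moreover have "weak_deriv U \<in> borel_measurable (lebesgue_on {0<..})"
  proof -
    have "(\<lambda>r. indicator {0<..} r * weak_deriv U r) \<in> borel_measurable lebesgue"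
    proof (rule borel_measurable_AE)
      show "(\<lambda>r. indicator {0<..} r * g r) \<in> borel_measurable lebesgue"
        using D(2) by (intro measurable_completion) simp
      show "AE r in lebesgue. indicator {0<..} r * g r = indicator {0<..} r * weak_deriv U r"
        using AE_completion[OF W(2)] by eventually_elim (auto simp: indicator_def)
    qed
    then have "(\<lambda>r. indicator {0<..} r * weak_deriv U r) \<in> borel_measurable (lebesgue_on {0<..})"
      by (rule measurable_restrict_space1)
    then show ?thesis
      by (subst (asm) measurable_cong[where g = "weak_deriv U"]) auto
  qed
  ultimately show ?thesis
    using fin W(1) unfolding X_space_def wLp_def by (auto simp: wnorm_eq_wint ennpowr_less_top)
qed

section \<open>The truncated exponential\<close>

text \<open>What remains of \<open>exp_p\<close> after the factor \<open>t powr (p - 1)\<close> is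
  taken out: a genuine power series, continuous up to \<open>t = 0\<close>.\<close>

definition gamma_exp :: "real \<Rightarrow> real \<Rightarrow> real" where
  "gamma_exp p t = (\<Sum>j. t ^ j / Gamma (p + real j))"

text \<open>Each step multiplies by \<open>p + j\<close>, which is at least \<open>1 + j\<close>. It
  makes \<open>exp t / Gamma p\<close> a majorant of the series.\<close>

lemma Gamma_add_nat_ge:
  assumes "p \<ge> (1::real)"
  shows "Gamma p * fact j \<le> Gamma (p + real j)"
proof (induction j)
  case (Suc j)
  have "p + real j \<notin> \<int>\<^sub>\<le>\<^sub>0" using assms by (auto elim!: nonpos_Ints_cases)
  then have "Gamma (p + real (Suc j)) = (p + real j) * Gamma (p + real j)"
    using Gamma_plus1[of "p + real j"] by (simp add: add_ac)
  moreover have "(1 + real j) * (Gamma p * fact j) \<le> (p + real j) * Gamma (p + real j)"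
    using Suc assms by (intro mult_mono) auto
  ultimately show ?case by (simp add: algebra_simps)
qed simp

lemma gamma_exp_term_le:
  assumes "p \<ge> 1" "t \<ge> 0"
  shows "0 \<le> t ^ j / Gamma (p + real j)" "t ^ j / Gamma (p + real j) \<le> t ^ j /\<^sub>R fact j / Gamma p"
proof -
  have G: "Gamma p > 0" "Gamma (p + real j) > 0" using assms by auto
  show "0 \<le> t ^ j / Gamma (p + real j)" using assms G by simp
  have "t ^ j / Gamma (p + real j) \<le> t ^ j / (Gamma p * fact j)"
    using Gamma_add_nat_ge[OF assms(1), of j] assms G by (intro divide_left_mono) auto
  then show "t ^ j / Gamma (p + real j) \<le> t ^ j /\<^sub>R fact j / Gamma p" by (simp add: field_simps)
qed

lemma gamma_exp_majorant_sums: "(\<lambda>j. t ^ j /\<^sub>R fact j / Gamma p) sums (exp t / Gamma p)" for t :: real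
  by (intro sums_divide exp_converges)

lemma gamma_exp_summable:
  assumes "p \<ge> 1" "t \<ge> 0"
  shows "summable (\<lambda>j. t ^ j / Gamma (p + real j))"
proof (rule summable_comparison_test')
  show "summable (\<lambda>j. t ^ j /\<^sub>R fact j / Gamma p)" by (rule sums_summable[OF gamma_exp_majorant_sums])
  show "norm (t ^ j / Gamma (p + real j)) \<le> t ^ j /\<^sub>R fact j / Gamma p" for j
    using gamma_exp_term_le[OF assms, of j] unfolding real_norm_def by linarith
qed

lemma gamma_exp_mono:
  assumes "p \<ge> 1" "0 \<le> s" "s \<le> t"
  shows "gamma_exp p s \<le> gamma_exp p t"
  unfolding gamma_exp_def using assms
  by (intro suminf_le gamma_exp_summable divide_right_mono power_mono Gamma_real_nonneg) auto

text \<open>Both bounds separate the constant term \<open>1 / Gamma p\<close>, which will be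
  subtracted. The lower one keeps two terms of the series; the upper one combines the exponential
  majorant with \<open>exp t \<le> 1 + t * exp t\<close>.\<close>

lemma gamma_exp_bounds:
  assumes "p \<ge> 1" "t \<ge> 0"
  shows "1 / Gamma p + t / Gamma (p + 1) \<le> gamma_exp p t"
    "gamma_exp p t \<le> 1 / Gamma p + t * exp t / Gamma p"
proof -
  note S = gamma_exp_summable[OF assms]
  have "(\<Sum>j<2. t ^ j / Gamma (p + real j)) \<le> gamma_exp p t"
    unfolding gamma_exp_def using gamma_exp_term_le(1)[OF assms] by (intro sum_le_suminf S) auto
  then show "1 / Gamma p + t / Gamma (p + 1) \<le> gamma_exp p t"
    by (simp add: numeral_2_eq_2)
  have "gamma_exp p t \<le> exp t / Gamma p"
    unfolding gamma_exp_def sums_unique[OF gamma_exp_majorant_sums]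
    by (intro suminf_le gamma_exp_term_le(2)[OF assms] S sums_summable[OF gamma_exp_majorant_sums])
  also have "exp t \<le> 1 + t * exp t"
  proof -
    have "1 - t \<le> exp (- t)" using exp_ge_add_one_self[of "- t"] by simp
    then have "(1 - t) * exp t \<le> 1" using mult_right_mono[of "1 - t" "exp (- t)" "exp t"] by (simp add: exp_minus)
    then show ?thesis by (simp add: algebra_simps)
  qed
  then have "exp t / Gamma p \<le> (1 + t * exp t) / Gamma p"
    using assms by (intro divide_right_mono) auto
  finally show "gamma_exp p t \<le> 1 / Gamma p + t * exp t / Gamma p" by (simp add: add_divide_distrib)
qed

lemma gamma_exp_continuous:
  assumes "p \<ge> 1"
  shows "continuous_on {0..} (gamma_exp p)"
proof -
  have "isCont (\<lambda>x. \<Sum>n. inverse (Gamma (p + real n)) * x ^ n) t" if "t \<ge> 0" for t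
  proof (rule isCont_powser)
    show "summable (\<lambda>n. inverse (Gamma (p + real n)) * (t + 1) ^ n)"
      using gamma_exp_summable[OF assms, of "t + 1"] that by (simp add: divide_inverse mult.commute)
    show "norm t < norm (t + 1)" using that by simp
  qed
  then show ?thesis
    unfolding gamma_exp_def
    by (intro continuous_at_imp_continuous_on) (simp add: divide_inverse mult.commute)
qed

lemma exp_p_eq:
  assumes "p > 1" "t \<ge> 0"
  shows "exp_p p t = t powr (p - 1) * gamma_exp p t"
proof (cases "t = 0")
  case True
  then show ?thesis by (simp add: exp_p_def)
next
  case False
  then have "(\<lambda>j. t powr (p - 1 + real j) / Gamma (p + real j)) = (\<lambda>j. t powr (p - 1) * (t ^ j / Gamma (p + real j)))"
    using assms by (simp add: powr_add powr_realpow)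
  then show ?thesis
    unfolding exp_p_def gamma_exp_def
    using suminf_mult[OF gamma_exp_summable[of p t], of "t powr (p - 1)"] assms by simp
qed

section \<open>Splitting the integrand into leading term and remainder\<close>

locale trudinger_moser =
  fixes p \<alpha> \<mu> :: real
  assumes p2: "p \<ge> 2" and \<alpha>: "\<alpha> > -1" and \<mu>0: "\<mu> > 0"
begin

definition "p' = p / (p - 1)"
definition "lead_const = \<mu> powr (p - 1) / Gamma p"

definition remainder :: "real \<Rightarrow> real" where
  "remainder x = (\<mu> * \<bar>x\<bar> powr p') powr (p - 1) * (gamma_exp p (\<mu> * \<bar>x\<bar> powr p') - 1 / Gamma p)"

lemma p'_facts: "p' > 1" "p' * (p - 1) = p" "p' * p = p + p'" "p' / p = 1 / (p - 1)" "1 / p' = 1 - 1 / p"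
proof -
  have p: "p > 0" "p - 1 > 0" using p2 by auto
  show "p' > 1" "p' * (p - 1) = p" using p p2 by (simp_all add: p'_def divide_simps)
  then show "p' * p = p + p'" by (simp add: right_diff_distrib)
  show "p' / p = 1 / (p - 1)" "1 / p' = 1 - 1 / p" using p by (simp_all add: p'_def diff_divide_distrib)
qed

lemma argument_powr: "(\<mu> * \<bar>x\<bar> powr p') powr (p - 1) = \<mu> powr (p - 1) * \<bar>x\<bar> powr p"
  using \<mu>0 by (simp add: powr_mult powr_powr p'_facts(2))

lemma exp_p_split: "exp_p p (\<mu> * \<bar>x\<bar> powr p') = lead_const * \<bar>x\<bar> powr p + remainder x"
  using p2 \<mu>0 exp_p_eq[of p "\<mu> * \<bar>x\<bar> powr p'"]
  by (simp add: remainder_def argument_powr lead_const_def right_diff_distrib)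

lemma lead_const_pos: "lead_const > 0"
  using p2 \<mu>0 by (simp add: lead_const_def)

text \<open>Compared with the leading term there is an additional factor
  \<open>\<bar>x\<bar> powr p'\<close>, small for small \<open>x\<close>. The exponent comes from
  \<open>p' * p = p + p'\<close>.\<close>

lemma remainder_le: "remainder x \<le> \<mu> powr p / Gamma p * (\<bar>x\<bar> powr (p + p') * exp (\<mu> * \<bar>x\<bar> powr p'))"
proof -
  define t where "t = \<mu> * \<bar>x\<bar> powr p'"
  have t: "t \<ge> 0" using \<mu>0 by (simp add: t_def)
  have "remainder x \<le> t powr (p - 1) * (t * exp t / Gamma p)"
    unfolding remainder_def t_def[symmetric]
    using gamma_exp_bounds(2)[of p t] p2 t by (intro mult_left_mono) auto
  also have "\<dots> = (t powr (p - 1) * t) * exp t / Gamma p" by simp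
  also have "t powr (p - 1) * t = t powr p" using t by (cases "t = 0") (simp_all add: powr_diff)
  also have "t powr p = \<mu> powr p * \<bar>x\<bar> powr (p + p')"
    using \<mu>0 by (simp add: t_def powr_mult powr_powr p'_facts(3))
  finally show ?thesis by (simp add: t_def mult.assoc)
qed

text \<open>The left side is the second term of \<open>exp_p\<close>, the one that later beats the
  deficit of the leading term.\<close>

lemma remainder_ge: "\<mu> powr p / Gamma (p + 1) * \<bar>x\<bar> powr (p + p') \<le> remainder x"
proof -
  define t where "t = \<mu> * \<bar>x\<bar> powr p'"
  have t: "t \<ge> 0" using \<mu>0 by (simp add: t_def)
  have "\<mu> powr p / Gamma (p + 1) * \<bar>x\<bar> powr (p + p') = t powr p / Gamma (p + 1)"
    using \<mu>0 by (simp add: t_def powr_mult powr_powr p'_facts(3))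
  also have "t powr p = t powr (p - 1) * t" using t by (cases "t = 0") (simp_all add: powr_diff)
  also have "t powr (p - 1) * t / Gamma (p + 1) = t powr (p - 1) * (t / Gamma (p + 1))" by simp
  also have "\<dots> \<le> remainder x"
    unfolding remainder_def t_def[symmetric]
    using gamma_exp_bounds(1)[of p t] p2 t by (intro mult_left_mono) auto
  finally show ?thesis .
qed

lemma remainder_nonneg: "remainder x \<ge> 0"
  using p2 by (intro order_trans[OF _ remainder_ge]) auto

lemma remainder_zero: "remainder 0 = 0"
  by (simp add: remainder_def)

lemma remainder_continuous: "continuous_on UNIV remainder"
proof -
  have 1: "continuous_on UNIV (\<lambda>x. \<mu> * \<bar>x\<bar> powr p')"
    using p'_facts(1) by (intro continuous_intros continuous_on_powr') auto
  have 2: "continuous_on UNIV (\<lambda>x. (\<mu> * \<bar>x\<bar> powr p') powr (p - 1))"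
    using p2 \<mu>0 by (intro continuous_on_powr' 1 continuous_intros) auto
  have 3: "continuous_on UNIV (\<lambda>x. gamma_exp p (\<mu> * \<bar>x\<bar> powr p'))"
    using p2 \<mu>0 by (intro continuous_on_compose2[OF gamma_exp_continuous[of p] 1]) auto
  show ?thesis unfolding remainder_def by (intro continuous_intros 2 3)
qed

lemma remainder_measurable[measurable]: "remainder \<in> borel_measurable borel"
  by (intro borel_measurable_continuous_onI remainder_continuous)

lemma exp_p_mono:
  assumes "\<bar>x\<bar> \<le> \<bar>y\<bar>"
  shows "exp_p p (\<mu> * \<bar>x\<bar> powr p') \<le> exp_p p (\<mu> * \<bar>y\<bar> powr p')"
proof -
  have le: "\<mu> * \<bar>x\<bar> powr p' \<le> \<mu> * \<bar>y\<bar> powr p'"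
    using assms \<mu>0 p'_facts(1) by (intro mult_left_mono powr_mono2) auto
  have "gamma_exp p 0 \<ge> 0" using gamma_exp_bounds(1)[of p 0] p2 by (intro order_trans[OF _ gamma_exp_bounds(1)]) auto
  then have "gamma_exp p (\<mu> * \<bar>x\<bar> powr p') \<ge> 0"
    using gamma_exp_mono[of p 0 "\<mu> * \<bar>x\<bar> powr p'"] p2 \<mu>0 by auto
  then show ?thesis
    using p2 \<mu>0 le by (auto simp: exp_p_eq intro!: mult_mono powr_mono2 gamma_exp_mono)
qed

end

section \<open>Uniform bounds\<close>

text \<open>The inequality \<open>y \<le> exp y\<close> at \<open>y = \<epsilon> * z / p\<close>,
  raised to the power \<open>p\<close>.\<close>

lemma powr_le_exp:
  fixes z p \<epsilon> :: real
  assumes "z \<ge> 0" "p > 0" "\<epsilon> > 0"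
  shows "z powr p \<le> (p / \<epsilon>) powr p * exp (\<epsilon> * z)"
proof -
  have "\<epsilon> * z / p \<le> exp (\<epsilon> * z / p)"
    using exp_ge_add_one_self[of "\<epsilon> * z / p"] by linarith
  then have "(\<epsilon> * z / p) powr p \<le> exp (\<epsilon> * z / p) powr p"
    using assms by (intro powr_mono2) auto
  also have "\<dots> = exp (\<epsilon> * z)" using assms by (simp add: powr_def)
  finally have "(p / \<epsilon>) powr p * (\<epsilon> * z / p) powr p \<le> (p / \<epsilon>) powr p * exp (\<epsilon> * z)"
    by (intro mult_left_mono) auto
  moreover have "(p / \<epsilon>) powr p * (\<epsilon> * z / p) powr p = z powr p"
    using assms by (subst powr_mult[symmetric]) auto
  ultimately show ?thesis by simp
qed

text \<open>With \<open>\<delta>\<close> fixed by \<open>(1 + \<delta>) powr q = \<theta>\<close>,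
  either \<open>K \<le> \<delta> * y\<close> and the sum is at most
  \<open>(1 + \<delta>) * y\<close>, or \<open>y\<close> is below \<open>K / \<delta>\<close> and
  everything is bounded.\<close>

lemma add_powr_le:
  fixes \<theta> q K :: real
  assumes "\<theta> > 1" "q > 0" "K \<ge> 0"
  shows "\<exists>C. \<forall>y\<ge>0. (K + y) powr q \<le> \<theta> * y powr q + C"
proof -
  define \<delta> where "\<delta> = \<theta> powr (1 / q) - 1"
  have \<delta>: "\<delta> > 0" "(1 + \<delta>) powr q = \<theta>"
    using assms by (auto simp: \<delta>_def powr_powr intro: gr_one_powr)
  have "(K + y) powr q \<le> \<theta> * y powr q + (K + K / \<delta>) powr q" if y: "y \<ge> 0" for y
  proof (cases "K \<le> \<delta> * y")
    case True
    then have "(K + y) powr q \<le> ((1 + \<delta>) * y) powr q"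
      using assms y by (intro powr_mono2) (auto simp: algebra_simps)
    also have "\<dots> = \<theta> * y powr q" using \<delta> y by (simp add: powr_mult)
    finally show ?thesis by (simp add: add_increasing2)
  next
    case False
    then have "(K + y) powr q \<le> (K + K / \<delta>) powr q"
      using assms y \<delta> by (intro powr_mono2) (auto simp: field_simps)
    then show ?thesis using assms by (simp add: add_increasing)
  qed
  then show ?thesis by blast
qed

lemma nn_integral_powr_Icc:
  fixes a s t :: real
  assumes "a \<noteq> 0" "0 < s" "s \<le> t"
  shows "(\<integral>\<^sup>+r. ennreal (r powr (a - 1)) * indicator {s..t} r \<partial>lborel) = ennreal (t powr a / a - s powr a / a)"
proof (rule nn_integral_FTC_Icc)
  fix x assume "x \<in> {s..t}"
  then show "((\<lambda>r. r powr a / a) has_real_derivative x powr (a - 1)) (at x)"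
    using assms by (auto intro!: derivative_eq_intros simp: powr_diff)
qed (use assms in auto)

lemma nn_integral_inverse_Icc:
  fixes s t :: real
  assumes "0 < s" "s \<le> t"
  shows "(\<integral>\<^sup>+r. ennreal (1 / r) * indicator {s..t} r \<partial>lborel) = ennreal (ln (t / s))"
proof -
  have "(\<integral>\<^sup>+r. ennreal (1 / r) * indicator {s..t} r \<partial>lborel) = ennreal (ln t - ln s)"
  proof (rule nn_integral_FTC_Icc)
    fix x assume "x \<in> {s..t}"
    then show "(ln has_real_derivative 1 / x) (at x)"
      using assms by (auto intro!: derivative_eq_intros)
  qed (use assms in auto)
  then show ?thesis using assms by (simp add: ln_div)
qed

lemma nn_integral_powr_from_0:
  fixes b T :: real
  assumes "b > -1" "T > 0"
  shows "(\<integral>\<^sup>+r. ennreal (r powr b) * indicator {0<..T} r \<partial>lborel) < \<infinity>"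
proof -
  have "((\<lambda>x. x powr b) has_integral T powr (b + 1) / (b + 1)) {0..T}"
    using has_integral_powr_from_0[of b T] assms by simp
  then have "((\<lambda>x. indicator {0..T} x * x powr b) has_integral T powr (b + 1) / (b + 1)) UNIV"
    by (subst (asm) has_integral_restrict_UNIV[symmetric]) (simp add: indicator_def of_bool_def if_distrib[of "\<lambda>x. x * _"] cong: if_cong)
  then have "(\<integral>\<^sup>+x. ennreal (indicator {0..T} x * x powr b) \<partial>lborel) = ennreal (T powr (b + 1) / (b + 1))"
    using assms by (intro nn_integral_has_integral_lborel) auto
  moreover have "(\<integral>\<^sup>+r. ennreal (r powr b) * indicator {0<..T} r \<partial>lborel) \<le> (\<integral>\<^sup>+x. ennreal (indicator {0..T} x * x powr b) \<partial>lborel)"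
    by (intro nn_integral_mono) (auto simp: indicator_def)
  ultimately show ?thesis by (simp add: order_le_less_trans)
qed

section \<open>Pointwise control by the norm and domination near zero\<close>

context trudinger_moser
begin

text \<open>Hoelder's inequality for \<open>\<bar>f r\<bar> * r powr ((p - 1) / p)\<close> against
  the inverse weight, whose \<open>p'\<close>-th power is \<open>1 / r\<close>; hence the logarithm.
  It is obtained by integrating Young's inequality with an optimized parameter.\<close>

lemma L1_bound_of_wint:
  assumes f[measurable]: "f \<in> borel_measurable borel" and st: "0 < s" "s \<le> t"
    and \<kappa>: "\<kappa> > 0" "wint p (p - 1) f \<le> ennreal (\<kappa> powr p)"
  shows "(\<integral>\<^sup>+r. ennreal \<bar>f r\<bar> * indicator {s..t} r \<partial>lborel) \<le> ennreal (\<kappa> * ln (t / s) powr (1 / p'))"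
proof (cases "s = t")
  \<comment> \<open>Here the logarithm is 0, and so would be the parameter \<open>lam\<close> by
    which the main case divides.\<close>
  case True
  have "AE r in lborel. ennreal \<bar>f r\<bar> * indicator {s..t} r = 0"
    using AE_lborel_singleton[of s] by eventually_elim (use True in auto)
  then have "(\<integral>\<^sup>+r. ennreal \<bar>f r\<bar> * indicator {s..t} r \<partial>lborel) = 0"
    by (subst nn_integral_0_iff_AE) auto
  then show ?thesis by simp
next
  case False
  define L where "L = ln (t / s)"
  have L: "L > 0" using False st by (simp add: L_def ln_div)
  define B where "B = \<kappa> * L powr (1 / p')"
  \<comment> \<open>This value balances Young's inequality:
    \<open>lam powr p * \<kappa> powr p\<close> and \<open>lam powr (- p') * L\<close> both equal
    \<open>B\<close>, and the weights \<open>1 / p\<close> and \<open>1 / p'\<close> add up to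
    1.\<close>
  define lam where "lam = \<kappa> powr (1 / p - 1) * L powr (1 / (p * p'))"
  have lam: "lam > 0" using L \<kappa> by (simp add: lam_def)
  have pp: "p > 1" "p' > 1" "1 / p + 1 / p' = 1" using p2 p'_facts(1,5) by auto
  have lam1: "lam powr p * \<kappa> powr p = B"
    using pp L \<kappa> by (simp add: lam_def B_def powr_mult powr_powr powr_add[symmetric] left_diff_distrib)
  have e: "(1 / p - 1) * p' = - 1" using pp by (simp add: field_simps)
  have "lam powr (- p') * L = \<kappa> powr (- ((1 / p - 1) * p')) * (L powr (- (1 / p)) * L powr 1)"
    using pp L \<kappa> by (simp add: lam_def powr_mult powr_powr)
  also have "L powr (- (1 / p)) * L powr 1 = L powr (1 / p')"
    using pp by (simp only: powr_add[symmetric]) (simp add: p'_facts(5))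
  finally have lam2: "lam powr (- p') * L = B" unfolding e using \<kappa> by (simp add: B_def)
  have young: "\<bar>f r\<bar> \<le> lam powr p / p * (\<bar>f r\<bar> powr p * r powr (p - 1)) + lam powr (- p') / p' * (1 / r)" if r: "r > 0" for r
  proof -
    have "(lam * (\<bar>f r\<bar> * r powr ((p - 1) / p))) * (r powr (- ((p - 1) / p)) / lam)
        \<le> (lam * (\<bar>f r\<bar> * r powr ((p - 1) / p))) powr p / p + (r powr (- ((p - 1) / p)) / lam) powr p' / p'"
      using pp lam by (intro Youngs_inequality) auto
    also have "(lam * (\<bar>f r\<bar> * r powr ((p - 1) / p))) powr p = lam powr p * (\<bar>f r\<bar> powr p * r powr (p - 1))"
      using lam pp by (simp add: powr_mult powr_powr)
    also have "(r powr (- ((p - 1) / p)) / lam) powr p' = lam powr (- p') * (1 / r)"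
    proof -
      have "(p - 1) * (p' / p) = 1" using p'_facts(4) p2 by simp
      then have e': "- ((p - 1) / p) * p' = -1" by simp
      have "(r powr (- ((p - 1) / p)) / lam) powr p' = r powr (- ((p - 1) / p) * p') / lam powr p'"
        using lam by (simp only: powr_divide powr_powr powr_ge_zero less_imp_le)
      then show ?thesis unfolding e' using r by (simp add: powr_minus_divide)
    qed
    also have "(lam * (\<bar>f r\<bar> * r powr ((p - 1) / p))) * (r powr (- ((p - 1) / p)) / lam) = \<bar>f r\<bar>"
      using lam r by (simp add: powr_minus_divide)
    finally show ?thesis by (simp add: mult_ac)
  qed
  have "(\<integral>\<^sup>+r. ennreal \<bar>f r\<bar> * indicator {s..t} r \<partial>lborel) \<le>
    (\<integral>\<^sup>+r. ennreal (lam powr p / p) * (ennreal (\<bar>f r\<bar> powr p * r powr (p - 1)) * indicator {0<..} r)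
        + ennreal (lam powr (- p') / p') * (ennreal (1 / r) * indicator {s..t} r) \<partial>lborel)"
  proof (rule nn_integral_mono)
    fix r
    show "ennreal \<bar>f r\<bar> * indicator {s..t} r \<le> ennreal (lam powr p / p) * (ennreal (\<bar>f r\<bar> powr p * r powr (p - 1)) * indicator {0<..} r)
        + ennreal (lam powr (- p') / p') * (ennreal (1 / r) * indicator {s..t} r)"
    proof (cases "r \<in> {s..t}")
      case True
      then have "r > 0" using st by auto
      with young[OF this] pp True show ?thesis
        by (simp add: ennreal_mult[symmetric] ennreal_plus[symmetric] del: ennreal_plus)
    qed simp
  qed
  also have "\<dots> = ennreal (lam powr p / p) * wint p (p - 1) f + ennreal (lam powr (- p') / p') * ennreal L"
    unfolding wint_def using nn_integral_inverse_Icc[OF st]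
    by (subst nn_integral_add) (auto simp: nn_integral_cmult L_def)
  also have "\<dots> \<le> ennreal (lam powr p / p) * ennreal (\<kappa> powr p) + ennreal (lam powr (- p') / p') * ennreal L"
    using \<kappa> by (intro add_mono mult_left_mono) auto
  also have "\<dots> = ennreal (lam powr p * \<kappa> powr p / p + lam powr (- p') * L / p')"
    using pp L by (simp add: ennreal_mult[symmetric] ennreal_plus[symmetric] del: ennreal_plus)
  also have "lam powr p * \<kappa> powr p / p + lam powr (- p') * L / p' = B * (1 / p + 1 / p')"
    by (simp only: lam1 lam2) (simp add: algebra_simps)
  finally show ?thesis using pp by (simp add: B_def L_def)
qed

lemma primitive_pair_increment_bound:
  assumes P: "primitive_pair U g" and g: "wint p (p - 1) g \<le> 1" and st: "0 < s" "s \<le> t"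
  shows "\<bar>U t - U s\<bar> \<le> ln (t / s) powr (1 / p')"
proof -
  note D = primitive_pairD[OF P]
  note [measurable] = D(2)
  have "ennreal \<bar>U t - U s\<bar> \<le> (\<integral>\<^sup>+r. norm (indicator {s..t} r *\<^sub>R g r) \<partial>lborel)"
    using integral_norm_bound_ennreal[OF D(4)[OF st(1), of t, unfolded set_integrable_def]] D(5)[OF st]
    by (simp add: set_lebesgue_integral_def)
  also have "\<dots> = (\<integral>\<^sup>+r. ennreal \<bar>g r\<bar> * indicator {s..t} r \<partial>lborel)"
    by (intro nn_integral_cong) (auto simp: indicator_def)
  also have "\<dots> \<le> ennreal (1 * ln (t / s) powr (1 / p'))"
    using g by (intro L1_bound_of_wint D(2) st) auto
  finally show ?thesis by simp
qed

text \<open>If \<open>\<bar>U r\<bar>\<close> exceeded this bound, \<open>\<bar>U\<bar>\<close> would exceed the first summand on all of \<open>[r, r exp \<delta>]\<close>,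
  which would make \<open>wint p \<alpha> U\<close> larger than \<open>1\<close>.\<close>

definition tail_bound :: "real \<Rightarrow> real \<Rightarrow> real" where
  "tail_bound \<delta> r = ((\<alpha> + 1) / (r powr (\<alpha> + 1) * (exp ((\<alpha> + 1) * \<delta>) - 1))) powr (1 / p) + \<delta> powr (1 / p')"

lemma primitive_pair_pointwise_bound:
  assumes P: "primitive_pair U g" and g: "wint p (p - 1) g \<le> 1" and U: "wint p \<alpha> U \<le> 1"
    and r: "r > 0" "\<delta> > 0"
  shows "\<bar>U r\<bar> \<le> tail_bound \<delta> r"
proof (rule ccontr)
  note D = primitive_pairD[OF P]
  note [measurable] = D(1)
  define a where "a = \<alpha> + 1"
  have a: "a > 0" using \<alpha> by (simp add: a_def)
  \<comment> \<open>The integral of \<open>s powr \<alpha>\<close> over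
    \<open>[r, r exp \<delta>]\<close>.\<close>
  define V where "V = r powr a * (exp (a * \<delta>) - 1) / a"
  have V: "V > 0" using a r by (simp add: V_def)
  define m where "m = \<bar>U r\<bar> - \<delta> powr (1 / p')"
  assume "\<not> ?thesis"
  then have m: "(1 / V) powr (1 / p) < m"
    by (simp add: tail_bound_def m_def V_def a_def)
  then have m0: "m > 0" by (meson le_less_trans powr_ge_zero)
  have "((1 / V) powr (1 / p)) powr p < m powr p"
    using m p2 by (intro powr_less_mono2) auto
  then have mV: "m powr p * V > 1" using V p2 by (simp add: powr_powr field_simps)
  have le: "r \<le> r * exp \<delta>" using r by simp
  \<comment> \<open>On this interval \<open>ln (s / r) \<le> \<delta>\<close>, so
    \<open>\<bar>U s\<bar>\<close> is below \<open>\<bar>U r\<bar>\<close> by at most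
    \<open>\<delta> powr (1 / p')\<close>.\<close>
  have lower: "m \<le> \<bar>U s\<bar>" if s: "s \<in> {r..r * exp \<delta>}" for s
  proof -
    have "ln (s / r) \<le> ln (exp \<delta>)" using s r by (subst ln_le_cancel_iff) (auto simp: field_simps)
    then have "ln (s / r) powr (1 / p') \<le> \<delta> powr (1 / p')"
      using s r p'_facts(1) by (intro powr_mono2) auto
    then show ?thesis
      using primitive_pair_increment_bound[OF P g r(1), of s] s by (auto simp: m_def)
  qed
  have "ennreal (m powr p * V) = ennreal (m powr p) * (\<integral>\<^sup>+s. ennreal (s powr (a - 1)) * indicator {r..r * exp \<delta>} s \<partial>lborel)"
  proof -
    have "(r * exp \<delta>) powr a = r powr a * exp (a * \<delta>)" using r by (simp add: powr_def ln_mult exp_add[symmetric] distrib_left)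
    then have "(r * exp \<delta>) powr a / a - r powr a / a = V"
      by (simp add: V_def diff_divide_distrib right_diff_distrib)
    then show ?thesis using nn_integral_powr_Icc[OF _ r(1) le, of a] a V by (simp add: ennreal_mult)
  qed
  also have "\<dots> = (\<integral>\<^sup>+s. ennreal (m powr p) * (ennreal (s powr (a - 1)) * indicator {r..r * exp \<delta>} s) \<partial>lborel)"
    by (subst nn_integral_cmult) auto
  also have "\<dots> \<le> wint p \<alpha> U"
    unfolding wint_def
  proof (rule nn_integral_mono)
    fix s
    show "ennreal (m powr p) * (ennreal (s powr (a - 1)) * indicator {r..r * exp \<delta>} s) \<le> ennreal (\<bar>U s\<bar> powr p * s powr \<alpha>) * indicator {0<..} s"
    proof (cases "s \<in> {r..r * exp \<delta>}")
      case True
      then have "m powr p * s powr (a - 1) \<le> \<bar>U s\<bar> powr p * s powr \<alpha>"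
        using lower[OF True] m0 p2 by (auto simp: a_def intro!: mult_right_mono powr_mono2)
      then show ?thesis using True r by (simp add: ennreal_mult[symmetric])
    qed simp
  qed
  also have "\<dots> \<le> ennreal 1" using U by simp
  finally show False using mV by (simp add: ennreal_le_1)
qed

lemma tail_bound_tendsto: "\<delta> > 0 \<Longrightarrow> (tail_bound \<delta> \<longlongrightarrow> \<delta> powr (1 / p')) at_top"
proof -
  assume d: "\<delta> > 0"
  have "((\<lambda>r. r powr - (\<alpha> + 1)) \<longlongrightarrow> 0) at_top"
    using \<alpha> by (intro tendsto_neg_powr filterlim_ident) auto
  then have "((\<lambda>r. (\<alpha> + 1) / (exp ((\<alpha> + 1) * \<delta>) - 1) * r powr - (\<alpha> + 1)) \<longlongrightarrow> (\<alpha> + 1) / (exp ((\<alpha> + 1) * \<delta>) - 1) * 0) at_top"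
    by (intro tendsto_mult tendsto_const)
  then have "((\<lambda>r. (\<alpha> + 1) / (r powr (\<alpha> + 1) * (exp ((\<alpha> + 1) * \<delta>) - 1))) \<longlongrightarrow> 0) at_top"
    by (simp only: powr_minus divide_inverse mult_ac inverse_mult_distrib mult_zero_right mult_zero_left)
  then have "((\<lambda>r. ((\<alpha> + 1) / (r powr (\<alpha> + 1) * (exp ((\<alpha> + 1) * \<delta>) - 1))) powr (1 / p)) \<longlongrightarrow> 0 powr (1 / p)) at_top"
    using p2 \<alpha> d by (intro tendsto_powr' tendsto_const) auto
  from tendsto_add[OF this tendsto_const[of "\<delta> powr (1 / p')"]]
  show ?thesis by (simp add: tail_bound_def[abs_def])
qed

text \<open>The first summand of \<open>tail_bound\<close> vanishes as \<open>r\<close> grows, and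
  \<open>\<delta>\<close> is chosen so that the second is \<open>\<eta> / 2\<close>. The radius
  depends on \<open>\<eta>\<close> only, not on the function.\<close>

lemma uniform_decay:
  assumes "\<eta> > 0"
  shows "\<exists>T>0. \<forall>U g r. primitive_pair U g \<longrightarrow> wint p (p - 1) g \<le> 1 \<longrightarrow> wint p \<alpha> U \<le> 1 \<longrightarrow>
    r \<ge> T \<longrightarrow> \<bar>U r\<bar> \<le> \<eta>"
proof -
  define \<delta> where "\<delta> = (\<eta> / 2) powr p'"
  have \<delta>: "\<delta> > 0" "\<delta> powr (1 / p') = \<eta> / 2" using assms p'_facts(1) by (auto simp: \<delta>_def powr_powr)
  have "\<forall>\<^sub>F r in at_top. tail_bound \<delta> r < \<eta>"
    using order_tendstoD(2)[OF tail_bound_tendsto[OF \<delta>(1)], of \<eta>] \<delta> assms by simp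
  then obtain T where T: "\<And>r. r \<ge> T \<Longrightarrow> tail_bound \<delta> r < \<eta>" by (auto simp: eventually_at_top_linorder)
  show ?thesis
  proof (intro exI[of _ "max T 1"] conjI allI impI)
    fix U g r assume "primitive_pair U g" "wint p (p - 1) g \<le> 1" "wint p \<alpha> U \<le> 1" "r \<ge> max T 1"
    then show "\<bar>U r\<bar> \<le> \<eta>"
      using primitive_pair_pointwise_bound[of U g r \<delta>] T[of r] \<delta> by auto
  qed simp
qed

text \<open>Comparison with the value at \<open>T\<close> bounds
  \<open>\<rho> * \<bar>U r\<bar> powr p'\<close> by \<open>\<nu> * ln (T / r)\<close> plus a
  constant, so the remainder is at most a multiple of \<open>r powr (- \<nu>)\<close>; the majorant
  \<open>r powr (\<alpha> - \<nu>)\<close> is integrable at 0.\<close>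

lemma remainder_dominated_near_zero:
  assumes \<mu>: "\<mu> < \<alpha> + 1" and T: "T > 0"
  shows "\<exists>w. w \<in> borel_measurable borel \<and> (\<integral>\<^sup>+r. ennreal (w r) * indicator {0<..T} r \<partial>lborel) < \<infinity> \<and>
    (\<forall>U g r. primitive_pair U g \<longrightarrow> wint p (p - 1) g \<le> 1 \<longrightarrow> wint p \<alpha> U \<le> 1 \<longrightarrow> 0 < r \<longrightarrow> r \<le> T \<longrightarrow>
       remainder (U r) * r powr \<alpha> \<le> w r)"
proof -
  \<comment> \<open>Each gap in \<open>\<mu> < \<rho> < \<nu> < \<alpha> + 1\<close> has its use:
    the first absorbs the factor \<open>\<bar>x\<bar> powr (p + p')\<close>, the second the bounded
    term \<open>K\<close>, the third gives integrability.\<close>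
  define \<nu> where "\<nu> = (\<mu> + (\<alpha> + 1)) / 2"
  define \<rho> where "\<rho> = (\<mu> + \<nu>) / 2"
  have \<nu>: "\<mu> < \<rho>" "\<rho> < \<nu>" "\<nu> < \<alpha> + 1" "0 < \<rho>" using \<mu> \<mu>0 \<alpha> by (auto simp: \<nu>_def \<rho>_def field_simps)
  define K where "K = tail_bound 1 T"
  have K: "K \<ge> 0" by (simp add: K_def tail_bound_def)
  obtain C where C: "\<And>y. y \<ge> 0 \<Longrightarrow> (K + y) powr p' \<le> \<nu> / \<rho> * y powr p' + C"
    using add_powr_le[of "\<nu> / \<rho>" p' K] \<nu> K p'_facts(1) by auto
  define D where "D = \<mu> powr p / Gamma p * (p / (\<rho> - \<mu>)) powr p"
  have D: "D \<ge> 0" using p2 by (simp add: D_def)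
  have exp_bound: "remainder x \<le> D * exp (\<rho> * \<bar>x\<bar> powr p')" for x
  proof -
    have "\<bar>x\<bar> powr (p + p') = (\<bar>x\<bar> powr p') powr p" by (simp add: powr_powr p'_facts(3))
    also have "\<dots> \<le> (p / (\<rho> - \<mu>)) powr p * exp ((\<rho> - \<mu>) * \<bar>x\<bar> powr p')"
      using p2 \<nu> by (intro powr_le_exp) auto
    finally have "\<bar>x\<bar> powr (p + p') * exp (\<mu> * \<bar>x\<bar> powr p') \<le>
        (p / (\<rho> - \<mu>)) powr p * exp ((\<rho> - \<mu>) * \<bar>x\<bar> powr p') * exp (\<mu> * \<bar>x\<bar> powr p')"
      by (intro mult_right_mono) auto
    also have "\<dots> = (p / (\<rho> - \<mu>)) powr p * exp (\<rho> * \<bar>x\<bar> powr p')"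
      by (simp add: mult.assoc exp_add[symmetric] left_diff_distrib)
    finally have "\<mu> powr p / Gamma p * (\<bar>x\<bar> powr (p + p') * exp (\<mu> * \<bar>x\<bar> powr p'))
       \<le> \<mu> powr p / Gamma p * ((p / (\<rho> - \<mu>)) powr p * exp (\<rho> * \<bar>x\<bar> powr p'))"
      using p2 by (intro mult_left_mono) auto
    then show ?thesis using remainder_le[of x] by (simp add: D_def mult_ac)
  qed
  define w where "w r = D * exp (\<rho> * C) * T powr \<nu> * r powr (\<alpha> - \<nu>)" for r
  show ?thesis
  proof (intro exI[of _ w] conjI allI impI)
    show "w \<in> borel_measurable borel" unfolding w_def by measurable
    have "(\<integral>\<^sup>+r. ennreal (w r) * indicator {0<..T} r \<partial>lborel) =
        ennreal (D * exp (\<rho> * C) * T powr \<nu>) * (\<integral>\<^sup>+r. ennreal (r powr (\<alpha> - \<nu>)) * indicator {0<..T} r \<partial>lborel)"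
      using D by (subst nn_integral_cmult[symmetric]) (auto simp: w_def ennreal_mult mult_ac)
    also have "\<dots> < \<infinity>"
      using nn_integral_powr_from_0[of "\<alpha> - \<nu>" T] \<nu> T by (simp add: ennreal_mult_less_top)
    finally show "(\<integral>\<^sup>+r. ennreal (w r) * indicator {0<..T} r \<partial>lborel) < \<infinity>" .
  next
    fix U g r
    assume P: "primitive_pair U g" "wint p (p - 1) g \<le> 1" "wint p \<alpha> U \<le> 1" and r: "0 < r" "r \<le> T"
    define y where "y = ln (T / r) powr (1 / p')"
    have lnT: "ln (T / r) \<ge> 0" using r T by simp
    have y: "y \<ge> 0" "y powr p' = ln (T / r)" using lnT p'_facts(1) by (auto simp: y_def powr_powr)
    have "\<bar>U r\<bar> \<le> \<bar>U T\<bar> + y"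
      using primitive_pair_increment_bound[OF P(1,2) r] by (simp add: y_def)
    also have "\<dots> \<le> K + y"
      using primitive_pair_pointwise_bound[OF P T, of 1] by (simp add: K_def)
    finally have "\<bar>U r\<bar> powr p' \<le> (K + y) powr p'"
      using p'_facts(1) by (intro powr_mono2) auto
    also have "\<dots> \<le> \<nu> / \<rho> * ln (T / r) + C" using C[OF y(1)] y(2) by simp
    finally have "\<rho> * \<bar>U r\<bar> powr p' \<le> \<rho> * (\<nu> / \<rho> * ln (T / r) + C)"
      using \<nu> by (intro mult_left_mono) auto
    also have "\<dots> = \<nu> * ln (T / r) + \<rho> * C" using \<nu> by (simp add: distrib_left)
    finally have "exp (\<rho> * \<bar>U r\<bar> powr p') \<le> exp (\<nu> * ln (T / r) + \<rho> * C)" by simp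
    also have "\<dots> = exp (\<rho> * C) * (T / r) powr \<nu>"
      using r T by (simp add: powr_def exp_add mult_ac)
    finally have "D * exp (\<rho> * \<bar>U r\<bar> powr p') \<le> D * (exp (\<rho> * C) * (T / r) powr \<nu>)"
      using D by (intro mult_left_mono)
    then have "remainder (U r) \<le> D * (exp (\<rho> * C) * (T / r) powr \<nu>)"
      using exp_bound[of "U r"] by linarith
    then have "remainder (U r) * r powr \<alpha> \<le> D * (exp (\<rho> * C) * (T / r) powr \<nu>) * r powr \<alpha>"
      by (intro mult_right_mono) auto
    also have "\<dots> = w r"
      using r T by (simp add: w_def powr_divide powr_diff)
    finally show "remainder (U r) * r powr \<alpha> \<le> w r" .
  qed
qed

end

section \<open>Lower semicontinuity of the derivative norm\<close>

text \<open>Write \<open>u powr s\<close> as \<open>u * u powr (s - 1)\<close> and enlarge the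
  second factor to \<open>(u + v) powr (s - 1)\<close>; likewise for \<open>v\<close>.\<close>

lemma powr_superadditive:
  fixes u v s :: real
  assumes "u \<ge> 0" "v \<ge> 0" "s \<ge> 1"
  shows "u powr s + v powr s \<le> (u + v) powr s"
proof -
  have *: "x * x powr (s - 1) = x powr s" if "x \<ge> 0" for x :: real
    using that by (cases "x = 0") (simp_all add: powr_diff)
  have "u * u powr (s - 1) \<le> u * (u + v) powr (s - 1)" "v * v powr (s - 1) \<le> v * (u + v) powr (s - 1)"
    using assms by (auto intro!: mult_left_mono powr_mono2)
  then have "u powr s + v powr s \<le> (u + v) * (u + v) powr (s - 1)"
    using * assms by (simp add: distrib_right)
  then show ?thesis using *[of "u + v"] assms by simp
qed

lemma powr_midpoint_le:
  fixes x y s :: real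
  assumes "x \<ge> 0" "y \<ge> 0" "s \<ge> 1"
  shows "((x + y) / 2) powr s \<le> (x powr s + y powr s) / 2"
proof (cases "x > 0 \<and> y > 0")
  case True
  then have "((1 - 1/2) *\<^sub>R x + (1/2) *\<^sub>R y) powr s \<le> (1 - 1/2) * x powr s + (1/2) * y powr s"
    using powr_convex[OF assms(3)] by (intro convex_onD) auto
  then show ?thesis by (simp add: add_divide_distrib)
next
  \<comment> \<open>One argument is 0, and the claim reduces to
    \<open>2 \<le> 2 powr s\<close>.\<close>
  case False
  have "(z / 2) powr s \<le> z powr s / 2" if "z \<ge> 0" for z :: real
  proof -
    have "2 powr 1 \<le> (2::real) powr s" using assms by (intro powr_mono) auto
    then have "z powr s / 2 powr s \<le> z powr s / 2" by (intro divide_left_mono) auto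
    then show ?thesis using that by (simp add: powr_divide)
  qed
  with False assms show ?thesis by (metis add.commute add.right_neutral divide_nonneg_nonneg less_eq_real_def powr_zero_eq_one powr_0)
qed

text \<open>With \<open>t powr (p / 2)\<close> applied to squares, superadditivity merges the two
  terms on the left, the parallelogram identity evaluates the sum, and convexity splits it again.
  Both properties use \<open>p / 2 \<ge> 1\<close>.\<close>

lemma clarkson_pointwise:
  fixes x y p :: real
  assumes p: "p \<ge> 2"
  shows "\<bar>(x + y) / 2\<bar> powr p + \<bar>(x - y) / 2\<bar> powr p \<le> (\<bar>x\<bar> powr p + \<bar>y\<bar> powr p) / 2"
proof -
  have sq: "\<bar>z\<bar> powr p = (z\<^sup>2) powr (p / 2)" for z :: real
  proof -
    have z: "z\<^sup>2 = \<bar>z\<bar> powr 2" by (cases "z = 0") (simp_all add: powr_numeral)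
    show ?thesis unfolding z powr_powr by simp
  qed
  have "\<bar>(x + y) / 2\<bar> powr p + \<bar>(x - y) / 2\<bar> powr p \<le> (((x + y) / 2)\<^sup>2 + ((x - y) / 2)\<^sup>2) powr (p / 2)"
    unfolding sq using p by (intro powr_superadditive) auto
  also have "((x + y) / 2)\<^sup>2 + ((x - y) / 2)\<^sup>2 = (x\<^sup>2 + y\<^sup>2) / 2"
    by (simp add: power2_eq_square field_simps)
  also have "\<dots> powr (p / 2) \<le> ((x\<^sup>2) powr (p / 2) + (y\<^sup>2) powr (p / 2)) / 2"
    using p by (intro powr_midpoint_le) auto
  finally show ?thesis by (simp add: sq)
qed

lemma wint_clarkson:
  assumes [measurable]: "f \<in> borel_measurable borel" "h \<in> borel_measurable borel" and p: "p \<ge> 2"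
  shows "wint p \<theta> (\<lambda>r. (f r + h r) / 2) + wint p \<theta> (\<lambda>r. (f r - h r) / 2) \<le> ennreal (1 / 2) * (wint p \<theta> f + wint p \<theta> h)"
proof -
  have "wint p \<theta> (\<lambda>r. (f r + h r) / 2) + wint p \<theta> (\<lambda>r. (f r - h r) / 2) =
    (\<integral>\<^sup>+r. ennreal (\<bar>(f r + h r) / 2\<bar> powr p * r powr \<theta>) * indicator {0<..} r
       + ennreal (\<bar>(f r - h r) / 2\<bar> powr p * r powr \<theta>) * indicator {0<..} r \<partial>lborel)"
    unfolding wint_def by (rule nn_integral_add[symmetric]) measurable
  also have "\<dots> \<le> (\<integral>\<^sup>+r. ennreal (1 / 2) * (ennreal (\<bar>f r\<bar> powr p * r powr \<theta>) * indicator {0<..} r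
       + ennreal (\<bar>h r\<bar> powr p * r powr \<theta>) * indicator {0<..} r) \<partial>lborel)"
  proof (rule nn_integral_mono)
    fix r
    have "(\<bar>(f r + h r) / 2\<bar> powr p + \<bar>(f r - h r) / 2\<bar> powr p) * r powr \<theta> \<le> (\<bar>f r\<bar> powr p + \<bar>h r\<bar> powr p) / 2 * r powr \<theta>"
      by (intro mult_right_mono clarkson_pointwise p) auto
    then have "ennreal ((\<bar>(f r + h r) / 2\<bar> powr p + \<bar>(f r - h r) / 2\<bar> powr p) * r powr \<theta>) \<le> ennreal ((\<bar>f r\<bar> powr p + \<bar>h r\<bar> powr p) / 2 * r powr \<theta>)"
      by (rule ennreal_leI)
    also have "(\<bar>f r\<bar> powr p + \<bar>h r\<bar> powr p) / 2 * r powr \<theta> = 1 / 2 * (\<bar>f r\<bar> powr p * r powr \<theta> + \<bar>h r\<bar> powr p * r powr \<theta>)"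
      by (simp add: algebra_simps)
    also have "ennreal \<dots> = ennreal (1 / 2) * (ennreal (\<bar>f r\<bar> powr p * r powr \<theta>) + ennreal (\<bar>h r\<bar> powr p * r powr \<theta>))"
      by (subst ennreal_mult) (auto simp: ennreal_plus)
    finally show "ennreal (\<bar>(f r + h r) / 2\<bar> powr p * r powr \<theta>) * indicator {0<..} r
       + ennreal (\<bar>(f r - h r) / 2\<bar> powr p * r powr \<theta>) * indicator {0<..} r \<le>
       ennreal (1 / 2) * (ennreal (\<bar>f r\<bar> powr p * r powr \<theta>) * indicator {0<..} r
       + ennreal (\<bar>h r\<bar> powr p * r powr \<theta>) * indicator {0<..} r)"
      by (auto simp: distrib_right indicator_def)
  qed
  also have "\<dots> = ennreal (1 / 2) * (wint p \<theta> f + wint p \<theta> h)"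
    unfolding wint_def by (subst nn_integral_cmult) (auto simp: nn_integral_add)
  finally show ?thesis .
qed

lemma wint_scale: "f \<in> borel_measurable borel \<Longrightarrow> wint p \<theta> (\<lambda>r. c * f r) = ennreal (\<bar>c\<bar> powr p) * wint p \<theta> f"
  unfolding wint_def
  by (subst nn_integral_cmult[symmetric]) (auto simp: abs_mult powr_mult ennreal_mult mult_ac)

lemma primitive_pair_linear:
  assumes "primitive_pair U g" "primitive_pair V h"
  shows "primitive_pair (\<lambda>r. a * U r + b * V r) (\<lambda>r. a * g r + b * h r)"
proof -
  note D = primitive_pairD[OF assms(1)] primitive_pairD[OF assms(2)]
  note [measurable] = D(1,2,6,7)
  show ?thesis
    unfolding primitive_pair_def
  proof (intro conjI allI impI)
    fix s t :: real assume st: "0 < s" "s \<le> t"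
    have i: "set_integrable lborel {s..t} (\<lambda>r. a * g r)" "set_integrable lborel {s..t} (\<lambda>r. b * h r)"
      using D(4,9)[OF st(1), of t] by auto
    show "set_integrable lborel {s..t} (\<lambda>r. a * g r + b * h r)"
      using i by (rule set_integral_add)
    have "(LINT r:{s..t}|lborel. a * g r + b * h r) = a * (LINT r:{s..t}|lborel. g r) + b * (LINT r:{s..t}|lborel. h r)"
      using set_integral_add(2)[OF i] by simp
    then show "(a * U t + b * V t) - (a * U s + b * V s) = (LINT r:{s..t}|lborel. a * g r + b * h r)"
      using D(5,10)[OF st] by (simp add: algebra_simps)
  qed (use D(3,8) in auto)
qed

lemma primitive_pair_mean:
  assumes "primitive_pair U g" "primitive_pair V h"
  shows "primitive_pair (\<lambda>r. (U r + V r) / 2) (\<lambda>r. (g r + h r) / 2)"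
  using primitive_pair_linear[OF assms, of "1/2" "1/2"] by (simp add: add_divide_distrib)

context trudinger_moser
begin

text \<open>Completeness of the weighted \<open>L\<^sup>p\<close> space, carried along with the primitives.\<close>

lemma primitive_pair_complete:
  assumes P: "\<And>n. primitive_pair (W n) (h n)"
    and conv: "\<And>r. r > 0 \<Longrightarrow> (\<lambda>n. W n r) \<longlonglongrightarrow> U0 r" and U0: "\<And>r. r \<le> 0 \<Longrightarrow> U0 r = 0"
    and C: "\<And>n m. n \<le> m \<Longrightarrow> wint p (p - 1) (\<lambda>r. h n r - h m r) \<le> ennreal ((1 / 2 ^ n) powr p)"
  obtains g0 where "primitive_pair U0 g0" "\<And>A. (\<And>n. wint p (p - 1) (h n) \<le> A n) \<Longrightarrow> wint p (p - 1) g0 \<le> liminf A"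
proof -
  note D = primitive_pairD[OF P]
  note [measurable] = D(1,2)
  define g0 where "g0 r = lim (\<lambda>n. h n r)" for r
  have [measurable]: "g0 \<in> borel_measurable borel" unfolding g0_def by (intro borel_measurable_lim_metric) auto
  define L where "L s t = ln (t / s) powr (1 / p')" for s t :: real
  \<comment> \<open>The weighted bound gives geometric decay in \<open>L1\<close> on each compact
    interval. Hence the telescoping series converges absolutely almost everywhere there, and no
    subsequence has to be extracted.\<close>
  have diff: "(\<integral>\<^sup>+r. ennreal \<bar>h n r - h m r\<bar> * indicator {s..t} r \<partial>lborel) \<le> ennreal (1 / 2 ^ n * L s t)"
    if "n \<le> m" "0 < s" "s \<le> t" for n m s t
    unfolding L_def using that C[OF that(1)] by (intro L1_bound_of_wint) auto
  have ae_st: "AE r in lborel. r \<in> {s..t} \<longrightarrow> summable (\<lambda>n. \<bar>h n r - h (Suc n) r\<bar>)" if st: "0 < s" "s \<le> t" for s t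
  proof -
    have "(\<integral>\<^sup>+r. (\<Sum>n. ennreal \<bar>h n r - h (Suc n) r\<bar> * indicator {s..t} r) \<partial>lborel) =
       (\<Sum>n. \<integral>\<^sup>+r. ennreal \<bar>h n r - h (Suc n) r\<bar> * indicator {s..t} r \<partial>lborel)"
      by (rule nn_integral_suminf) measurable
    also have "\<dots> \<le> (\<Sum>n. ennreal (1 / 2 ^ n * L s t))"
      using diff[OF _ st] by (intro suminf_le summableI) auto
    also have "\<dots> < \<infinity>"
    proof -
      have "summable (\<lambda>n. (1 / 2) ^ n * L s t)" by (intro summable_mult2 summable_geometric) simp
      then have "(\<Sum>n. ennreal ((1 / 2) ^ n * L s t)) = ennreal (\<Sum>n. (1 / 2) ^ n * L s t)"
        by (intro suminf_ennreal2) (auto simp: L_def)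
      then show ?thesis by (simp add: power_one_over)
    qed
    finally have "(\<integral>\<^sup>+r. (\<Sum>n. ennreal \<bar>h n r - h (Suc n) r\<bar> * indicator {s..t} r) \<partial>lborel) \<noteq> \<infinity>" by simp
    then have "AE r in lborel. (\<Sum>n. ennreal \<bar>h n r - h (Suc n) r\<bar> * indicator {s..t} r) \<noteq> \<infinity>"
      by (intro nn_integral_PInf_AE) auto
    then show ?thesis
    proof eventually_elim
      case (elim r)
      show ?case
      proof
        assume "r \<in> {s..t}"
        with elim have "(\<Sum>n. ennreal \<bar>h n r - h (Suc n) r\<bar>) \<noteq> top" by simp
        then show "summable (\<lambda>n. \<bar>h n r - h (Suc n) r\<bar>)"
          by (intro summable_suminf_not_top) auto
      qed
    qed
  qed
  have ae: "AE r in lborel. r > 0 \<longrightarrow> (\<lambda>n. h n r) \<longlonglongrightarrow> g0 r"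
  proof -
    have "AE r in lborel. \<forall>k. r \<in> {inverse (real (Suc k))..real (Suc k)} \<longrightarrow> summable (\<lambda>n. \<bar>h n r - h (Suc n) r\<bar>)"
      unfolding AE_all_countable
    proof
      fix k
      have "inverse (real (Suc k)) \<le> 1" by (simp add: inverse_le_1_iff)
      moreover have "1 \<le> real (Suc k)" by simp
      ultimately have "inverse (real (Suc k)) \<le> real (Suc k)" by linarith
      then show "AE r in lborel. r \<in> {inverse (real (Suc k))..real (Suc k)} \<longrightarrow> summable (\<lambda>n. \<bar>h n r - h (Suc n) r\<bar>)"
        by (intro ae_st) auto
    qed
    then show ?thesis
    proof eventually_elim
      case (elim r)
      show ?case
      proof
        assume "r > 0"
        obtain n1 where n1: "inverse (real (Suc n1)) < r" using \<open>r > 0\<close> reals_Archimedean by blast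
        obtain n2 where n2: "r < real n2" using reals_Archimedean2 by blast
        define k where "k = max n1 n2"
        have "inverse (real (Suc k)) \<le> inverse (real (Suc n1))" by (simp add: k_def)
        then have "inverse (real (Suc k)) \<le> r" using n1 by linarith
        moreover have "r \<le> real (Suc k)" using n2 by (simp add: k_def)
        ultimately have "r \<in> {inverse (real (Suc k))..real (Suc k)}" by simp
        with elim have "summable (\<lambda>n. \<bar>h n r - h (Suc n) r\<bar>)" by blast
        then have "summable (\<lambda>n. h n r - h (Suc n) r)" by (rule summable_rabs_cancel)
        then have "convergent (\<lambda>n. \<Sum>i<n. h i r - h (Suc i) r)" by (simp add: summable_iff_convergent)
        moreover have "(\<Sum>i<n. h i r - h (Suc i) r) = h 0 r - h n r" for n
          by (induction n) auto
        ultimately have "convergent (\<lambda>n. h 0 r - h n r)" by simp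
        from convergent_diff[OF convergent_const[of "h 0 r"] this] have "convergent (\<lambda>n. h n r)" by simp
        then show "(\<lambda>n. h n r) \<longlonglongrightarrow> g0 r" by (simp add: g0_def convergent_LIMSEQ_iff)
      qed
    qed
  qed
  \<comment> \<open>Fatou's lemma in \<open>m\<close>, with \<open>n\<close> fixed, transfers the
    Cauchy estimate to the limit.\<close>
  have lim_diff: "(\<integral>\<^sup>+r. ennreal \<bar>h n r - g0 r\<bar> * indicator {s..t} r \<partial>lborel) \<le> ennreal (1 / 2 ^ n * L s t)"
    if st: "0 < s" "s \<le> t" for n s t
  proof -
    have "(\<integral>\<^sup>+r. ennreal \<bar>h n r - g0 r\<bar> * indicator {s..t} r \<partial>lborel) =
      (\<integral>\<^sup>+r. liminf (\<lambda>m. ennreal \<bar>h n r - h m r\<bar> * indicator {s..t} r) \<partial>lborel)"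
    proof (rule nn_integral_cong_AE)
      show "AE r in lborel. ennreal \<bar>h n r - g0 r\<bar> * indicator {s..t} r = liminf (\<lambda>m. ennreal \<bar>h n r - h m r\<bar> * indicator {s..t} r)"
        using ae
      proof eventually_elim
        case (elim r)
        show ?case
        proof (cases "r \<in> {s..t}")
          case True
          then have "(\<lambda>m. h m r) \<longlonglongrightarrow> g0 r" using elim st by auto
          then have "(\<lambda>m. ennreal \<bar>h n r - h m r\<bar>) \<longlonglongrightarrow> ennreal \<bar>h n r - g0 r\<bar>"
            by (intro tendsto_intros)
          from lim_imp_Liminf[OF _ this] True show ?thesis by simp
        next
          case False
          then show ?thesis by (simp add: Liminf_const)
        qed
      qed
    qed
    also have "\<dots> \<le> liminf (\<lambda>m. \<integral>\<^sup>+r. ennreal \<bar>h n r - h m r\<bar> * indicator {s..t} r \<partial>lborel)"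
      by (rule nn_integral_liminf) measurable
    also have "\<dots> \<le> liminf (\<lambda>m. ennreal (1 / 2 ^ n * L s t))"
    proof (rule Liminf_mono)
      show "\<forall>\<^sub>F m in sequentially. (\<integral>\<^sup>+r. ennreal \<bar>h n r - h m r\<bar> * indicator {s..t} r \<partial>lborel) \<le> ennreal (1 / 2 ^ n * L s t)"
        using eventually_ge_at_top[of n] by eventually_elim (rule diff[OF _ st])
    qed
    finally show ?thesis by (simp add: Liminf_const)
  qed
  have g0_int: "set_integrable lborel {s..t} g0" if s: "0 < s" for s t
  proof (cases "s \<le> t")
    case True
    have "set_integrable lborel {s..t} (\<lambda>r. h 0 r - g0 r)"
      unfolding set_integrable_def
    proof (rule integrableI_bounded)
      have "(\<integral>\<^sup>+r. ennreal (norm (indicator {s..t} r *\<^sub>R (h 0 r - g0 r))) \<partial>lborel)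
        = (\<integral>\<^sup>+r. ennreal \<bar>h 0 r - g0 r\<bar> * indicator {s..t} r \<partial>lborel)"
        by (intro nn_integral_cong) (auto simp: indicator_def)
      also have "\<dots> < \<infinity>" using lim_diff[OF s True, of 0] by (simp add: order_le_less_trans)
      finally show "(\<integral>\<^sup>+r. ennreal (norm (indicator {s..t} r *\<^sub>R (h 0 r - g0 r))) \<partial>lborel) < \<infinity>" .
    qed measurable
    from set_integral_diff(1)[OF D(4)[OF s, of t 0] this] show ?thesis by simp
  qed (simp add: set_integrable_def)
  have "primitive_pair U0 g0"
    unfolding primitive_pair_def
  proof (intro conjI allI impI g0_int)
    show "U0 \<in> borel_measurable borel"
    proof (rule borel_measurable_LIMSEQ_real)
      show "(\<lambda>n. W n r) \<longlonglongrightarrow> U0 r" for r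
        using conv[of r] U0[of r] D(3)[of r] by (cases "r > 0") auto
    qed measurable
    fix s t :: real assume st: "0 < s" "s \<le> t"
    have bd: "\<bar>(W n t - W n s) - (LINT r:{s..t}|lborel. g0 r)\<bar> \<le> (1 / 2) ^ n * L s t" for n
    proof -
      have i: "set_integrable lborel {s..t} (\<lambda>r. h n r - g0 r)"
        by (intro set_integral_diff D(4) g0_int st)
      have "(W n t - W n s) - (LINT r:{s..t}|lborel. g0 r) = (LINT r:{s..t}|lborel. h n r - g0 r)"
        using set_integral_diff(2)[OF D(4)[OF st(1), of t n] g0_int[OF st(1), of t]] D(5)[OF st] by simp
      then have "ennreal \<bar>(W n t - W n s) - (LINT r:{s..t}|lborel. g0 r)\<bar> \<le> (\<integral>\<^sup>+r. norm (indicator {s..t} r *\<^sub>R (h n r - g0 r)) \<partial>lborel)"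
        using integral_norm_bound_ennreal[OF i[unfolded set_integrable_def]] by (simp add: set_lebesgue_integral_def)
      also have "\<dots> = (\<integral>\<^sup>+r. ennreal \<bar>h n r - g0 r\<bar> * indicator {s..t} r \<partial>lborel)"
        by (intro nn_integral_cong) (auto simp: indicator_def)
      also have "\<dots> \<le> ennreal (1 / 2 ^ n * L s t)" by (rule lim_diff[OF st])
      finally show ?thesis by (simp add: L_def power_one_over)
    qed
    have "(\<lambda>n. (1 / 2) ^ n * L s t) \<longlonglongrightarrow> 0 * L s t"
      by (intro tendsto_mult tendsto_const LIMSEQ_realpow_zero) auto
    then have "(\<lambda>n. (W n t - W n s) - (LINT r:{s..t}|lborel. g0 r)) \<longlonglongrightarrow> 0"
      using bd Lim_null_comparison[of "\<lambda>n. (W n t - W n s) - (LINT r:{s..t}|lborel. g0 r)"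
          "\<lambda>n. (1 / 2) ^ n * L s t" sequentially] by simp
    moreover have "(\<lambda>n. (W n t - W n s) - (LINT r:{s..t}|lborel. g0 r)) \<longlonglongrightarrow> (U0 t - U0 s) - (LINT r:{s..t}|lborel. g0 r)"
      using st by (intro tendsto_intros conv) auto
    ultimately show "U0 t - U0 s = (LINT r:{s..t}|lborel. g0 r)"
      using LIMSEQ_unique by fastforce
  qed (use U0 in auto)
  \<comment> \<open>Fatou's lemma again, now along the almost everywhere convergent
    derivatives.\<close>
  moreover have "wint p (p - 1) g0 \<le> liminf A" if A: "\<And>n. wint p (p - 1) (h n) \<le> A n" for A
  proof -
    have "wint p (p - 1) g0 = (\<integral>\<^sup>+r. liminf (\<lambda>n. ennreal (\<bar>h n r\<bar> powr p * r powr (p - 1)) * indicator {0<..} r) \<partial>lborel)"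
      unfolding wint_def
    proof (rule nn_integral_cong_AE)
      show "AE r in lborel. ennreal (\<bar>g0 r\<bar> powr p * r powr (p - 1)) * indicator {0<..} r =
          liminf (\<lambda>n. ennreal (\<bar>h n r\<bar> powr p * r powr (p - 1)) * indicator {0<..} r)"
        using ae
      proof eventually_elim
        case (elim r)
        show ?case
        proof (cases "r > 0")
          case True
          then have "(\<lambda>n. h n r) \<longlonglongrightarrow> g0 r" using elim by auto
          then have "(\<lambda>n. ennreal (\<bar>h n r\<bar> powr p * r powr (p - 1))) \<longlonglongrightarrow> ennreal (\<bar>g0 r\<bar> powr p * r powr (p - 1))"
            using p2 by (intro tendsto_ennrealI tendsto_mult tendsto_powr' tendsto_const tendsto_rabs) auto
          from lim_imp_Liminf[OF _ this] True show ?thesis by simp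
        next
          case False
          then show ?thesis by (simp add: Liminf_const)
        qed
      qed
    qed
    also have "\<dots> \<le> liminf (\<lambda>n. wint p (p - 1) (h n))"
      unfolding wint_def by (rule nn_integral_liminf) measurable
    also have "\<dots> \<le> liminf A" using A by (intro Liminf_mono) auto
    finally show ?thesis .
  qed
  ultimately show ?thesis by (rule that)
qed

text \<open>The pairs \<open>(W, h)\<close> in \<open>near n\<close> form a convex set containing all \<open>(U m, g m)\<close> with \<open>m \<ge> n\<close>; by
  Clarkson's inequality, near-minimizers of the energy over these sets form a Cauchy sequence.\<close>

lemma derivative_energy_lsc:
  assumes P: "\<And>n. primitive_pair (U n) (g n)"
    and conv: "\<And>r. r > 0 \<Longrightarrow> (\<lambda>n. U n r) \<longlonglongrightarrow> U0 r" and U0: "\<And>r. r \<le> 0 \<Longrightarrow> U0 r = 0"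
    and A: "\<And>n. wint p (p - 1) (g n) \<le> ennreal (A n)" "A \<longlonglongrightarrow> a"
  obtains g0 where "primitive_pair U0 g0" "wint p (p - 1) g0 \<le> ennreal a"
proof -
  \<comment> \<open>Inheriting every bound valid for all later \<open>U m\<close> is a condition
    preserved by averaging, and it forces any sequence picked from these sets to converge pointwise
    to \<open>U0\<close>.\<close>
  define near where "near n = {(W, h). primitive_pair W h \<and>
    (\<forall>r>0. \<forall>e. (\<forall>m\<ge>n. \<bar>U m r - U0 r\<bar> \<le> e) \<longrightarrow> \<bar>W r - U0 r\<bar> \<le> e)}" for n
  have near_mem: "(U m, g m) \<in> near n" if "n \<le> m" for n m
    using P that by (auto simp: near_def)
  have near_anti: "near m \<subseteq> near n" if "n \<le> m" for n m
    using that unfolding near_def by (auto intro: order_trans)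
  have near_mean: "((\<lambda>r. (W r + V r) / 2), (\<lambda>r. (h r + k r) / 2)) \<in> near n"
    if "(W, h) \<in> near n" "(V, k) \<in> near n" for W V h k n
  proof -
    have "\<bar>(W r + V r) / 2 - U0 r\<bar> \<le> e" if "\<bar>W r - U0 r\<bar> \<le> e" "\<bar>V r - U0 r\<bar> \<le> e" for r e
      using that by (simp add: abs_le_iff field_simps)
    with that show ?thesis by (auto simp: near_def intro!: primitive_pair_mean)
  qed
  define I where "I n = (INF (W, h)\<in>near n. wint p (p - 1) h)" for n
  have I_le: "I n \<le> wint p (p - 1) h" if "(W, h) \<in> near n" for n W h
    unfolding I_def using that by (auto intro: INF_lower2)
  have I_le_a: "I n \<le> ennreal a" for n
  proof (rule LIMSEQ_le_const)
    show "(\<lambda>n. ennreal (A n)) \<longlonglongrightarrow> ennreal a" by (intro tendsto_ennrealI A(2))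
    show "\<exists>N. \<forall>m\<ge>N. I n \<le> ennreal (A m)"
      using order_trans[OF I_le[OF near_mem] A(1)] by blast
  qed
  define i where "i n = enn2real (I n)" for n
  have i: "I n = ennreal (i n)" "i n \<ge> 0" for n
  proof -
    have "I n < top" using I_le_a[of n] by (rule order_le_less_trans) simp
    then show "I n = ennreal (i n)" "i n \<ge> 0" by (simp_all add: i_def)
  qed
  \<comment> \<open>The sign of \<open>a\<close> is not known at this point, and
    \<open>ennreal\<close> sends negative numbers to 0.\<close>
  have i_le: "i n \<le> max a 0" for n
    using I_le_a[of n] i[of n] by (cases "a \<ge> 0") (auto simp: ennreal_neg)
  have "incseq i"
  proof (rule incseq_SucI)
    fix n
    have "I n \<le> I (Suc n)" unfolding I_def by (intro INF_superset_mono near_anti) auto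
    then show "i n \<le> i (Suc n)" using i by simp
  qed
  from incseq_convergent[OF this, of "max a 0"] i_le
  obtain L where L: "i \<longlonglongrightarrow> L" "\<And>n. i n \<le> L" by auto
  have "\<exists>W h. (W, h) \<in> near n \<and> wint p (p - 1) h < ennreal (i n + 1 / (real n + 1))" for n
  proof -
    have "I n < ennreal (i n + 1 / (real n + 1))" using i[of n] by (simp add: ennreal_less_iff)
    then show ?thesis unfolding I_def by (auto simp: INF_less_iff)
  qed
  then obtain W h where Wh: "\<And>n. (W n, h n) \<in> near n" "\<And>n. wint p (p - 1) (h n) < ennreal (i n + 1 / (real n + 1))"
    by metis
  have PW: "primitive_pair (W n) (h n)" for n using Wh(1)[of n] by (simp add: near_def)
  note [measurable] = primitive_pairD(1,2)[OF PW]
  \<comment> \<open>The mean of the two near-minimal energies of index \<open>n\<close> and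
    \<open>m \<ge> n\<close> exceeds \<open>i n\<close> by at most this much, since
    \<open>i m \<le> L\<close>. It tends to 0 because the infima increase to
    \<open>L\<close>.\<close>
  define \<epsilon> where "\<epsilon> n = (L - i n) / 2 + 1 / (real n + 1)" for n
  have \<epsilon>_lim: "\<epsilon> \<longlonglongrightarrow> 0"
  proof -
    have "(\<lambda>n. 1 / (real n + 1)) \<longlonglongrightarrow> 0"
      using LIMSEQ_inverse_real_of_nat by (simp add: inverse_eq_divide add.commute)
    from tendsto_add[OF tendsto_divide[OF tendsto_diff[OF tendsto_const[of L] L(1)] tendsto_const[of 2]] this]
    show ?thesis by (simp add: \<epsilon>_def[abs_def])
  qed
  have half: "wint p (p - 1) (\<lambda>r. (h n r - h m r) / 2) \<le> ennreal (\<epsilon> n)" if nm: "n \<le> m" for n m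
  proof -
    let ?d = "wint p (p - 1) (\<lambda>r. (h n r - h m r) / 2)"
    \<comment> \<open>The sets decrease, so both pairs and their midpoint lie in
      \<open>near n\<close>; the midpoint energy is thus at least \<open>i n\<close>, and Clarkson's
      inequality leaves only \<open>\<epsilon> n\<close> for the difference.\<close>
    have "(W m, h m) \<in> near n" using Wh(1) near_anti[OF nm] by blast
    from I_le[OF near_mean[OF Wh(1) this]] have mid: "ennreal (i n) \<le> wint p (p - 1) (\<lambda>r. (h n r + h m r) / 2)"
      by (simp add: i)
    have "1 / (real m + 1) \<le> 1 / (real n + 1)" using nm by (simp add: frac_le)
    have aux: "b + x + (c + y) \<le> 2 * (b + ((l - b) / 2 + x))" if "y \<le> x" "c \<le> l" for b c x y l :: real
      using that by (simp add: field_simps)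
    from \<open>1 / (real m + 1) \<le> 1 / (real n + 1)\<close> have sum: "i n + 1 / (real n + 1) + (i m + 1 / (real m + 1)) \<le> 2 * (i n + \<epsilon> n)"
      using L(2)[of m] unfolding \<epsilon>_def by (rule aux)
    have "ennreal (i n) + ?d \<le> wint p (p - 1) (\<lambda>r. (h n r + h m r) / 2) + ?d"
      by (intro add_right_mono mid)
    also have "\<dots> \<le> ennreal (1 / 2) * (wint p (p - 1) (h n) + wint p (p - 1) (h m))"
      by (rule wint_clarkson) (use p2 in auto)
    also have "\<dots> \<le> ennreal (1 / 2) * (ennreal (i n + 1 / (real n + 1)) + ennreal (i m + 1 / (real m + 1)))"
      using Wh(2) by (intro mult_left_mono add_mono) (auto intro: less_imp_le)
    also have "\<dots> = ennreal (1 / 2 * (i n + 1 / (real n + 1) + (i m + 1 / (real m + 1))))"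
      using i(2)[of n] i(2)[of m] by (subst ennreal_mult) (simp_all only: ennreal_plus add_nonneg_nonneg
          divide_nonneg_nonneg of_nat_0_le_iff zero_le_one zero_le_numeral)
    also have "\<dots> \<le> ennreal (i n + \<epsilon> n)"
      using sum by (intro ennreal_leI) simp
    finally have *: "ennreal (i n) + ?d \<le> ennreal (i n + \<epsilon> n)" .
    have \<epsilon>0: "\<epsilon> n \<ge> 0" using L(2)[of n] by (simp add: \<epsilon>_def)
    have "?d \<noteq> top" using * by (auto simp: top_unique)
    then obtain x where x: "x \<ge> 0" "?d = ennreal x" by (cases ?d) auto
    show ?thesis using * \<epsilon>0 i(2)[of n] x by (simp add: ennreal_plus[symmetric] del: ennreal_plus)
  qed
  have full: "wint p (p - 1) (\<lambda>r. h n r - h m r) \<le> ennreal (2 powr p * \<epsilon> n)" if nm: "n \<le> m" for n m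
  proof -
    have "wint p (p - 1) (\<lambda>r. 2 * ((h n r - h m r) / 2)) = ennreal (\<bar>2\<bar> powr p) * wint p (p - 1) (\<lambda>r. (h n r - h m r) / 2)"
      by (rule wint_scale) measurable
    also have "\<dots> \<le> ennreal (\<bar>2\<bar> powr p) * ennreal (\<epsilon> n)"
      by (intro mult_left_mono half nm) auto
    finally have "wint p (p - 1) (\<lambda>r. 2 * ((h n r - h m r) / 2)) \<le> ennreal (2 powr p * \<epsilon> n)"
      by (simp only: abs_numeral ennreal_mult' powr_ge_zero)
    moreover have "(\<lambda>r. 2 * ((h n r - h m r) / 2)) = (\<lambda>r. h n r - h m r)" by auto
    ultimately show ?thesis by simp
  qed
  have "\<exists>N. \<forall>n\<ge>N. 2 powr p * \<epsilon> n \<le> (1 / 2 ^ k) powr p" for k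
  proof -
    have "(\<lambda>n. 2 powr p * \<epsilon> n) \<longlonglongrightarrow> 2 powr p * 0" by (intro tendsto_mult tendsto_const \<epsilon>_lim)
    then have "\<forall>\<^sub>F n in sequentially. 2 powr p * \<epsilon> n < (1 / 2 ^ k) powr p"
      by (rule order_tendstoD) simp
    then show ?thesis by (auto simp: eventually_sequentially intro: less_imp_le)
  qed
  then obtain N where N: "\<And>k n. n \<ge> N k \<Longrightarrow> 2 powr p * \<epsilon> n \<le> (1 / 2 ^ k) powr p" by metis
  \<comment> \<open>The summand \<open>k\<close> makes the indices strictly increasing, and the sum
    makes them exceed \<open>N k\<close>.\<close>
  define \<phi> where "\<phi> k = k + (\<Sum>j\<le>k. N j)" for k
  have \<phi>: "strict_mono \<phi>" "\<phi> k \<ge> N k" for k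
    by (auto simp: \<phi>_def strict_mono_Suc_iff intro: trans_le_add2 member_le_sum)
  have W_conv: "(\<lambda>n. W n r) \<longlonglongrightarrow> U0 r" if r: "r > 0" for r
  proof (rule LIMSEQ_I)
    fix e :: real assume e: "e > 0"
    obtain M where M: "\<And>m. m \<ge> M \<Longrightarrow> norm (U m r - U0 r) < e / 2"
      using LIMSEQ_D[OF conv[OF r], of "e / 2"] e by auto
    have "norm (W n r - U0 r) < e" if "n \<ge> M" for n
    proof -
      have "\<forall>m\<ge>n. \<bar>U m r - U0 r\<bar> \<le> e / 2" using M that by (auto intro: less_imp_le)
      moreover have "\<forall>r>0. \<forall>e. (\<forall>m\<ge>n. \<bar>U m r - U0 r\<bar> \<le> e) \<longrightarrow> \<bar>W n r - U0 r\<bar> \<le> e"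
        using Wh(1)[of n] by (simp add: near_def)
      ultimately have "\<bar>W n r - U0 r\<bar> \<le> e / 2" using r by blast
      then show ?thesis using e by simp
    qed
    then show "\<exists>no. \<forall>n\<ge>no. norm (W n r - U0 r) < e" by blast
  qed
  obtain g0 where g0: "primitive_pair U0 g0"
    "\<And>A. (\<And>n. wint p (p - 1) (h (\<phi> n)) \<le> A n) \<Longrightarrow> wint p (p - 1) g0 \<le> liminf A"
  proof (rule primitive_pair_complete[of "\<lambda>n. W (\<phi> n)" "\<lambda>n. h (\<phi> n)" U0])
    show "(\<lambda>n. W (\<phi> n) r) \<longlonglongrightarrow> U0 r" if "r > 0" for r
      using LIMSEQ_subseq_LIMSEQ[OF W_conv[OF that] \<phi>(1)] by (simp add: o_def)
    show "wint p (p - 1) (\<lambda>r. h (\<phi> n) r - h (\<phi> m) r) \<le> ennreal ((1 / 2 ^ n) powr p)" if "n \<le> m" for n m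
      using full[of "\<phi> n" "\<phi> m"] N[OF \<phi>(2)[of n]] \<phi>(1) that
      by (meson ennreal_leI order_trans strict_mono_less_eq)
  qed (use PW U0 in auto)
  have "wint p (p - 1) g0 \<le> liminf (\<lambda>k. ennreal (i (\<phi> k) + 1 / (real (\<phi> k) + 1)))"
    using Wh(2) by (intro g0(2)) (auto intro: less_imp_le)
  also have "\<dots> = ennreal L"
  proof (rule lim_imp_Liminf)
    have "(\<lambda>n. 1 / (real n + 1)) \<longlonglongrightarrow> 0"
      using LIMSEQ_inverse_real_of_nat by (simp add: inverse_eq_divide add.commute)
    from tendsto_ennrealI[OF tendsto_add[OF L(1) this]]
    have "(\<lambda>n. ennreal (i n + 1 / (real n + 1))) \<longlonglongrightarrow> ennreal L" by simp
    from LIMSEQ_subseq_LIMSEQ[OF this \<phi>(1)]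
    show "(\<lambda>k. ennreal (i (\<phi> k) + 1 / (real (\<phi> k) + 1))) \<longlonglongrightarrow> ennreal L" by (simp add: o_def)
  qed simp
  also have "\<dots> \<le> ennreal (max a 0)"
    using L(1) i_le by (intro ennreal_leI LIMSEQ_le_const2[of i]) auto
  also have "\<dots> = ennreal a" by (simp add: max_def ennreal_neg)
  finally show ?thesis using g0(1) that by blast
qed

end

section \<open>Maximizing sequences\<close>

lemma wint_rescale:
  assumes [measurable]: "U \<in> borel_measurable borel" and l: "l > 0"
  shows "wint q \<theta> U = ennreal (l powr (\<theta> + 1)) * wint q \<theta> (\<lambda>r. U (l * r))"
proof -
  have "wint q \<theta> U = ennreal \<bar>l\<bar> * (\<integral>\<^sup>+r. ennreal (\<bar>U (0 + l * r)\<bar> powr q * (0 + l * r) powr \<theta>) * indicator {0<..} (0 + l * r) \<partial>lborel)"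
    unfolding wint_def by (rule nn_integral_real_affine) (use l in auto)
  also have "\<dots> = (\<integral>\<^sup>+r. ennreal \<bar>l\<bar> * (ennreal (\<bar>U (0 + l * r)\<bar> powr q * (0 + l * r) powr \<theta>) * indicator {0<..} (0 + l * r)) \<partial>lborel)"
    by (rule nn_integral_cmult[symmetric]) measurable
  also have "\<dots> = (\<integral>\<^sup>+r. ennreal (l powr (\<theta> + 1)) * (ennreal (\<bar>U (l * r)\<bar> powr q * r powr \<theta>) * indicator {0<..} r) \<partial>lborel)"
  proof (rule nn_integral_cong)
    fix r
    show "ennreal \<bar>l\<bar> * (ennreal (\<bar>U (0 + l * r)\<bar> powr q * (0 + l * r) powr \<theta>) * indicator {0<..} (0 + l * r)) =
      ennreal (l powr (\<theta> + 1)) * (ennreal (\<bar>U (l * r)\<bar> powr q * r powr \<theta>) * indicator {0<..} r)"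
    proof (cases "r > 0")
      case True
      then show ?thesis using l
        by (simp add: ennreal_mult[symmetric] powr_mult powr_add mult_ac zero_less_mult_iff)
    next
      case False
      then show ?thesis using l by (simp add: zero_less_mult_iff)
    qed
  qed
  also have "\<dots> = ennreal (l powr (\<theta> + 1)) * wint q \<theta> (\<lambda>r. U (l * r))"
    unfolding wint_def by (rule nn_integral_cmult) measurable
  finally show ?thesis .
qed

lemma primitive_pair_rescale:
  assumes P: "primitive_pair U g" and l: "l > 0"
  shows "primitive_pair (\<lambda>r. U (l * r)) (\<lambda>r. l * g (l * r))"
proof -
  note D = primitive_pairD[OF P]
  note [measurable] = D(1,2)
  show ?thesis
    unfolding primitive_pair_def
  proof (intro conjI allI impI)
    show "U (l * r) = 0" if "r \<le> 0" for r using D(3)[of "l * r"] that l by (simp add: mult_le_0_iff)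
    fix s t :: real assume st: "0 < s" "s \<le> t"
    have st': "0 < l * s" "l * s \<le> l * t" using st l by auto
    have eq: "indicator {l * s..l * t} (0 + l * r) *\<^sub>R g (0 + l * r) = indicator {s..t} r *\<^sub>R g (l * r)" for r
      using l by (auto simp: indicator_def)
    have "integrable lborel (\<lambda>r. indicator {s..t} r *\<^sub>R g (l * r))"
      using lborel_integrable_real_affine[OF D(4)[OF st'(1), of "l * t", unfolded set_integrable_def], of l 0] l
      unfolding eq by simp
    then show "set_integrable lborel {s..t} (\<lambda>r. l * g (l * r))"
      by (intro set_integrable_mult_right) (simp add: set_integrable_def)
    have "(LINT r:{l * s..l * t}|lborel. g r) = \<bar>l\<bar> *\<^sub>R (\<integral>r. indicator {s..t} r *\<^sub>R g (l * r) \<partial>lborel)"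
      using lborel_integral_real_affine[of l "\<lambda>r. indicator {l * s..l * t} r *\<^sub>R g r" 0] l
      unfolding set_lebesgue_integral_def eq by simp
    then show "U (l * t) - U (l * s) = (LINT r:{s..t}|lborel. l * g (l * r))"
      using D(5)[OF st'] l by (simp add: set_lebesgue_integral_def)
  qed measurable
qed

text \<open>Every \<open>q\<close> is allowed, because \<open>0 powr q = 0\<close> even for
  \<open>q = 0\<close> and \<open>powr\<close> is positive at a positive base.\<close>

lemma wint_zero_iff:
  assumes [measurable]: "U \<in> borel_measurable borel"
  shows "wint q \<theta> U = 0 \<longleftrightarrow> (AE r in lborel. r > 0 \<longrightarrow> U r = 0)"
  unfolding wint_def
proof (subst nn_integral_0_iff_AE)
  show "(AE r in lborel. ennreal (\<bar>U r\<bar> powr q * r powr \<theta>) * indicator {0<..} r = 0) \<longleftrightarrow> (AE r in lborel. r > 0 \<longrightarrow> U r = 0)"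
    by (rule AE_cong) (auto simp: indicator_def powr_def ennreal_eq_0_iff mult_le_0_iff)
qed measurable

lemma primitive_pair_scale:
  assumes "primitive_pair U g"
  shows "primitive_pair (\<lambda>r. c * U r) (\<lambda>r. c * g r)"
  using primitive_pair_linear[OF assms assms, of c 0] by simp

context trudinger_moser
begin

definition energy :: "(real \<Rightarrow> real) \<Rightarrow> (real \<Rightarrow> real) \<Rightarrow> ennreal" where
  "energy U g = wint p (p - 1) g + wint p \<alpha> U"

definition remainder_int :: "(real \<Rightarrow> real) \<Rightarrow> ennreal" where
  "remainder_int U = (\<integral>\<^sup>+r. ennreal (remainder (U r) * r powr \<alpha>) * indicator {0<..} r \<partial>lborel)"

lemma TM_functional_lborel:
  "TM_functional p \<alpha> \<mu> u = (\<integral>\<^sup>+r. ennreal (exp_p p (\<mu> * \<bar>u r\<bar> powr p') * r powr \<alpha>) * indicator {0<..} r \<partial>lborel)"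
  by (simp add: TM_functional_def nn_integral_completion p'_def)

lemma TM_functional_cong_AE:
  assumes "AE r in lborel. r > 0 \<longrightarrow> u r = w r"
  shows "TM_functional p \<alpha> \<mu> u = TM_functional p \<alpha> \<mu> w"
  unfolding TM_functional_lborel using assms
  by (intro nn_integral_cong_AE) (auto elim!: eventually_mono simp: indicator_def)

lemma TM_functional_split:
  assumes [measurable]: "U \<in> borel_measurable borel"
  shows "TM_functional p \<alpha> \<mu> U = ennreal lead_const * wint p \<alpha> U + remainder_int U"
proof -
  have "TM_functional p \<alpha> \<mu> U = (\<integral>\<^sup>+r. ennreal lead_const * (ennreal (\<bar>U r\<bar> powr p * r powr \<alpha>) * indicator {0<..} r)
      + ennreal (remainder (U r) * r powr \<alpha>) * indicator {0<..} r \<partial>lborel)"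
    unfolding TM_functional_lborel
  proof (rule nn_integral_cong)
    fix r
    have "exp_p p (\<mu> * \<bar>U r\<bar> powr p') * r powr \<alpha> = lead_const * (\<bar>U r\<bar> powr p * r powr \<alpha>) + remainder (U r) * r powr \<alpha>"
      by (simp add: exp_p_split algebra_simps)
    then have "ennreal (exp_p p (\<mu> * \<bar>U r\<bar> powr p') * r powr \<alpha>) = ennreal lead_const * ennreal (\<bar>U r\<bar> powr p * r powr \<alpha>) + ennreal (remainder (U r) * r powr \<alpha>)"
      using lead_const_pos remainder_nonneg[of "U r"] by (simp add: ennreal_mult ennreal_plus)
    then show "ennreal (exp_p p (\<mu> * \<bar>U r\<bar> powr p') * r powr \<alpha>) * indicator {0<..} r =
      ennreal lead_const * (ennreal (\<bar>U r\<bar> powr p * r powr \<alpha>) * indicator {0<..} r) + ennreal (remainder (U r) * r powr \<alpha>) * indicator {0<..} r"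
      by (simp add: indicator_def)
  qed
  also have "\<dots> = ennreal lead_const * wint p \<alpha> U + remainder_int U"
    unfolding wint_def remainder_int_def by (subst nn_integral_add) (auto simp: nn_integral_cmult)
  finally show ?thesis .
qed

lemma TM_functional_mono:
  assumes "\<And>r. r > 0 \<Longrightarrow> \<bar>u r\<bar> \<le> \<bar>w r\<bar>"
  shows "TM_functional p \<alpha> \<mu> u \<le> TM_functional p \<alpha> \<mu> w"
  unfolding TM_functional_lborel
  using assms by (intro nn_integral_mono) (auto simp: indicator_def intro!: ennreal_leI mult_right_mono exp_p_mono)

lemma remainder_int_rescale:
  assumes [measurable]: "U \<in> borel_measurable borel" and l: "l > 0"
  shows "remainder_int U = ennreal (l powr (\<alpha> + 1)) * remainder_int (\<lambda>r. U (l * r))"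
proof -
  define F where "F r = (remainder (U r))" for r
  have F: "F r \<ge> 0" for r by (simp add: F_def remainder_nonneg)
  have [measurable]: "F \<in> borel_measurable borel" unfolding F_def by measurable
  have "remainder_int U = wint 1 \<alpha> F" "remainder_int (\<lambda>r. U (l * r)) = wint 1 \<alpha> (\<lambda>r. F (l * r))"
    unfolding remainder_int_def wint_def F_def by (simp_all add: remainder_nonneg)
  then show ?thesis using wint_rescale[of F l 1 \<alpha>] l by simp
qed

lemma remainder_int_ge:
  assumes [measurable]: "U \<in> borel_measurable borel"
  shows "ennreal (\<mu> powr p / Gamma (p + 1)) * wint (p + p') \<alpha> U \<le> remainder_int U"
proof -
  have "ennreal (\<mu> powr p / Gamma (p + 1)) * wint (p + p') \<alpha> U =
     (\<integral>\<^sup>+r. ennreal (\<mu> powr p / Gamma (p + 1)) * (ennreal (\<bar>U r\<bar> powr (p + p') * r powr \<alpha>) * indicator {0<..} r) \<partial>lborel)"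
    unfolding wint_def by (rule nn_integral_cmult[symmetric]) measurable
  also have "\<dots> \<le> remainder_int U"
    unfolding remainder_int_def
  proof (rule nn_integral_mono)
    fix r
    have "\<mu> powr p / Gamma (p + 1) * (\<bar>U r\<bar> powr (p + p') * r powr \<alpha>) \<le> remainder (U r) * r powr \<alpha>"
      using mult_right_mono[OF remainder_ge[of "U r"], of "r powr \<alpha>"] by (simp add: mult_ac)
    then show "ennreal (\<mu> powr p / Gamma (p + 1)) * (ennreal (\<bar>U r\<bar> powr (p + p') * r powr \<alpha>) * indicator {0<..} r)
      \<le> ennreal (remainder (U r) * r powr \<alpha>) * indicator {0<..} r"
      using p2 by (simp add: indicator_def ennreal_mult[symmetric] ennreal_leI)
  qed
  finally show ?thesis .
qed

text \<open>The last claim is what makes normalization harmless for a maximizer: a function of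
  energy at most 1 is only enlarged by it.\<close>

lemma normalize_energy:
  assumes P: "primitive_pair U g" and E: "energy U g = ennreal E" "E > 0"
  defines "\<kappa> \<equiv> E powr (- (1 / p))"
  shows "primitive_pair (\<lambda>r. \<kappa> * U r) (\<lambda>r. \<kappa> * g r)" "energy (\<lambda>r. \<kappa> * U r) (\<lambda>r. \<kappa> * g r) = 1"
    "wint q \<theta> (\<lambda>r. \<kappa> * U r) = ennreal (E powr (- (q / p))) * wint q \<theta> U" "E \<le> 1 \<Longrightarrow> \<kappa> \<ge> 1"
proof -
  note [measurable] = primitive_pairD(1,2)[OF P]
  have k: "\<kappa> > 0" using E by (simp add: \<kappa>_def)
  show "primitive_pair (\<lambda>r. \<kappa> * U r) (\<lambda>r. \<kappa> * g r)" by (rule primitive_pair_scale[OF P])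
  have *: "wint q \<theta> (\<lambda>r. \<kappa> * f r) = ennreal (E powr (- (q / p))) * wint q \<theta> f" if "f \<in> borel_measurable borel" for f q \<theta>
    using wint_scale[OF that, of q \<theta> \<kappa>] k by (simp add: \<kappa>_def powr_powr)
  show "wint q \<theta> (\<lambda>r. \<kappa> * U r) = ennreal (E powr (- (q / p))) * wint q \<theta> U" by (rule *) measurable
  have "energy (\<lambda>r. \<kappa> * U r) (\<lambda>r. \<kappa> * g r) = ennreal (E powr (- (p / p))) * energy U g"
    unfolding energy_def by (subst (1 2) *) (auto simp: distrib_left)
  also have "\<dots> = 1" using E p2 by (simp add: powr_minus ennreal_mult[symmetric])
  finally show "energy (\<lambda>r. \<kappa> * U r) (\<lambda>r. \<kappa> * g r) = 1" .
  show "\<kappa> \<ge> 1" if "E \<le> 1"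
    using powr_mono2'[of "- (1 / p)" E 1] that E p2 by (simp add: \<kappa>_def)
qed

text \<open>The exponent in \<open>l\<close> makes \<open>x\<close> the factor of every integral
  with weight \<open>r powr \<alpha>\<close>. For the derivative, the factor \<open>l powr p\<close>
  from the chain rule cancels the one from the substitution.\<close>

lemma rescale_energy:
  assumes P: "primitive_pair U g" and x: "x > 0"
  defines "l \<equiv> x powr (- (1 / (\<alpha> + 1)))"
  shows "primitive_pair (\<lambda>r. U (l * r)) (\<lambda>r. l * g (l * r))"
    "wint p (p - 1) (\<lambda>r. l * g (l * r)) = wint p (p - 1) g"
    "wint q \<alpha> (\<lambda>r. U (l * r)) = ennreal x * wint q \<alpha> U"
    "remainder_int (\<lambda>r. U (l * r)) = ennreal x * remainder_int U"
proof -
  note [measurable] = primitive_pairD(1,2)[OF P]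
  have l: "l > 0" using x by (simp add: l_def)
  have "- (1 / (\<alpha> + 1)) * (\<alpha> + 1) = - 1" using \<alpha> by simp
  then have lx: "l powr (\<alpha> + 1) * x = 1" using x unfolding l_def powr_powr by (simp add: powr_minus_divide)
  have cancel: "b = ennreal x * c" if "c = ennreal (l powr (\<alpha> + 1)) * b" for b c :: ennreal
  proof -
    have "ennreal x * ennreal (l powr (\<alpha> + 1)) = 1"
      using lx x by (simp add: ennreal_mult[symmetric] mult.commute)
    then show ?thesis by (simp add: that mult.assoc[symmetric])
  qed
  show "primitive_pair (\<lambda>r. U (l * r)) (\<lambda>r. l * g (l * r))" by (rule primitive_pair_rescale[OF P l])
  have "wint p (p - 1) (\<lambda>r. l * g (l * r)) = ennreal (\<bar>l\<bar> powr p) * wint p (p - 1) (\<lambda>r. g (l * r))"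
    by (rule wint_scale) measurable
  then show "wint p (p - 1) (\<lambda>r. l * g (l * r)) = wint p (p - 1) g"
    using wint_rescale[of g l p "p - 1"] l by simp
  show "wint q \<alpha> (\<lambda>r. U (l * r)) = ennreal x * wint q \<alpha> U"
    by (rule cancel, rule wint_rescale) (use l in auto)
  show "remainder_int (\<lambda>r. U (l * r)) = ennreal x * remainder_int U"
    by (rule cancel, rule remainder_int_rescale) (use l in auto)
qed

text \<open>A diagonal sequence converges at the positive rationals; the uniform increment bound is
  an equicontinuity estimate that carries the Cauchy property to every \<open>r > 0\<close>.\<close>

lemma pointwise_convergent_subsequence:
  assumes P: "\<And>n. primitive_pair (U n) (g n)" and E: "\<And>n. wint p (p - 1) (g n) \<le> 1" "\<And>n. wint p \<alpha> (U n) \<le> 1"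
  shows "\<exists>(k :: nat \<Rightarrow> nat) U0. strict_mono k \<and> (\<forall>r>0. (\<lambda>n. U (k n) r) \<longlonglongrightarrow> U0 r) \<and> (\<forall>r\<le>0. U0 r = 0)"
proof -
  define S :: "real set" where "S = \<rat> \<inter> {0<..}"
  define K where "K r = tail_bound 1 r" for r
  have K: "K r > 0" for r by (simp add: K_def tail_bound_def add_nonneg_pos)
  \<comment> \<open>Division by \<open>K r\<close> turns the bound depending on \<open>r\<close>
    into the constant 1 expected by the diagonal argument.\<close>
  have bd: "norm (U n r / K r) \<le> 1" if "r \<in> S" for n r
    using primitive_pair_pointwise_bound[OF P E, of r 1] that K[of r] by (simp add: S_def K_def)
  have "countable S" unfolding S_def by (intro countable_Int1 countable_rat)
  from function_convergent_subsequence[OF this, of "\<lambda>n r. U n r / K r", OF bd]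
  obtain k where k: "strict_mono (k :: nat \<Rightarrow> nat)" "\<And>r. r \<in> S \<Longrightarrow> \<exists>l. (\<lambda>n. U (k n) r / K r) \<longlonglongrightarrow> l"
    by blast
  have S_conv: "Cauchy (\<lambda>n. U (k n) r)" if r: "r \<in> S" for r
  proof -
    obtain l where "(\<lambda>n. U (k n) r / K r) \<longlonglongrightarrow> l" using k(2)[OF r] by blast
    from tendsto_mult[OF this tendsto_const[of "K r"]] have "(\<lambda>n. U (k n) r) \<longlonglongrightarrow> l * K r"
      using K[of r] by (simp add: less_imp_neq[symmetric])
    then show ?thesis by (rule LIMSEQ_imp_Cauchy)
  qed
  have conv: "convergent (\<lambda>n. U (k n) r)" if r: "r > 0" for r
  proof -
    have "Cauchy (\<lambda>n. U (k n) r)"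
    proof (rule metric_CauchyI)
      fix e :: real assume e: "e > 0"
      \<comment> \<open>Points with \<open>ln (s / r) \<le> d\<close> have values within
        \<open>e / 4\<close>, so three such errors stay below \<open>e\<close>.\<close>
      define d where "d = (e / 4) powr p'"
      have d: "d > 0" "d powr (1 / p') = e / 4" using e p'_facts(1) by (auto simp: d_def powr_powr)
      obtain s where s: "s \<in> \<rat>" "r < s" "s < r * exp d" using Rats_dense_in_real[of r "r * exp d"] r d by auto
      then have sS: "s \<in> S" using r by (simp add: S_def)
      have close: "\<bar>U n s - U n r\<bar> \<le> e / 4" for n
      proof -
        have "ln (s / r) \<le> ln (exp d)" using s r by (subst ln_le_cancel_iff) (auto simp: field_simps)
        then have "ln (s / r) powr (1 / p') \<le> e / 4"
          unfolding d(2)[symmetric] using s r p'_facts(1) by (intro powr_mono2) auto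
        then show ?thesis using primitive_pair_increment_bound[OF P E(1) r, of s n] s by simp
      qed
      obtain M where M: "\<And>m n. m \<ge> M \<Longrightarrow> n \<ge> M \<Longrightarrow> dist (U (k m) s) (U (k n) s) < e / 4"
        using metric_CauchyD[OF S_conv[OF sS], of "e / 4"] e by auto
      have "dist (U (k m) r) (U (k n) r) < e" if "m \<ge> M" "n \<ge> M" for m n
        using close[of "k m"] close[of "k n"] M[OF that] e unfolding dist_real_def by linarith
      then show "\<exists>M. \<forall>m\<ge>M. \<forall>n\<ge>M. dist (U (k m) r) (U (k n) r) < e" by blast
    qed
    then show ?thesis by (simp add: Cauchy_convergent_iff)
  qed
  show ?thesis
  proof (intro exI[of _ k] exI[of _ "\<lambda>r. if r > 0 then lim (\<lambda>n. U (k n) r) else 0"] conjI allI impI)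
    show "(\<lambda>n. U (k n) r) \<longlonglongrightarrow> (if r > 0 then lim (\<lambda>n. U (k n) r) else 0)" if "r > 0" for r
      using conv[OF that] that by (simp add: convergent_LIMSEQ_iff)
  qed (use k in auto)
qed

text \<open>Concentration at \<open>0\<close> is excluded by \<open>\<mu> < \<alpha> + 1\<close>, and near infinity the remainder has higher
  order than \<open>\<bar>u\<bar> powr p\<close>; so only the leading term can lose mass in the limit.\<close>

lemma remainder_int_upper_semicontinuous:
  assumes \<mu>: "\<mu> < \<alpha> + 1"
    and P: "\<And>n. primitive_pair (U n) (g n)" and E: "\<And>n. wint p (p - 1) (g n) \<le> 1" "\<And>n. wint p \<alpha> (U n) \<le> 1"
    and conv: "\<And>r. r > 0 \<Longrightarrow> (\<lambda>n. U n r) \<longlonglongrightarrow> U0 r" and U0[measurable]: "U0 \<in> borel_measurable borel"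
    and e: "e > 0"
  shows "\<exists>X x. X \<longlonglongrightarrow> x \<and> (\<forall>n. remainder_int (U n) \<le> X n + ennreal e) \<and> x \<le> remainder_int U0"
proof -
  note [measurable] = primitive_pairD(1)[OF P]
  define C where "C = \<mu> powr p / Gamma p * exp \<mu>"
  have C: "C > 0" using p2 \<mu>0 by (simp add: C_def)
  \<comment> \<open>Chosen so that \<open>\<bar>x\<bar> \<le> \<eta>\<close> implies
    \<open>remainder x \<le> e * \<bar>x\<bar> powr p\<close>: the bound 1 controls the exponential
    inside \<open>C\<close>, the other one gives \<open>C * \<eta> powr p' \<le> e\<close>.\<close>
  define \<eta> where "\<eta> = min 1 ((e / C) powr (1 / p'))"
  have \<eta>: "\<eta> > 0" "\<eta> \<le> 1" using e C by (auto simp: \<eta>_def)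
  have "\<eta> powr p' \<le> ((e / C) powr (1 / p')) powr p'"
    using \<eta> p'_facts(1) by (intro powr_mono2) (auto simp: \<eta>_def)
  also have "\<dots> = e / C" using e C p'_facts(1) by (simp add: powr_powr)
  finally have \<eta>e: "C * \<eta> powr p' \<le> e" using C by (simp add: field_simps)
  obtain T where T: "T > 0" "\<And>U g r. primitive_pair U g \<Longrightarrow> wint p (p - 1) g \<le> 1 \<Longrightarrow> wint p \<alpha> U \<le> 1 \<Longrightarrow> r \<ge> T \<Longrightarrow> \<bar>U r\<bar> \<le> \<eta>"
    using uniform_decay[OF \<eta>(1)] by metis
  obtain w where w[measurable]: "w \<in> borel_measurable borel" and w': "(\<integral>\<^sup>+r. ennreal (w r) * indicator {0<..T} r \<partial>lborel) < \<infinity>"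
    "\<And>U g r. primitive_pair U g \<Longrightarrow> wint p (p - 1) g \<le> 1 \<Longrightarrow> wint p \<alpha> U \<le> 1 \<Longrightarrow> 0 < r \<Longrightarrow> r \<le> T \<Longrightarrow>
       remainder (U r) * r powr \<alpha> \<le> w r"
    using remainder_dominated_near_zero[OF \<mu> T(1)] by metis
  \<comment> \<open>The mass on \<open>(0, T]\<close> converges by domination; the mass beyond
    \<open>T\<close> is at most \<open>e\<close> because the weighted norm is at most 1.\<close>
  define near where "near V = (\<integral>\<^sup>+r. ennreal (remainder (V r) * r powr \<alpha>) * indicator {0<..T} r \<partial>lborel)" for V
  show ?thesis
  proof (intro exI[of _ "\<lambda>n. near (U n)"] exI[of _ "near U0"] conjI allI)
    show "(\<lambda>n. near (U n)) \<longlonglongrightarrow> near U0"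
      unfolding near_def
    proof (rule nn_integral_dominated_convergence[where w = "\<lambda>r. ennreal (w r) * indicator {0<..T} r"])
      show "AE r in lborel. ennreal (remainder (U n r) * r powr \<alpha>) * indicator {0<..T} r \<le> ennreal (w r) * indicator {0<..T} r" for n
        using w'(2)[OF P E] by (intro AE_I2) (auto simp: indicator_def intro!: ennreal_leI)
      show "AE r in lborel. (\<lambda>n. ennreal (remainder (U n r) * r powr \<alpha>) * indicator {0<..T} r)
          \<longlonglongrightarrow> ennreal (remainder (U0 r) * r powr \<alpha>) * indicator {0<..T} r"
      proof (rule AE_I2)
        fix r
        show "(\<lambda>n. ennreal (remainder (U n r) * r powr \<alpha>) * indicator {0<..T} r)
          \<longlonglongrightarrow> ennreal (remainder (U0 r) * r powr \<alpha>) * indicator {0<..T} r"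
        proof (cases "r \<in> {0<..T}")
          case True
          have "isCont remainder (U0 r)"
            using remainder_continuous by (simp add: continuous_on_eq_continuous_at)
          from isCont_tendsto_compose[OF this conv[of r]] True
          have "(\<lambda>n. remainder (U n r)) \<longlonglongrightarrow> remainder (U0 r)" by simp
          then have "(\<lambda>n. ennreal (remainder (U n r) * r powr \<alpha>)) \<longlonglongrightarrow> ennreal (remainder (U0 r) * r powr \<alpha>)"
            by (intro tendsto_intros)
          then show ?thesis using True by simp
        qed simp
      qed
    qed (use w'(1) in auto)
    show "near U0 \<le> remainder_int U0"
      unfolding near_def remainder_int_def by (intro nn_integral_mono) (auto simp: indicator_def)
    fix n
    have "remainder_int (U n) \<le> (\<integral>\<^sup>+r. ennreal (remainder (U n r) * r powr \<alpha>) * indicator {0<..T} r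
         + ennreal e * (ennreal (\<bar>U n r\<bar> powr p * r powr \<alpha>) * indicator {0<..} r) \<partial>lborel)"
      unfolding remainder_int_def
    proof (rule nn_integral_mono)
      fix r
      show "ennreal (remainder (U n r) * r powr \<alpha>) * indicator {0<..} r \<le> ennreal (remainder (U n r) * r powr \<alpha>) * indicator {0<..T} r
         + ennreal e * (ennreal (\<bar>U n r\<bar> powr p * r powr \<alpha>) * indicator {0<..} r)"
      proof (cases "r > T")
        case True
        define x where "x = \<bar>U n r\<bar>"
        have x: "0 \<le> x" "x \<le> \<eta>" using T(2)[OF P E, of r n] True by (auto simp: x_def)
        have "x powr p' \<le> 1 powr p'" using x \<eta> p'_facts(1) by (intro powr_mono2) auto
        then have "\<mu> * x powr p' \<le> \<mu> * 1" using \<mu>0 by (intro mult_left_mono) auto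
        then have ex: "exp (\<mu> * x powr p') \<le> exp \<mu>" by simp
        have "x powr (p + p') = x powr p * x powr p'" by (simp add: powr_add)
        also have "\<dots> \<le> x powr p * \<eta> powr p'" using x p'_facts(1) by (intro mult_left_mono powr_mono2) auto
        finally have "x powr (p + p') * exp (\<mu> * x powr p') \<le> (x powr p * \<eta> powr p') * exp \<mu>"
          using ex by (intro mult_mono) auto
        then have "\<mu> powr p / Gamma p * (x powr (p + p') * exp (\<mu> * x powr p')) \<le> \<mu> powr p / Gamma p * ((x powr p * \<eta> powr p') * exp \<mu>)"
          using p2 by (intro mult_left_mono) auto
        then have "remainder (U n r) \<le> C * \<eta> powr p' * x powr p"
          using remainder_le[of "U n r"] by (simp add: x_def C_def mult_ac)
        also have "\<dots> \<le> e * x powr p" using \<eta>e by (intro mult_right_mono) auto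
        finally have "remainder (U n r) * r powr \<alpha> \<le> e * x powr p * r powr \<alpha>" by (intro mult_right_mono) auto
        then have "ennreal (remainder (U n r) * r powr \<alpha>) \<le> ennreal e * ennreal (\<bar>U n r\<bar> powr p * r powr \<alpha>)"
          using e by (simp add: x_def ennreal_mult[symmetric] ennreal_leI mult.assoc)
        then show ?thesis using True T(1) by simp
      next
        case False
        then show ?thesis by (auto simp: indicator_def)
      qed
    qed
    also have "\<dots> = near (U n) + ennreal e * wint p \<alpha> (U n)"
      unfolding near_def wint_def by (subst nn_integral_add) (auto simp: nn_integral_cmult)
    also have "\<dots> \<le> near (U n) + ennreal e * 1"
      using E by (intro add_left_mono mult_left_mono) auto
    finally show "remainder_int (U n) \<le> near (U n) + ennreal e" by simp
  qed
qed

subsection \<open>Existence of maximizers\<close>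

lemma maximizer_exists:
  assumes \<mu>: "\<mu> < \<alpha> + 1"
    and gap: "primitive_pair U1 g1" "energy U1 g1 = 1" "TM_functional p \<alpha> \<mu> U1 > ennreal lead_const"
  shows "\<exists>U g. primitive_pair U g \<and> energy U g = 1 \<and>
    (\<forall>V h. primitive_pair V h \<longrightarrow> energy V h = 1 \<longrightarrow> TM_functional p \<alpha> \<mu> V \<le> TM_functional p \<alpha> \<mu> U)"
proof -
  let ?F = "TM_functional p \<alpha> \<mu>"
  define S where "S = {U. \<exists>g. primitive_pair U g \<and> energy U g = 1}"
  define d where "d = Sup (?F ` S)"
  have le_d: "?F V \<le> d" if "primitive_pair V h" "energy V h = 1" for V h
    unfolding d_def using that by (intro SUP_upper) (auto simp: S_def)
  have "?F ` S \<noteq> {}" using gap by (auto simp: S_def)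
  from ennreal_Sup_countable_SUP[OF this]
  obtain f :: "nat \<Rightarrow> ennreal" where f: "incseq f" "range f \<subseteq> ?F ` S" "d = (SUP i. f i)" by (auto simp: d_def)
  have f_lim: "f \<longlonglongrightarrow> d" unfolding f(3) by (rule LIMSEQ_SUP[OF f(1)])
  have "\<exists>U g. primitive_pair U g \<and> energy U g = 1 \<and> f n = ?F U" for n
  proof -
    have "f n \<in> ?F ` S" using f(2) by blast
    then show ?thesis by (auto simp: S_def)
  qed
  then obtain U g where U: "\<And>n. primitive_pair (U n) (g n)" "\<And>n. energy (U n) (g n) = 1" "\<And>n. f n = ?F (U n)"
    by metis
  have E: "wint p (p - 1) (g n) \<le> 1" "wint p \<alpha> (U n) \<le> 1" for n
    using U(2)[of n] unfolding energy_def by (metis le_iff_add add.commute)+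
  obtain k :: "nat \<Rightarrow> nat" and U0 :: "real \<Rightarrow> real" where k: "strict_mono k"
    "\<And>r. r > 0 \<Longrightarrow> (\<lambda>n. U (k n) r) \<longlonglongrightarrow> U0 r" "\<And>r. r \<le> 0 \<Longrightarrow> U0 r = 0"
    using pointwise_convergent_subsequence[of U g, OF U(1) E] by blast
  define A where "A n = enn2real (wint p (p - 1) (g n))" for n
  have wA: "wint p (p - 1) (g n) = ennreal (A n)" and A01: "A n \<in> {0..1}" for n
  proof -
    have "wint p (p - 1) (g n) < top" using E(1)[of n] by (rule order_le_less_trans) simp
    then show wA: "wint p (p - 1) (g n) = ennreal (A n)" by (simp add: A_def)
    have "A n \<ge> 0" by (simp add: A_def)
    then show "A n \<in> {0..1}" using E(1)[of n] unfolding wA by simp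
  qed
  have wB: "wint p \<alpha> (U n) = ennreal (1 - A n)" for n
  proof -
    have "ennreal (A n) + wint p \<alpha> (U n) = ennreal 1" using U(2)[of n] by (simp add: energy_def wA)
    then show ?thesis using A01[of n]
      by (cases "wint p \<alpha> (U n)") (auto simp: ennreal_plus[symmetric] simp del: ennreal_plus)
  qed
  obtain a l where a: "a \<in> {0..1}" "strict_mono (l :: nat \<Rightarrow> nat)" "(A \<circ> k \<circ> l) \<longlonglongrightarrow> a"
  proof -
    have "seq_compact {0..1::real}" by (rule compact_imp_seq_compact) simp
    moreover have "\<forall>n. (A \<circ> k) n \<in> {0..1}" using A01 by (simp del: atLeastAtMost_iff)
    ultimately show ?thesis using that by (rule seq_compactE) (simp del: atLeastAtMost_iff add: o_def)
  qed
  define m where "m n = k (l n)" for n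
  have sm: "strict_mono m" unfolding m_def using strict_mono_o[OF k(1) a(2)] by (simp add: o_def)
  have Um: "(\<lambda>n. U (m n) r) \<longlonglongrightarrow> U0 r" if "r > 0" for r
    using LIMSEQ_subseq_LIMSEQ[OF k(2)[OF that] a(2)] by (simp add: o_def m_def)
  have Am: "(\<lambda>n. A (m n)) \<longlonglongrightarrow> a" using a(3) by (simp add: o_def m_def)
  have fm: "(\<lambda>n. ?F (U (m n))) \<longlonglongrightarrow> d"
    using LIMSEQ_subseq_LIMSEQ[OF f_lim sm] by (simp add: o_def U(3))
  obtain g0 where g0: "primitive_pair U0 g0" "wint p (p - 1) g0 \<le> ennreal a"
  proof (rule derivative_energy_lsc[of "\<lambda>n. U (m n)" "\<lambda>n. g (m n)" U0 "\<lambda>n. A (m n)" a])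
    show "wint p (p - 1) (g (m n)) \<le> ennreal (A (m n))" for n by (simp add: wA)
  qed (use U(1) Um k(3) Am in auto)
  note [measurable] = primitive_pairD(1)[OF g0(1)] primitive_pairD(1)[OF U(1)]
  \<comment> \<open>The limit of the weighted norms of the sequence, which may be larger than the
    weighted norm \<open>b0\<close> of its pointwise limit.\<close>
  define b where "b = 1 - a"
  have b: "b \<ge> 0" "b \<le> 1" using a(1) by (auto simp: b_def)
  have Bm: "(\<lambda>n. 1 - A (m n)) \<longlonglongrightarrow> b" unfolding b_def by (intro tendsto_intros Am)
  have U0_le: "wint p \<alpha> U0 \<le> ennreal b"
  proof -
    have "wint p \<alpha> U0 = (\<integral>\<^sup>+r. liminf (\<lambda>n. ennreal (\<bar>U (m n) r\<bar> powr p * r powr \<alpha>) * indicator {0<..} r) \<partial>lborel)"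
      unfolding wint_def
    proof (rule nn_integral_cong)
      fix r
      show "ennreal (\<bar>U0 r\<bar> powr p * r powr \<alpha>) * indicator {0<..} r =
          liminf (\<lambda>n. ennreal (\<bar>U (m n) r\<bar> powr p * r powr \<alpha>) * indicator {0<..} r)"
      proof (cases "r > 0")
        case True
        have "(\<lambda>n. ennreal (\<bar>U (m n) r\<bar> powr p * r powr \<alpha>)) \<longlonglongrightarrow> ennreal (\<bar>U0 r\<bar> powr p * r powr \<alpha>)"
          using p2 Um[OF True] by (intro tendsto_ennrealI tendsto_mult tendsto_powr' tendsto_const tendsto_rabs) auto
        from lim_imp_Liminf[OF _ this] True show ?thesis by simp
      next
        case False
        then show ?thesis by (simp add: Liminf_const)
      qed
    qed
    also have "\<dots> \<le> liminf (\<lambda>n. wint p \<alpha> (U (m n)))"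
      unfolding wint_def by (rule nn_integral_liminf) measurable
    also have "\<dots> = ennreal b"
      unfolding wB by (intro lim_imp_Liminf tendsto_ennrealI Bm) simp
    finally show ?thesis .
  qed
  \<comment> \<open>The leading term keeps the full limit \<open>b\<close>; only the remainder is
    evaluated at \<open>U0\<close>, with an arbitrarily small error.\<close>
  have d_le: "d \<le> ennreal (lead_const * b) + remainder_int U0"
  proof (rule ennreal_le_epsilon)
    fix e :: real assume e: "e > 0"
    have "\<exists>X x. X \<longlonglongrightarrow> x \<and> (\<forall>n. remainder_int (U (m n)) \<le> X n + ennreal e) \<and> x \<le> remainder_int U0"
      by (rule remainder_int_upper_semicontinuous[of "\<lambda>n. U (m n)" "\<lambda>n. g (m n)" U0 e, OF \<mu> U(1) E Um _ e]) auto
    then obtain X x where X: "X \<longlonglongrightarrow> x" "\<And>n. remainder_int (U (m n)) \<le> X n + ennreal e" "x \<le> remainder_int U0"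
      by blast
    have "d \<le> ennreal (lead_const * b) + (x + ennreal e)"
    proof (rule LIMSEQ_le[OF fm])
      show "(\<lambda>n. ennreal (lead_const * (1 - A (m n))) + (X n + ennreal e)) \<longlonglongrightarrow> ennreal (lead_const * b) + (x + ennreal e)"
        by (intro tendsto_add tendsto_ennrealI tendsto_mult tendsto_const Bm X(1))
      have "?F (U (m n)) \<le> ennreal (lead_const * (1 - A (m n))) + (X n + ennreal e)" for n
        using X(2)[of n] lead_const_pos by (simp add: TM_functional_split wB ennreal_mult' add_left_mono)
      then show "\<exists>N. \<forall>n\<ge>N. ?F (U (m n)) \<le> ennreal (lead_const * (1 - A (m n))) + (X n + ennreal e)" by blast
    qed
    also have "\<dots> \<le> ennreal (lead_const * b) + remainder_int U0 + ennreal e"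
      using X(3) by (simp add: add.assoc add_left_mono add_right_mono)
    finally show "d \<le> ennreal (lead_const * b) + remainder_int U0 + ennreal e" .
  qed
  obtain b0 where b0: "wint p \<alpha> U0 = ennreal b0" "0 \<le> b0" "b0 \<le> b"
    using U0_le b by (cases "wint p \<alpha> U0") (auto simp: top_unique)
  have "b0 \<noteq> 0"
  proof
    assume "b0 = 0"
    then have ae: "AE r in lborel. r > 0 \<longrightarrow> U0 r = 0" using b0(1) wint_zero_iff[of U0 p \<alpha>] by simp
    have "remainder_int U0 = 0"
      unfolding remainder_int_def
    proof (subst nn_integral_0_iff_AE)
      show "AE r in lborel. ennreal (remainder (U0 r) * r powr \<alpha>) * indicator {0<..} r = 0"
        using ae by eventually_elim (auto simp: indicator_def remainder_zero)
    qed measurable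
    then have "d \<le> ennreal (lead_const * b)" using d_le by simp
    also have "\<dots> \<le> ennreal lead_const"
      using b lead_const_pos by (intro ennreal_leI mult_left_le) auto
    finally show False using gap(3) le_d[OF gap(1,2)] by simp
  qed
  then have b0_pos: "b0 > 0" "b > 0" using b0 by auto
  define x where "x = b / b0"
  have x: "x \<ge> 1" "x > 0" "x * b0 = b" using b0 b0_pos by (auto simp: x_def)
  define s where "s = x powr (- (1 / (\<alpha> + 1)))"
  define V where "V r = U0 (s * r)" for r
  define h where "h r = s * g0 (s * r)" for r
  have V: "primitive_pair V h" "wint p (p - 1) h = wint p (p - 1) g0" "wint p \<alpha> V = ennreal b"
    "remainder_int V = ennreal x * remainder_int U0"
    using rescale_energy[OF g0(1) x(2)] b0 x by (simp_all add: V_def[abs_def] h_def[abs_def] s_def ennreal_mult[symmetric])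
  note [measurable] = primitive_pairD(1)[OF V(1)]
  have "d \<le> ennreal (lead_const * b) + remainder_int U0" by (rule d_le)
  also have "remainder_int U0 \<le> remainder_int V"
    unfolding V(4) using mult_right_mono[of 1 "ennreal x" "remainder_int U0"] x(1) by simp
  also have "ennreal (lead_const * b) + remainder_int V = ?F V"
    using lead_const_pos V(3) by (simp add: TM_functional_split ennreal_mult')
  finally have dV: "d \<le> ?F V" by simp
  have "energy V h \<le> ennreal a + ennreal b" unfolding energy_def V(2,3) by (intro add_right_mono g0(2))
  also have "\<dots> = 1" using a(1) b by (simp add: b_def ennreal_plus[symmetric] del: ennreal_plus)
  finally have E1: "energy V h \<le> 1" .
  define e where "e = enn2real (energy V h)"
  have e: "energy V h = ennreal e"
  proof -
    have "energy V h < top" using E1 by (rule order_le_less_trans) simp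
    then show ?thesis by (simp add: e_def)
  qed
  \<comment> \<open>The energy of \<open>V\<close> may lie below 1, as derivative energy can be lost
    in the limit. It is positive since \<open>b > 0\<close>, so \<open>V\<close> can be
    normalized.\<close>
  have "ennreal b \<le> energy V h" unfolding energy_def V(3) by simp
  then have e01: "e > 0" "e \<le> 1" using E1 e b0_pos
    by (auto simp: ennreal_le_iff2)
  define \<kappa> where "\<kappa> = e powr (- (1 / p))"
  note N = normalize_energy[OF V(1) e e01(1), folded \<kappa>_def]
  have "?F V \<le> ?F (\<lambda>r. \<kappa> * V r)"
  proof (rule TM_functional_mono)
    show "\<bar>V r\<bar> \<le> \<bar>\<kappa> * V r\<bar>" for r
      using N(4)[OF e01(2)] mult_right_mono[of 1 "\<bar>\<kappa>\<bar>" "\<bar>V r\<bar>"] by (simp add: abs_mult)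
  qed
  then show ?thesis
    using N(1,2) order_trans[OF le_d order_trans[OF dV]] by blast
qed

section \<open>Raising the functional above the leading constant by dilation\<close>

text \<open>Dilation makes the energy \<open>S = A + x * B\<close>. After normalization the leading
  term misses \<open>lead_const\<close> by \<open>lead_const * A / S\<close>, while the second term
  contributes at least a multiple of \<open>x * D / S powr (1 + p' / p)\<close>; the last hypothesis
  compares the two. \<open>D\<close> is a lower bound so that an infinite integral is covered as
  well.\<close>

lemma functional_exceeds_lead_const:
  assumes P: "primitive_pair U g" and A: "wint p (p - 1) g = ennreal A" "A \<ge> 0"
    and B: "wint p \<alpha> U = ennreal B" "B > 0"
    and D: "ennreal D \<le> wint (p + p') \<alpha> U"
    and x: "x > 0" "\<mu> powr p / Gamma (p + 1) * (x * D) > lead_const * A * (A + x * B) powr (p' / p)"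
  shows "\<exists>V h. primitive_pair V h \<and> energy V h = 1 \<and> TM_functional p \<alpha> \<mu> V > ennreal lead_const"
proof -
  define s where "s = x powr (- (1 / (\<alpha> + 1)))"
  define W where "W r = U (s * r)" for r
  define k where "k r = s * g (s * r)" for r
  define S where "S = A + x * B"
  have S: "S > 0" using A B x by (simp add: S_def add_nonneg_pos)
  have W: "primitive_pair W k" "wint p (p - 1) k = wint p (p - 1) g" "wint q \<alpha> W = ennreal x * wint q \<alpha> U" for q
    using rescale_energy(1,2)[OF P x(1)] rescale_energy(3)[OF P x(1), of q]
    by (simp_all add: W_def[abs_def] k_def[abs_def] s_def)
  have EW: "energy W k = ennreal S"
    unfolding energy_def W(2,3) A(1) B(1) S_def using A B x
    by (simp add: ennreal_mult[symmetric] ennreal_plus[symmetric] del: ennreal_plus)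
  define \<kappa> where "\<kappa> = S powr (- (1 / p))"
  note N = normalize_energy[OF W(1) EW S, folded \<kappa>_def]
  define V where "V r = \<kappa> * W r" for r
  have [measurable]: "V \<in> borel_measurable borel"
    using primitive_pairD(1)[OF N(1)] by (simp add: V_def[abs_def])
  define c2 where "c2 = \<mu> powr p / Gamma (p + 1)"
  have c2: "c2 \<ge> 0" using p2 by (simp add: c2_def)
  \<comment> \<open>Positivity is forced by the strict inequality for \<open>x\<close>, whose
    smaller side is nonnegative.\<close>
  have D0: "D > 0"
  proof -
    have "0 \<le> lead_const * A * (A + x * B) powr (p' / p)" using lead_const_pos A by simp
    then have "c2 * (x * D) > 0" using x(2) unfolding c2_def by linarith
    then show ?thesis using c2 x(1) by (simp add: zero_less_mult_iff)
  qed
  have e1: "- (p / p) = - 1" "- ((p + p') / p) = - 1 - p' / p" using p2 by (auto simp: add_divide_distrib)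
  have wV: "wint p \<alpha> V = ennreal (x * B / S)"
    unfolding V_def N(3) W(3) B(1) e1 using x B S by (simp add: ennreal_mult[symmetric] powr_minus_divide)
  have wV': "ennreal (S powr (- 1 - p' / p) * (x * D)) \<le> wint (p + p') \<alpha> V"
  proof -
    have "ennreal (S powr (- 1 - p' / p) * (x * D)) = ennreal (S powr (- 1 - p' / p)) * (ennreal x * ennreal D)"
      using x D0 by (simp add: ennreal_mult)
    also have "\<dots> \<le> wint (p + p') \<alpha> V"
      unfolding V_def N(3) W(3) e1 by (intro mult_left_mono D) auto
    finally show ?thesis .
  qed
  have "lead_const * A < c2 * (S powr (- (p' / p)) * (x * D))"
  proof -
    have "lead_const * A = S powr (- (p' / p)) * (lead_const * A * S powr (p' / p))"
      using S by (simp add: powr_minus)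
    also have "\<dots> < S powr (- (p' / p)) * (c2 * (x * D))"
      using x(2) S by (intro mult_strict_left_mono) (auto simp: S_def c2_def)
    finally show ?thesis by (simp add: mult_ac)
  qed
  then have "lead_const * S < lead_const * (x * B) + c2 * (S powr (- (p' / p)) * (x * D))"
    by (simp add: S_def algebra_simps)
  then have "lead_const < (lead_const * (x * B) + c2 * (S powr (- (p' / p)) * (x * D))) / S"
    using S by (simp add: pos_less_divide_eq)
  also have "\<dots> = lead_const * (x * B / S) + c2 * (S powr (- 1 - p' / p) * (x * D))"
  proof -
    have "S powr (- 1 - p' / p) = S powr (- (p' / p)) / S" using S by (simp add: powr_diff powr_minus_divide)
    then show ?thesis by (simp add: add_divide_distrib)
  qed
  finally have "ennreal lead_const < ennreal (lead_const * (x * B / S) + c2 * (S powr (- 1 - p' / p) * (x * D)))"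
    using lead_const_pos by (simp add: ennreal_less_iff)
  also have "\<dots> = ennreal lead_const * wint p \<alpha> V + ennreal c2 * ennreal (S powr (- 1 - p' / p) * (x * D))"
  proof -
    have sum: "ennreal (a * u + b * v) = ennreal a * ennreal u + ennreal b * ennreal v"
      if "a \<ge> 0" "b \<ge> 0" "u \<ge> 0" "v \<ge> 0" for a b u v
      using that by (simp add: ennreal_mult ennreal_plus)
    show ?thesis unfolding wV by (rule sum) (use lead_const_pos c2 x(1) B S D0 in auto)
  qed
  also have "\<dots> \<le> ennreal lead_const * wint p \<alpha> V + ennreal c2 * wint (p + p') \<alpha> V"
    by (intro add_left_mono mult_left_mono wV') auto
  also have "\<dots> \<le> TM_functional p \<alpha> \<mu> V"
    unfolding c2_def by (subst TM_functional_split) (auto intro!: add_left_mono remainder_int_ge)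
  finally have "ennreal lead_const < TM_functional p \<alpha> \<mu> V" .
  then show ?thesis using N(1,2) by (auto simp: V_def[abs_def])
qed

section \<open>From primitive pairs back to the function space\<close>

lemma energy_eq_1_iff_X_norm:
  assumes P: "primitive_pair U g" and "AE r in lborel. r > 0 \<longrightarrow> u r = U r" "AE r in lborel. r > 0 \<longrightarrow> weak_deriv u r = g r"
  shows "X_norm p \<alpha> u = 1 \<longleftrightarrow> energy U g = 1"
  using X_norm_eq_1[of p \<alpha> u] wint_cong_AE[OF assms(2)] wint_cong_AE[OF assms(3)] p2
  by (simp add: energy_def)

text \<open>Every competitor agrees almost everywhere with a primitive pair of the same norm and
  functional, so maximality among pairs is maximality in the space.\<close>

lemma TM_attainedI:
  assumes \<mu>: "\<mu> < \<alpha> + 1"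
    and gap: "\<exists>V h. primitive_pair V h \<and> energy V h = 1 \<and> TM_functional p \<alpha> \<mu> V > ennreal lead_const"
  shows "TM_attained p \<alpha> \<mu>"
proof -
  obtain U g where U: "primitive_pair U g" "energy U g = 1"
    "\<And>V h. primitive_pair V h \<Longrightarrow> energy V h = 1 \<Longrightarrow> TM_functional p \<alpha> \<mu> V \<le> TM_functional p \<alpha> \<mu> U"
    using maximizer_exists[OF \<mu>] gap by metis
  have fin: "wint p \<alpha> U < \<infinity>" "wint p (p - 1) g < \<infinity>"
  proof -
    have "energy U g < top" using U(2) by simp
    then show "wint p \<alpha> U < \<infinity>" "wint p (p - 1) g < \<infinity>" by (auto simp: energy_def)
  qed
  have X: "U \<in> X_space p \<alpha>" by (rule primitive_pair_in_X_space[OF U(1) fin])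
  have N: "X_norm p \<alpha> U = 1"
    using energy_eq_1_iff_X_norm[OF U(1) _ primitive_pair_weak_deriv(2)[OF U(1)]] U(2) by simp
  have "TM_sup p \<alpha> \<mu> \<le> TM_functional p \<alpha> \<mu> U"
    unfolding TM_sup_def
  proof (rule SUP_least)
    fix u assume "u \<in> {u \<in> X_space p \<alpha>. X_norm p \<alpha> u = 1}"
    then have u: "u \<in> X_space p \<alpha>" "X_norm p \<alpha> u = 1" by auto
    obtain V h where V: "primitive_pair V h" "AE r in lborel. r > 0 \<longrightarrow> u r = V r" "AE r in lborel. r > 0 \<longrightarrow> weak_deriv u r = h r"
      using X_space_imp_primitive_pair[OF u(1)] .
    then show "TM_functional p \<alpha> \<mu> u \<le> TM_functional p \<alpha> \<mu> U"
      using U(3)[OF V(1)] energy_eq_1_iff_X_norm[OF V] u(2) TM_functional_cong_AE[OF V(2)] by simp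
  qed
  moreover have "TM_functional p \<alpha> \<mu> U \<le> TM_sup p \<alpha> \<mu>"
    unfolding TM_sup_def using X N by (intro SUP_upper) auto
  ultimately show ?thesis unfolding TM_attained_def using X N by (auto intro: antisym)
qed

text \<open>A concrete nonzero element: since \<open>p \<ge> 1\<close>, both integrals are dominated
  by Gamma integrals, convergent because the weights have exponents above -1.\<close>

lemma primitive_pair_exp:
  defines "U \<equiv> \<lambda>r. if r > 0 then exp (- r) else (0::real)" and "g \<equiv> \<lambda>r. - exp (- r :: real)"
  shows "primitive_pair U g" "wint p \<alpha> U < \<infinity>" "wint p (p - 1) g < \<infinity>" "wint q \<alpha> U \<noteq> 0"
proof -
  show "primitive_pair U g"
    unfolding primitive_pair_def
  proof (intro conjI allI impI)
    fix s t :: real assume st: "0 < s" "s \<le> t"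
    show "set_integrable lborel {s..t} g"
      unfolding set_integrable_def g_def by (intro borel_integrable_compact continuous_intros) auto
    have "(\<integral>x. g x * indicator {s..t} x \<partial>lborel) = exp (- t) - exp (- s)"
      unfolding g_def
      by (rule integral_FTC_Icc_real[OF st(2)]) (auto intro!: derivative_eq_intros continuous_intros)
    then show "U t - U s = (LINT r:{s..t}|lborel. g r)"
      using st by (simp add: U_def set_lebesgue_integral_def mult.commute)
  qed (auto simp: U_def g_def)
  then have [measurable]: "U \<in> borel_measurable borel" "g \<in> borel_measurable borel"
    by (auto dest: primitive_pairD(1,2))
  have fin: "wint p \<theta> f < \<infinity>" if \<theta>: "\<theta> > -1" and f: "\<And>r. r > 0 \<Longrightarrow> \<bar>f r\<bar> = exp (- r)" for \<theta> f
  proof -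
    have "wint p \<theta> f \<le> (\<integral>\<^sup>+r. ennreal (indicator {0..} r * r powr ((\<theta> + 1) - 1) / exp r) \<partial>lborel)"
      unfolding wint_def
    proof (rule nn_integral_mono)
      fix r :: real
      have "\<bar>f r\<bar> powr p * r powr \<theta> \<le> r powr \<theta> / exp r" if "r > 0"
      proof -
        have "exp (- r) powr p = exp (- r * p)" by (simp add: powr_def mult.commute)
        also have "\<dots> \<le> exp (- r)" using that p2 by simp
        finally have "\<bar>f r\<bar> powr p * r powr \<theta> \<le> exp (- r) * r powr \<theta>" using f[OF that] by (intro mult_right_mono) auto
        then show ?thesis by (simp add: exp_minus divide_inverse mult.commute)
      qed
      then show "ennreal (\<bar>f r\<bar> powr p * r powr \<theta>) * indicator {0<..} r \<le> ennreal (indicator {0..} r * r powr ((\<theta> + 1) - 1) / exp r)"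
        by (auto simp: indicator_def intro!: ennreal_leI)
    qed
    also have "\<dots> = ennreal (Gamma (\<theta> + 1))" using \<theta> by (intro Gamma_conv_nn_integral_real[symmetric]) simp
    finally show ?thesis by (simp add: order_le_less_trans)
  qed
  show "wint p \<alpha> U < \<infinity>" using \<alpha> by (intro fin) (auto simp: U_def)
  show "wint p (p - 1) g < \<infinity>" using p2 by (intro fin) (auto simp: g_def)
  show "wint q \<alpha> U \<noteq> 0"
  proof
    assume "wint q \<alpha> U = 0"
    then have "AE r in lborel. r > 0 \<longrightarrow> U r = 0" by (simp add: wint_zero_iff)
    then have "AE r in lborel. r \<notin> {0<..<1::real}" by eventually_elim (auto simp: U_def)
    then have "emeasure lborel {0<..<1::real} = 0"
      by (subst (asm) AE_iff_measurable[of "{0<..<1}"]) auto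
    then show False by simp
  qed
qed

text \<open>In the comparison of \<open>functional_exceeds_lead_const\<close> the gain is linear in
  \<open>x\<close> and the deficit has order \<open>x powr (p' / p)\<close>, with
  \<open>p' / p = 1 / (p - 1) < 1\<close>. Any nonzero function therefore works.\<close>

lemma gap_superquadratic:
  assumes p: "p > 2"
  shows "\<exists>V h. primitive_pair V h \<and> energy V h = 1 \<and> TM_functional p \<alpha> \<mu> V > ennreal lead_const"
proof -
  obtain U g where U: "primitive_pair U g" "wint p \<alpha> U < top" "wint p (p - 1) g < top" "\<And>q. wint q \<alpha> U \<noteq> 0"
    using primitive_pair_exp by (metis infinity_ennreal_def)
  obtain A where A: "wint p (p - 1) g = ennreal A" "A \<ge> 0" using U(3) by (cases "wint p (p - 1) g") auto
  obtain B where B: "wint p \<alpha> U = ennreal B" "B > 0"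
    using U(2) U(4)[of p] by (cases "wint p \<alpha> U") (auto simp: less_le)
  obtain D where D: "ennreal D \<le> wint (p + p') \<alpha> U" "D > 0"
  proof (cases "wint (p + p') \<alpha> U")
    case (real D)
    then show ?thesis using that[of D] U(4)[of "p + p'"] by (auto simp: less_le)
  next
    case top
    then show ?thesis using that[of 1] by auto
  qed
  define \<theta> where "\<theta> = p' / p"
  have \<theta>: "0 < \<theta>" "\<theta> < 1" unfolding \<theta>_def p'_facts(4) using p by auto
  define c2 where "c2 = \<mu> powr p / Gamma (p + 1)"
  have c2: "c2 > 0" using p \<mu>0 by (simp add: c2_def)
  define M where "M = lead_const * A * (A + B) powr \<theta> / (c2 * D)"
  have M: "M \<ge> 0" using lead_const_pos A c2 D by (simp add: M_def)
  \<comment> \<open>Since \<open>A + x * B \<le> x * (A + B)\<close> for \<open>x \<ge> 1\<close>,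
    it suffices that \<open>x powr (1 - \<theta>)\<close> exceeds the ratio
    \<open>M\<close>.\<close>
  define x where "x = (M + 1) powr (1 / (1 - \<theta>))"
  have x: "x \<ge> 1" "x powr (1 - \<theta>) = M + 1"
    using M \<theta> by (auto simp: x_def powr_powr intro: ge_one_powr_ge_zero)
  have "lead_const * A * (A + x * B) powr \<theta> \<le> lead_const * A * (x * (A + B)) powr \<theta>"
    using x(1) A B \<theta> lead_const_pos mult_right_mono[of 1 x A]
    by (intro mult_left_mono powr_mono2) (auto simp: distrib_left)
  also have "\<dots> = M * (c2 * D) * x powr \<theta>"
    using x(1) A B c2 D by (simp add: M_def powr_mult)
  also have "\<dots> < (M + 1) * (c2 * D) * x powr \<theta>"
    using c2 D x(1) by (intro mult_strict_right_mono) auto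
  also have "\<dots> = c2 * ((x powr (1 - \<theta>) * x powr \<theta>) * D)" by (simp add: x(2) mult_ac)
  also have "x powr (1 - \<theta>) * x powr \<theta> = x" using x(1) by (simp add: powr_add[symmetric])
  finally show ?thesis
    using functional_exceeds_lead_const[OF U(1) A B D(1), of x] x(1) by (simp add: \<theta>_def c2_def)
qed

text \<open>For \<open>p = 2\<close> both sides of the comparison are affine in \<open>x\<close>, so
  the slopes decide: \<open>A * B < D * \<mu> / 2\<close>. This is the statement that the quotient
  defining \<open>B2\<close> exceeds \<open>2 / \<mu>\<close> at the chosen function.\<close>

lemma gap_quadratic:
  assumes p: "p = 2" and B2: "2 / B2 \<alpha> < ennreal \<mu>"
  shows "\<exists>V h. primitive_pair V h \<and> energy V h = 1 \<and> TM_functional p \<alpha> \<mu> V > ennreal lead_const"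
proof -
  have p': "p' = 2" unfolding p'_def by (simp add: p)
  \<comment> \<open>Otherwise \<open>B2 \<alpha>\<close> is at most \<open>2 / \<mu>\<close>,
    against the hypothesis. The value 0 fits in, because \<open>2 / 0\<close> is infinite in
    \<open>ennreal\<close>.\<close>
  have "\<exists>u\<in>{u \<in> X_space 2 \<alpha>. \<not> (AE r in lebesgue_on {0<..}. u r = 0)}.
        ennreal (2 / \<mu>) < wnorm 4 \<alpha> u ^ 4 / (wnorm 2 1 (weak_deriv u) ^ 2 * wnorm 2 \<alpha> u ^ 2)"
  proof (rule ccontr)
    assume "\<not> ?thesis"
    then have "B2 \<alpha> \<le> ennreal (2 / \<mu>)"
      unfolding B2_def by (intro SUP_least) (auto simp: not_less)
    then have "ennreal \<mu> * B2 \<alpha> \<le> ennreal \<mu> * ennreal (2 / \<mu>)" by (intro mult_left_mono) auto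
    also have "\<dots> = 2" using \<mu>0 by (simp add: ennreal_mult[symmetric])
    finally have le: "ennreal \<mu> * B2 \<alpha> \<le> 2" .
    have "ennreal \<mu> \<le> 2 / B2 \<alpha>"
    proof (cases "B2 \<alpha>")
      case (real z)
      then have "ennreal (\<mu> * z) \<le> ennreal 2" using le \<mu>0 by (simp add: ennreal_mult)
      then have z: "\<mu> * z \<le> 2" by (subst (asm) ennreal_le_iff) auto
      show ?thesis
      proof (cases "z = 0")
        case False
        then have "ennreal 2 / ennreal z = ennreal (2 / z)" using real by (intro divide_ennreal) auto
        moreover have "\<mu> \<le> 2 / z" using z False real by (simp add: pos_le_divide_eq)
        ultimately show ?thesis using real by (simp add: ennreal_leI)
      qed (simp add: real)
    next
      case top
      then show ?thesis using le \<mu>0 by (simp add: ennreal_mult_top top_unique)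
    qed
    then show False using B2 by simp
  qed
  then obtain u where u: "u \<in> X_space 2 \<alpha>" "\<not> (AE r in lebesgue_on {0<..}. u r = 0)"
    "ennreal (2 / \<mu>) < wnorm 4 \<alpha> u ^ 4 / (wnorm 2 1 (weak_deriv u) ^ 2 * wnorm 2 \<alpha> u ^ 2)" by auto
  obtain U g where U: "primitive_pair U g" "AE r in lborel. r > 0 \<longrightarrow> u r = U r" "AE r in lborel. r > 0 \<longrightarrow> weak_deriv u r = g r"
    using X_space_imp_primitive_pair[OF u(1)] .
  have pow: "wnorm (real n) \<theta> v ^ n = wint (real n) \<theta> v" if "n > 0" for n \<theta> v
  proof (cases "wint (real n) \<theta> v")
    case (real z)
    then show ?thesis using that
      by (cases "z = 0") (auto simp: wnorm_eq_wint ennpowr_def ennreal_power powr_realpow[symmetric] powr_powr)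
  next
    case top
    then show ?thesis using that by (simp add: wnorm_eq_wint ennpowr_def power_eq_top_ennreal)
  qed
  note [measurable] = primitive_pairD(1)[OF U(1)]
  have fin: "wint 2 \<alpha> U < top" "wint 2 1 g < top"
    using u(1) wint_cong_AE[OF U(2), of 2 \<alpha>] wint_cong_AE[OF U(3), of 2 1]
    by (auto simp: X_space_def wLp_def wnorm_eq_wint ennpowr_less_top)
  have "\<not> (AE r in lborel. r > 0 \<longrightarrow> U r = 0)"
  proof
    assume "AE r in lborel. r > 0 \<longrightarrow> U r = 0"
    with U(2) have "AE r in lborel. r > 0 \<longrightarrow> u r = 0" by eventually_elim auto
    from AE_completion[OF this] have "AE r in lebesgue_on {0<..}. u r = 0"
      by (subst AE_restrict_space_iff) auto
    then show False using u(2) by simp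
  qed
  then have nz: "wint q \<alpha> U \<noteq> 0" for q by (simp add: wint_zero_iff)
  have ratio: "ennreal (2 / \<mu>) < wint 4 \<alpha> U / (wint 2 1 g * wint 2 \<alpha> U)"
    using u(3) pow[of 4 \<alpha> u] pow[of 2 1 "weak_deriv u"] pow[of 2 \<alpha> u]
      wint_cong_AE[OF U(2), of 2 \<alpha>] wint_cong_AE[OF U(2), of 4 \<alpha>] wint_cong_AE[OF U(3), of 2 1] by simp
  obtain A where A: "wint 2 1 g = ennreal A" "A \<ge> 0" using fin(2) by (cases "wint 2 1 g") auto
  obtain B where B: "wint 2 \<alpha> U = ennreal B" "B > 0"
    using fin(1) nz[of 2] by (cases "wint 2 \<alpha> U") (auto simp: less_le)
  obtain D where D: "ennreal D \<le> wint 4 \<alpha> U" "D > 0" "D * \<mu> / 2 > A * B"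
  proof (cases "wint 4 \<alpha> U")
    case (real D)
    then have D0: "D > 0" using nz[of 4] by (auto simp: less_le)
    show ?thesis
    \<comment> \<open>For \<open>A = 0\<close> the quotient has denominator 0, but the slope
      inequality only says that \<open>D\<close> is positive.\<close>
    proof (cases "A = 0")
      case True
      then show ?thesis using that[of D] real D0 \<mu>0 by auto
    next
      case False
      then have AB: "A * B > 0" using A B by simp
      have "ennreal (2 / \<mu>) < ennreal (D / (A * B))"
        using ratio A B AB real D0 by (simp add: ennreal_mult[symmetric] divide_ennreal)
      then have "2 / \<mu> < D / (A * B)" using \<mu>0 by (simp add: ennreal_less_iff)
      then have "D * \<mu> / 2 > A * B" using \<mu>0 AB by (simp add: field_simps)
      then show ?thesis using that[of D] real D0 by auto
    qed
  next
    case top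
    show ?thesis
    \<comment> \<open>An infinite integral admits any \<open>D\<close>; this one gives
      \<open>D * \<mu> / 2 = A * B + 1\<close>.\<close>
    proof (rule that[of "2 * (A * B + 1) / \<mu>"])
      show "2 * (A * B + 1) / \<mu> > 0" using A B \<mu>0 by (intro divide_pos_pos mult_pos_pos add_nonneg_pos) auto
      show "2 * (A * B + 1) / \<mu> * \<mu> / 2 > A * B" using \<mu>0 by simp
    qed (simp add: top)
  qed
  define \<delta> where "\<delta> = D * \<mu> / 2 - A * B"
  have \<delta>: "\<delta> > 0" using D by (simp add: \<delta>_def)
  \<comment> \<open>The claim amounts to \<open>A * A < x * \<delta>\<close>: the surplus of slope
    must outgrow the constant part of the deficit.\<close>
  define x where "x = A * A / \<delta> + 1"
  have x: "x > 0" using A \<delta> by (simp add: x_def add_nonneg_pos)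
  have "A * A < x * \<delta>" using \<delta> by (simp add: x_def field_simps)
  then have "A * (A + x * B) < \<mu> / 2 * (x * D)" by (simp add: \<delta>_def algebra_simps)
  then have "\<mu> * (A * (A + x * B)) < \<mu> * (\<mu> / 2 * (x * D))" using \<mu>0 by (rule mult_strict_left_mono)
  \<comment> \<open>\<open>Gamma 2 = 1\<close> here, and \<open>Gamma 3 = 2\<close> in the
    coefficient of the second term.\<close>
  moreover have "lead_const = \<mu>" unfolding lead_const_def using \<mu>0 Gamma_fact[of 1, where 'a = real] by (simp add: p)
  moreover have "\<mu> powr p / Gamma (p + 1) = \<mu> * (\<mu> / 2)"
    using \<mu>0 p Gamma_fact[of 2, where 'a = real] by (simp add: power2_eq_square numeral_2_eq_2)
  moreover have "(A + x * B) powr (p' / p) = A + x * B" using p p' A B x by simp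
  ultimately have "\<mu> powr p / Gamma (p + 1) * (x * D) > lead_const * A * (A + x * B) powr (p' / p)"
    by (simp only: mult.assoc)
  moreover have "p + p' = 4" using p p' by simp
  moreover have "wint p (p - 1) g = ennreal A" "wint p \<alpha> U = ennreal B" using A(1) B(1) by (simp_all add: p)
  ultimately show ?thesis
    using functional_exceeds_lead_const[OF U(1) _ A(2) _ B(2) _ x] D(1) by metis
qed

end

theorem theorem1p4:
  fixes p \<alpha>\<^sub>0 \<mu> :: real
  assumes "p \<ge> 2" and "\<alpha>\<^sub>0 > -1" and "\<mu> > 0"
  shows "(p > 2 \<and> \<mu> < \<alpha>\<^sub>0 + 1 \<longrightarrow> TM_attained p \<alpha>\<^sub>0 \<mu>) \<and>
         (p = 2 \<and> 2 / B2 \<alpha>\<^sub>0 < ennreal \<mu> \<and> \<mu> < \<alpha>\<^sub>0 + 1 \<longrightarrow> TM_attained p \<alpha>\<^sub>0 \<mu>)"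
proof -
  interpret trudinger_moser p \<alpha>\<^sub>0 \<mu> using assms by unfold_locales auto
  show ?thesis using TM_attainedI gap_superquadratic gap_quadratic by blast
qed

end
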